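(* Let $f:(0,\infty)\to(0,\infty)$ be a matrix concave function with $f(1)=1$, and let $A,B\in\mathcal{M}_n$ be two accretive matrices with $W(A),W(B)\subset S_\alpha$ for some $0\le\alpha<\pi/2$. Then for any $0\le t\le 1$, $$\mathfrak{R}\big(f(A)\nabla_tf(B)\big)+2r\sec^2(\alpha)\Big(f\big(\mathfrak{R}(A\nabla B)\big)-f(\mathfrak{R}A)\nabla f(\mathfrak{R}B)\Big)\le\sec^2(\alpha)\,\mathfrak{R}f(A\nabla_tB),$$ where $r=\min\{t,1-t\}$.
   Context: $\mathcal{M}_n$ is the algebra of complex $n\times n$ matrices; $\mathfrak{R}A=\frac{A+A^*}{2}$; $A$ is accretive if $\mathfrak{R}A>0$ (positive definite). Inequalities between Hermitian matrices are in the Loewner (positive semidefinite) order. $W(A)=\{\langle Ax,x\rangle:\|x\|=1\}$ is the numerical range, and $S_\alpha=\{z\in\mathbb{C}:\Re z>0,\ |\Im z|\le\tan(\alpha)\,\Re z\}$. $X\nabla_tY=(1-t)X+tY$ and $\nabla=\nabla_{1/2}$. Matrix concave means $f((1-\lambda)X+\lambda Y)\ge(1-\lambda)f(X)+\lambda f(Y)$ for all positive definite $X,Y$ of every size and $\lambda\in[0,1]$; such a positive $f$ on $(0,\infty)$ is matrix monotone and extends analytically to $\mathbb{C}\setminus(-\infty,0]$. For a matrix $X$ with no eigenvalue in $(-\infty,0]$ (in particular $X$ accretive), $f(X)=\frac{1}{2\pi i}\int_\Gamma f(z)(zI-X)^{-1}dz$, where $\Gamma$ is a simple closed curve in the domain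 of analyticity surrounding the eigenvalues of $X$. *)

theory Defs
  imports "HOL-Complex_Analysis.Complex_Analysis" "Jordan_Normal_Form.Spectral_Radius"
    "Jordan_Normal_Form.Schur_Decomposition"
begin

definition hermitian :: "complex mat \<Rightarrow> bool" where
  "hermitian A \<longleftrightarrow> square_mat A \<and> mat_adjoint A = A"

definition unitary_mat :: "complex mat \<Rightarrow> bool" where
  "unitary_mat U \<longleftrightarrow> square_mat U \<and>
     U * mat_adjoint U = 1\<^sub>m (dim_row U) \<and> mat_adjoint U * U = 1\<^sub>m (dim_row U)"

text \<open>The library product \<open>v \<bullet>c w\<close> is linear in its first argument, so the inner product of
  \<open>A x\<close> with \<open>x\<close> is \<open>(A *\<^sub>v x) \<bullet>c x\<close>, which is real when \<open>A\<close> is Hermitian.\<close>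

definition pos_semidef :: "complex mat \<Rightarrow> bool" where
  "pos_semidef A \<longleftrightarrow> hermitian A \<and>
     (\<forall>x \<in> carrier_vec (dim_row A). 0 \<le> Re ((A *\<^sub>v x) \<bullet>c x))"

definition pos_def :: "complex mat \<Rightarrow> bool" where
  "pos_def A \<longleftrightarrow> hermitian A \<and>
     (\<forall>x \<in> carrier_vec (dim_row A). x \<noteq> 0\<^sub>v (dim_row A) \<longrightarrow> 0 < Re ((A *\<^sub>v x) \<bullet>c x))"

definition loewner_le :: "complex mat \<Rightarrow> complex mat \<Rightarrow> bool" (infix \<open>\<le>\<^sub>L\<close> 50) where
  "X \<le>\<^sub>L Y \<longleftrightarrow> hermitian X \<and> hermitian Y \<and> dim_row X = dim_row Y \<and> pos_semidef (Y - X)"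

definition mat_Re :: "complex mat \<Rightarrow> complex mat" where
  "mat_Re A = (1 / 2) \<cdot>\<^sub>m (A + mat_adjoint A)"

definition accretive :: "complex mat \<Rightarrow> bool" where
  "accretive A \<longleftrightarrow> square_mat A \<and> pos_def (mat_Re A)"

definition numerical_range :: "complex mat \<Rightarrow> complex set" where
  "numerical_range A = {(A *\<^sub>v x) \<bullet>c x | x. x \<in> carrier_vec (dim_row A) \<and> x \<bullet>c x = 1}"

definition sector :: "real \<Rightarrow> complex set" where
  "sector \<alpha> = {z. 0 < Re z \<and> \<bar>Im z\<bar> \<le> tan \<alpha> * Re z}"

definition mat_mean :: "real \<Rightarrow> complex mat \<Rightarrow> complex mat \<Rightarrow> complex mat" where
  "mat_mean t X Y = complex_of_real (1 - t) \<cdot>\<^sub>m X + complex_of_real t \<cdot>\<^sub>m Y"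

text \<open>The functional calculus of a Hermitian matrix for an arbitrary real function, obtained by
  applying the function to the eigenvalues in a unitary diagonalization; the result does not
  depend on the diagonalization. This is the meaning of \<open>f X\<close> in the definition of matrix
  concavity, where \<open>f\<close> is not yet known to be analytic.\<close>

definition herm_fun :: "(real \<Rightarrow> real) \<Rightarrow> complex mat \<Rightarrow> complex mat" where
  "herm_fun f X = (THE M. \<exists>U d. unitary_mat U \<and> dim_row U = dim_row X \<and>
      X = U * mat_diag (dim_row X) (\<lambda>i. complex_of_real (d i)) * mat_adjoint U \<and>
      M = U * mat_diag (dim_row X) (\<lambda>i. complex_of_real (f (d i))) * mat_adjoint U)"

definition matrix_concave :: "(real \<Rightarrow> real) \<Rightarrow> bool" where
  "matrix_concave f \<longleftrightarrow> (\<forall>n. \<forall>X \<in> carrier_mat n n. \<forall>Y \<in> carrier_mat n n. \<forall>s \<in> {0..1}.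
      pos_def X \<longrightarrow> pos_def Y \<longrightarrow>
      mat_mean s (herm_fun f X) (herm_fun f Y) \<le>\<^sub>L herm_fun f (mat_mean s X Y))"

text \<open>The analytic extension of \<open>f\<close> from the positive half-line to the slit plane. It is unique
  there by the identity theorem; its existence is not assumed.\<close>

definition analytic_ext :: "(real \<Rightarrow> real) \<Rightarrow> complex \<Rightarrow> complex" where
  "analytic_ext f = (SOME F. F holomorphic_on (- \<real>\<^sub>\<le>\<^sub>0) \<and>
      (\<forall>x > 0. F (complex_of_real x) = complex_of_real (f x)))"

text \<open>Positively oriented simple closed curves in the slit plane with the eigenvalues of \<open>X\<close> in
  their interior. The interior then avoids the closed negative half-line as well, since that
  half-line is connected, unbounded and disjoint from the curve.\<close>

definition surrounds_spectrum :: "(real \<Rightarrow> complex) \<Rightarrow> complex mat \<Rightarrow> bool" where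
  "surrounds_spectrum \<Gamma> X \<longleftrightarrow> valid_path \<Gamma> \<and> simple_path \<Gamma> \<and> pathfinish \<Gamma> = pathstart \<Gamma> \<and>
     path_image \<Gamma> \<subseteq> - \<real>\<^sub>\<le>\<^sub>0 \<and> spectrum X \<subseteq> inside (path_image \<Gamma>) \<and>
     (\<forall>z \<in> inside (path_image \<Gamma>). winding_number \<Gamma> z = 1)"

definition resolvent :: "complex mat \<Rightarrow> complex \<Rightarrow> complex mat" where
  "resolvent X z = the (mat_inverse (z \<cdot>\<^sub>m 1\<^sub>m (dim_row X) - X))"

text \<open>The contour integral is taken entrywise; its value does not depend on the curve.\<close>

definition mat_fun :: "(real \<Rightarrow> real) \<Rightarrow> complex mat \<Rightarrow> complex mat" where
  "mat_fun f X = (THE M. \<exists>\<Gamma>. surrounds_spectrum \<Gamma> X \<and>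
      M = Matrix.mat (dim_row X) (dim_row X) (\<lambda>(i, j).
        1 / (2 * of_real pi * \<i>) *
          contour_integral \<Gamma> (\<lambda>z. analytic_ext f z * resolvent X z $$ (i, j))))"

end

theory Submission
  imports Defs "HOL-Real_Asymp.Real_Asymp"
begin

text \<open>
  For \<open>h(z) = z / (s + (1 - s) z)\<close> with \<open>0 \<le> s \<le> 1\<close> the inequality is elementary. Writing
  \<open>x = s w + (1 - s) X w\<close>, one has \<open>\<langle>h(X) x, x\<rangle> = \<langle>X w, x\<rangle>\<close>, and for positive definite \<open>X\<close> this is the
  minimum of \<open>s \<langle>X a, a\<rangle> + (1 - s) \<parallel>b\<parallel>\<^sup>2\<close> over \<open>x = s a + (1 - s) b\<close>. The minimum principle gives
  concavity of \<open>h\<close> and \<open>h(\<Re>A) \<le> \<Re>h(A)\<close>; a Cauchy-Schwarz argument in the inner product of \<open>\<Re>A\<close> gives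
  \<open>\<Re>h(A) \<le> sec\<^sup>2(\<alpha>) h(\<Re>A)\<close>. These combine to the claim, which is linear in \<open>h\<close>.

  The reduction to these \<open>h\<close> is Loewner's theorem, in the form that \<open>f\<close> is a locally uniform limit on
  the slit plane of convex combinations of them. By Montel's theorem it is enough to approximate \<open>f\<close> on
  finite sets. By separation this amounts to the positivity of a functional on polynomials that are
  nonnegative on the half-line; such polynomials are sums of squares and shifted squares, and on these
  the positivity is matrix monotonicity of \<open>f\<close> for a rank one perturbation of a diagonal matrix.
\<close>

section \<open>Divided differences\<close>

text \<open>The hypothesis speaks of \<open>herm_fun\<close>, defined by diagonalization, the
  conclusion of contour integrals; what links them are the scalar values of \<open>f\<close>. Matrix
  concavity is turned into inequalities between finitely many of these values, the inequalities into
  approximants from \<open>hmean_hull\<close>, and locally uniform convergence passes through a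
  contour integral. Finite mixtures and their limits take the place of a representing measure. The
  minimum principle is a statement about positive definite matrices, so every comparison is routed
  through the Hermitian parts: the passage from \<open>A\<close> and \<open>B\<close> to them costs
  the factor sec^2, concavity is used between them, and the return to the mean of \<open>A\<close>
  and \<open>B\<close> is free. The factor sec^2 is 1 + tan^2: with M = H (1 + i T), the operator T
  is self-adjoint in the inner product of H and bounded there by tan, so 1 + i T has squared norm at
  most 1 + tan^2. The factor 2r is a weight: a mean with weight t at most 1/2 is a mean with weight
  2t of one endpoint and the midpoint.\<close>

lemma lagrange_partial_fractions:
  fixes x :: "'i \<Rightarrow> real" and q :: "real poly"
  assumes fin: "finite I" and inj: "inj_on x I" and deg: "degree q < card I" and y: "y \<notin> x ` I"
  shows "(\<Sum>i\<in>I. poly q (x i) / ((\<Prod>l\<in>I-{i}. x i - x l) * (y - x i))) = poly q y / (\<Prod>i\<in>I. y - x i)"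
proof -
  define c where "c i = poly q (x i) / (\<Prod>l\<in>I-{i}. x i - x l)" for i
  \<comment> \<open>\<open>p\<close> is the Lagrange interpolant of \<open>q\<close> at the nodes.
    The degree bound forces \<open>p = q\<close>, and dividing the value at \<open>y\<close> by the
    nodal polynomial gives the partial fractions.\<close>
  define p where "p = (\<Sum>i\<in>I. Polynomial.smult (c i) (\<Prod>l\<in>I-{i}. [:- x l, 1:]))"
  have nz: "(\<Prod>l\<in>I-{i}. x i - x l) \<noteq> 0" if "i \<in> I" for i
    using fin inj that by (auto simp: inj_on_def)
  have polyp: "poly p u = (\<Sum>i\<in>I. c i * (\<Prod>l\<in>I-{i}. u - x l))" for u
    by (simp add: p_def poly_sum poly_prod)
  have "degree (Polynomial.smult (c i) (\<Prod>l\<in>I-{i}. [:- x l, 1:])) \<le> card I - 1" if "i \<in> I" for i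
  proof -
    have "degree (\<Prod>l\<in>I-{i}. [:- x l, 1:]) \<le> (\<Sum>l\<in>I-{i}. degree [:- x l, 1:])"
      by (rule degree_prod_sum_le[unfolded o_def]) (use fin in auto)
    also have "\<dots> = card I - 1" using fin that by simp
    finally show ?thesis using degree_smult_le order_trans by blast
  qed
  then have degp: "degree p \<le> card I - 1" unfolding p_def by (intro degree_sum_le fin) auto
  have val: "poly p (x j) = poly q (x j)" if j: "j \<in> I" for j
  proof -
    have "poly p (x j) = (\<Sum>i\<in>I. if i = j then c j * (\<Prod>l\<in>I-{j}. x j - x l) else 0)"
      unfolding polyp
    proof (rule sum.cong[OF refl])
      fix i assume "i \<in> I"
      show "c i * (\<Prod>l\<in>I-{i}. x j - x l) = (if i = j then c j * (\<Prod>l\<in>I-{j}. x j - x l) else 0)"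
        using fin j by (auto intro!: prod_zero)
    qed
    also have "\<dots> = poly q (x j)" using fin j nz[OF j] by (simp add: c_def)
    finally show ?thesis .
  qed
  have cI: "card (x ` I) = card I" using inj by (simp add: card_image)
  have "p = q"
    by (rule poly_eqI_degree[where A = "x ` I"]) (use val degp deg cI in auto)
  then have "poly q y = (\<Sum>i\<in>I. c i * (\<Prod>l\<in>I-{i}. y - x l))" using polyp by simp
  moreover have "(\<Prod>i\<in>I. y - x i) \<noteq> 0" using fin y by auto
  moreover have "(\<Prod>l\<in>I. y - x l) = (y - x i) * (\<Prod>l\<in>I-{i}. y - x l)" if "i \<in> I" for i
    using fin that by (simp add: prod.remove)
  moreover have "y - x i \<noteq> 0" if "i \<in> I" for i using y that by auto
  ultimately show ?thesis
    by (auto simp: sum_divide_distrib c_def intro!: sum.cong)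
qed

text \<open>Monotonicity \<open>f(X) \<le> f(Y)\<close> for \<open>X = diag x\<close> and \<open>Y = X + v v\<^sup>T = U diag y U\<^sup>T\<close>, tested on real vectors.\<close>

definition rank_one_monotone :: "(real \<Rightarrow> real) \<Rightarrow> bool" where
  "rank_one_monotone f \<longleftrightarrow> (\<forall>k x y U v w.
     (\<forall>i<k. 0 < x i) \<longrightarrow> (\<forall>i<k. 0 < y i) \<longrightarrow>
     (\<forall>j<k. \<forall>l<k. (\<Sum>i<k. U i j * U i l) = (if j = l then 1 else 0)) \<longrightarrow>
     (\<forall>i<k. \<forall>j<k. x i * U i j + v i * (\<Sum>l<k. v l * U l j) = y j * U i j) \<longrightarrow>
     (\<Sum>i<k. f (x i) * (w i)\<^sup>2) \<le> (\<Sum>j<k::nat. f (y j) * (\<Sum>i<k. U i j * w i)\<^sup>2))"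

text \<open>For interlacing nodes, the rank one perturbation \<open>diag x + v v\<^sup>T\<close> with eigenvalues \<open>y\<close> is
  diagonalized by an explicit Cauchy matrix \<open>U\<close>; the inequality is monotonicity tested on the vector
  whose entries interpolate \<open>q\<close>.\<close>

lemma interlacing_divided_difference_nonneg:
  fixes x y :: "nat \<Rightarrow> real" and q :: "real poly"
  assumes mono: "rank_one_monotone f"
    and posx: "\<And>i. i < k \<Longrightarrow> 0 < x i"
    and xy: "\<And>i j. i \<le> j \<Longrightarrow> j < k \<Longrightarrow> x i < y j"
    and yx: "\<And>i j. i < j \<Longrightarrow> j < k \<Longrightarrow> y i < x j"
    and deg: "degree q < k"
  shows "0 \<le> (\<Sum>i<k. (poly q (x i))\<^sup>2 * f (x i) / ((\<Prod>l\<in>{..<k}-{i}. x i - x l) * (\<Prod>l<k. x i - y l)))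
    + (\<Sum>j<k. (poly q (y j))\<^sup>2 * f (y j) / ((\<Prod>l\<in>{..<k}-{j}. y j - y l) * (\<Prod>l<k. y j - x l)))"
proof -
  have xlt: "x i < x j" if "i < j" "j < k" for i j
    using xy[of i i] yx[of i j] that by fastforce
  have ylt: "y i < y j" if "i < j" "j < k" for i j
    using yx[of i j] xy[of j j] that by fastforce
  have injx: "inj_on x {..<k}" by (rule inj_onI) (metis lessThan_iff nat_neq_iff order_less_irrefl xlt)
  have injy: "inj_on y {..<k}" by (rule inj_onI) (metis lessThan_iff nat_neq_iff order_less_irrefl ylt)
  have neq: "x i \<noteq> y j" if "i < k" "j < k" for i j
    using that xy[of i j] yx[of j i] by (cases "i \<le> j") auto
  \<comment> \<open>\<open>P\<close> and \<open>N\<close> are the characteristic polynomials of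
    \<open>diag x\<close> and of its perturbation, \<open>P'\<close> and \<open>N'\<close> their
    derivatives at the respective nodes. Then \<open>- a i\<close> is the residue of
    \<open>N / P\<close> at \<open>x i\<close> and \<open>b j\<close> that of \<open>P / N\<close>
    at \<open>y j\<close>.\<close>
  define P' where "P' i = (\<Prod>l\<in>{..<k}-{i}. x i - x l)" for i
  define N' where "N' j = (\<Prod>l\<in>{..<k}-{j}. y j - y l)" for j
  define P where "P u = (\<Prod>l<k. u - x l)" for u
  define N where "N u = (\<Prod>l<k. u - y l)" for u
  define a where "a i = - N (x i) / P' i" for i
  define b where "b j = P (y j) / N' j" for j
  have P'nz: "P' i \<noteq> 0" if "i < k" for i using injx that by (auto simp: P'_def inj_on_def)
  have N'nz: "N' j \<noteq> 0" if "j < k" for j using injy that by (auto simp: N'_def inj_on_def)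
  have Nnz: "N (x i) \<noteq> 0" if "i < k" for i using neq that by (auto simp: N_def)
  have Pnz: "P (y j) \<noteq> 0" if "j < k" for j using neq that by (fastforce simp: P_def)
  \<comment> \<open>Factors of \<open>N (x i)\<close> and \<open>P' i\<close> with equal index have
    equal sign by interlacing; the unpaired factor, after the change of sign, is
    \<open>y i - x i\<close>.\<close>
  have a_pos: "0 < a i" if i: "i < k" for i
  proof -
    have "N (x i) = (x i - y i) * (\<Prod>l\<in>{..<k}-{i}. x i - y l)"
      unfolding N_def using i by (subst prod.remove[of _ i]) auto
    then have "- N (x i) = (y i - x i) * (\<Prod>l\<in>{..<k}-{i}. x i - y l)"
      by (simp add: algebra_simps)
    then have "a i = (y i - x i) * (\<Prod>l\<in>{..<k}-{i}. (x i - y l) / (x i - x l))"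
      by (simp add: a_def P'_def prod_dividef)
    moreover have "0 < (x i - y l) / (x i - x l)" if "l \<in> {..<k}-{i}" for l
    proof (cases "l < i")
      case True then show ?thesis using i yx[of l i] xlt[of l i] by simp
    next
      case False then have "i < l" "l < k" using that by auto
      then show ?thesis using xy[of i l] xlt[of i l] by (simp add: divide_neg_neg)
    qed
    ultimately show ?thesis using xy[of i i] i by (auto intro!: mult_pos_pos prod_pos)
  qed
  have b_pos: "0 < b j" if j: "j < k" for j
  proof -
    have "P (y j) = (y j - x j) * (\<Prod>l\<in>{..<k}-{j}. y j - x l)"
      unfolding P_def using j by (subst prod.remove[of _ j]) auto
    then have "b j = (y j - x j) * (\<Prod>l\<in>{..<k}-{j}. (y j - x l) / (y j - y l))"
      by (simp add: b_def N'_def prod_dividef)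
    moreover have "0 < (y j - x l) / (y j - y l)" if "l \<in> {..<k}-{j}" for l
    proof (cases "l < j")
      case True then show ?thesis using j xy[of l j] ylt[of l j] by simp
    next
      case False then have "j < l" "l < k" using that by auto
      then show ?thesis using yx[of j l] ylt[of j l] by (simp add: divide_neg_neg)
    qed
    ultimately show ?thesis using xy[of j j] j by (auto intro!: mult_pos_pos prod_pos)
  qed
  have pf: "(\<Sum>i<k. poly r (x i) / (P' i * (y j - x i))) = poly r (y j) / P (y j)"
    if "degree r < k" "j < k" for r j
    unfolding P'_def P_def
  proof (rule lagrange_partial_fractions)
    show "y j \<notin> x ` {..<k}" using neq[of _ j] that by force
  qed (use that injx in auto)
  define NP where "NP = (\<Prod>l<k. [:- y l, 1:])"
  define PP where "PP = (\<Prod>l<k. [:- x l, 1:])"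
  have NPv: "poly NP u = N u" and PPv: "poly PP u = P u" for u
    by (simp_all add: NP_def PP_def N_def P_def poly_prod)
  have degprod: "degree (\<Prod>l\<in>S. [:- z l, 1:]) = card S" if "finite S" for S and z :: "nat \<Rightarrow> real"
    using that by (subst degree_prod_eq_sum_degree) auto
  have monic: "lead_coeff (\<Prod>l\<in>S. [:- z l, 1:]) = 1" if "finite S" for S and z :: "nat \<Rightarrow> real"
    using that by (simp add: lead_coeff_prod)
  have k0: "0 < k" using deg by simp
  \<comment> \<open>Both products are monic of degree \<open>k\<close>, so the leading terms cancel
    and the partial fraction formula applies to the difference.\<close>
  have degd: "degree (PP - NP) < k"
  proof -
    have d1: "degree PP = k" "degree NP = k" unfolding PP_def NP_def by (simp_all add: degprod)
    have "Polynomial.coeff (PP - NP) k = 0"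
      using monic[of "{..<k}" x] monic[of "{..<k}" y] d1 by (simp add: PP_def NP_def)
    moreover have "degree (PP - NP) \<le> k" using d1 by (metis degree_diff_le order_refl)
    ultimately show ?thesis
      using k0 by (metis degree_0 leading_coeff_0_iff order_le_less)
  qed
  \<comment> \<open>The secular equation of the rank one perturbation with
    \<open>v i = sqrt (a i)\<close>; its solutions are the perturbed eigenvalues.\<close>
  have trace: "(\<Sum>i<k. a i / (y j - x i)) = 1" if j: "j < k" for j
  proof -
    have "poly (PP - NP) (x i) = - N (x i)" if "i < k" for i
      using that by (auto simp: NPv PPv P_def intro!: prod_zero)
    then have "(\<Sum>i<k. a i / (y j - x i)) = (\<Sum>i<k. poly (PP - NP) (x i) / (P' i * (y j - x i)))"
      by (intro sum.cong) (auto simp: a_def)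
    also have "\<dots> = poly (PP - NP) (y j) / P (y j)" by (rule pf[OF degd j])
    also have "\<dots> = 1"
    proof -
      have "N (y j) = 0" using j by (auto simp: N_def intro!: prod_zero)
      then show ?thesis using Pnz[OF j] by (simp add: NPv PPv)
    qed
    finally show ?thesis .
  qed
  \<comment> \<open>The eigenvectors have entries proportional to
    \<open>sqrt (a i) / (y j - x i)\<close>. Since \<open>r\<close> is \<open>N\<close> without the
    factor of \<open>y l\<close>, it vanishes at every other \<open>y j\<close>; this gives
    orthogonality, and \<open>1 / b j\<close> as the squared length.\<close>
  have gram: "(\<Sum>i<k. a i / ((y j - x i) * (y l - x i))) = (if j = l then 1 / b j else 0)"
    if j: "j < k" and l: "l < k" for j l
  proof -
    define r where "r = (\<Prod>m\<in>{..<k}-{l}. [:- y m, 1:])"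
    have rv: "poly r u = (\<Prod>m\<in>{..<k}-{l}. u - y m)" for u by (simp add: r_def poly_prod)
    have degr: "degree r < k" unfolding r_def using l by (subst degprod) auto
    have "N (x i) = (x i - y l) * poly r (x i)" for i
      unfolding N_def rv using l by (subst prod.remove[of _ l]) auto
    then have "- N (x i) = poly r (x i) * (y l - x i)" for i by (simp add: algebra_simps)
    then have "a i / ((y j - x i) * (y l - x i)) = poly r (x i) / (P' i * (y j - x i))" if "i < k" for i
      using neq[OF that l] neq[OF that j] P'nz[OF that] by (simp add: a_def)
    then have "(\<Sum>i<k. a i / ((y j - x i) * (y l - x i))) = (\<Sum>i<k. poly r (x i) / (P' i * (y j - x i)))"
      by (intro sum.cong) auto
    also have "\<dots> = poly r (y j) / P (y j)" by (rule pf[OF degr j])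
    also have "\<dots> = (if j = l then 1 / b j else 0)"
      using j Pnz[OF j] by (auto simp: rv b_def N'_def intro!: prod_zero)
    finally show ?thesis .
  qed
  define U where "U i j = sqrt (a i) * sqrt (b j) / (y j - x i)" for i j
  define v where "v i = sqrt (a i)" for i
  \<comment> \<open>Chosen so that the coordinate of \<open>w\<close> along column \<open>j\<close>
    of \<open>U\<close> is a partial fraction sum of \<open>q\<close>, evaluated at
    \<open>y j\<close>.\<close>
  define w where "w i = poly q (x i) / (sqrt (a i) * P' i)" for i
  have sqa: "sqrt (a i) * sqrt (a i) = a i" "sqrt (a i) \<noteq> 0" if "i < k" for i
    using a_pos[OF that] by auto
  have sqb: "sqrt (b i) * sqrt (b i) = b i" "sqrt (b i) \<noteq> 0" if "i < k" for i
    using b_pos[OF that] by auto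
  have orth: "(\<Sum>i<k. U i j * U i l) = (if j = l then 1 else 0)" if j: "j < k" and l: "l < k" for j l
  proof -
    have "(\<Sum>i<k. U i j * U i l) = (\<Sum>i<k. sqrt (b j) * sqrt (b l) * (a i / ((y j - x i) * (y l - x i))))"
      by (intro sum.cong refl) (use sqa in \<open>auto simp: U_def field_simps\<close>)
    also have "\<dots> = sqrt (b j) * sqrt (b l) * (if j = l then 1 / b j else 0)"
      by (simp only: sum_distrib_left[symmetric] gram[OF j l])
    also have "\<dots> = (if j = l then 1 else 0)" using sqb[OF j] by auto
    finally show ?thesis .
  qed
  have eig: "x i * U i j + v i * (\<Sum>l<k. v l * U l j) = y j * U i j" if i: "i < k" and j: "j < k" for i j
  proof -
    have "(\<Sum>l<k. v l * U l j) = (\<Sum>l<k. sqrt (b j) * (a l / (y j - x l)))"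
      by (intro sum.cong refl) (use sqa in \<open>auto simp: U_def v_def field_simps\<close>)
    also have "\<dots> = sqrt (b j)" by (simp only: sum_distrib_left[symmetric] trace[OF j])
    finally show ?thesis using neq[OF i j] by (simp add: U_def v_def field_simps)
  qed
  have Uw: "(\<Sum>i<k. U i j * w i) = sqrt (b j) * (poly q (y j) / P (y j))" if j: "j < k" for j
  proof -
    have "(\<Sum>i<k. U i j * w i) = (\<Sum>i<k. sqrt (b j) * (poly q (x i) / (P' i * (y j - x i))))"
      by (intro sum.cong refl) (use sqa in \<open>auto simp: U_def w_def field_simps\<close>)
    also have "\<dots> = sqrt (b j) * (poly q (y j) / P (y j))"
      by (simp only: sum_distrib_left[symmetric] pf[OF deg j])
    finally show ?thesis .
  qed
  have posy: "0 < y j" if "j < k" for j using posx[OF that] xy[of j j] that by simp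
  have "(\<Sum>i<k. f (x i) * (w i)\<^sup>2) \<le> (\<Sum>j<k. f (y j) * (\<Sum>i<k. U i j * w i)\<^sup>2)"
    using mono[unfolded rank_one_monotone_def, rule_format, of k x y U v w] posx posy orth eig by blast
  also have "(\<Sum>j<k. f (y j) * (\<Sum>i<k. U i j * w i)\<^sup>2)
      = (\<Sum>j<k. (poly q (y j))\<^sup>2 * f (y j) / (N' j * P (y j)))"
  proof (intro sum.cong refl)
    fix j assume "j \<in> {..<k}"
    then have j: "j < k" by simp
    have "(sqrt (b j))\<^sup>2 = P (y j) / N' j" using b_pos[OF j] by (simp add: b_def)
    then show "f (y j) * (\<Sum>i<k. U i j * w i)\<^sup>2 = (poly q (y j))\<^sup>2 * f (y j) / (N' j * P (y j))"
      unfolding Uw[OF j] power_mult_distrib using Pnz[OF j] N'nz[OF j]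
      by (simp add: field_simps power2_eq_square del: real_sqrt_pow2_iff)
  qed
  \<comment> \<open>The minus sign in \<open>a\<close> compensates for moving the nodes
    \<open>x i\<close> to the other side, so both families of nodes enter the divided difference
    with the same sign.\<close>
  also have "(\<Sum>i<k. f (x i) * (w i)\<^sup>2) = (\<Sum>i<k. - ((poly q (x i))\<^sup>2 * f (x i) / (P' i * N (x i))))"
  proof (intro sum.cong refl)
    fix i assume "i \<in> {..<k}"
    then have i: "i < k" by simp
    have "(sqrt (a i))\<^sup>2 = - N (x i) / P' i" using a_pos[OF i] by (simp add: a_def)
    then show "f (x i) * (w i)\<^sup>2 = - ((poly q (x i))\<^sup>2 * f (x i) / (P' i * N (x i)))"
      unfolding w_def power_divide power_mult_distrib using Nnz[OF i] P'nz[OF i]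
      by (simp add: field_simps power2_eq_square)
  qed
  finally show ?thesis by (simp add: sum_negf P'_def N'_def P_def N_def)
qed

text \<open>The sum is the divided difference of \<open>q\<^sup>2 f\<close> over \<open>Z\<close>.
  Taking the sorted nodes alternately as \<open>x\<close> and \<open>y\<close> produces an
  interlacing pair, hence the even number of nodes.\<close>

lemma divided_difference_nonneg:
  fixes q :: "real poly"
  assumes mono: "rank_one_monotone f" and fin: "finite Z" and pos: "\<And>z. z \<in> Z \<Longrightarrow> 0 < z"
    and card: "card Z = 2 * k" and deg: "degree q < k"
  shows "0 \<le> (\<Sum>z\<in>Z. (poly q z)\<^sup>2 * f z / (\<Prod>w\<in>Z-{z}. z - w))"
proof -
  define L where "L = sorted_list_of_set Z"
  have lenL: "length L = 2 * k" and setL: "set L = Z" and L: "sorted_wrt (<) L"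
    using fin card by (simp_all add: L_def)
  have lt: "L ! i < L ! j" if "i < j" "j < 2 * k" for i j
    using L that lenL by (simp add: sorted_wrt_nth_less)
  define x y where "x i = L ! (2 * i)" and "y i = L ! (2 * i + 1)" for i
  have Leq: "i = j" if "L ! i = L ! j" "i < 2 * k" "j < 2 * k" for i j
    using lt[of i j] lt[of j i] that by (cases i j rule: linorder_cases) auto
  have injx: "inj_on x {..<k}"
    by (rule inj_onI) (use Leq[of "2 * _" "2 * _"] in \<open>force simp: x_def\<close>)
  have injy: "inj_on y {..<k}"
    by (rule inj_onI) (use Leq[of "2 * _ + 1" "2 * _ + 1"] in \<open>force simp: y_def\<close>)
  have disj: "x ` {..<k} \<inter> y ` {..<k} = {}"
  proof -
    have "x i \<noteq> y j" if "i < k" "j < k" for i j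
    proof
      assume "x i = y j"
      then have "2 * i = 2 * j + 1"
        using Leq[of "2 * i" "2 * j + 1"] that by (simp add: x_def y_def)
      then show False by presburger
    qed
    then show ?thesis by auto
  qed
  have sub: "x ` {..<k} \<union> y ` {..<k} \<subseteq> Z"
    using setL lenL by (auto simp: x_def y_def intro!: nth_mem)
  have Z: "Z = x ` {..<k} \<union> y ` {..<k}"
    by (rule card_subset_eq[symmetric, OF fin sub])
       (use disj card in \<open>simp add: card_Un_disjoint card_image injx injy\<close>)
  have px: "(\<Prod>w\<in>Z-{x i}. x i - w) = (\<Prod>l\<in>{..<k}-{i}. x i - x l) * (\<Prod>l<k. x i - y l)" if i: "i < k" for i
  proof -
    have "Z - {x i} = x ` ({..<k}-{i}) \<union> y ` {..<k}"
      using Z disj injx i by (auto simp: inj_on_def)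
    moreover have "x ` ({..<k}-{i}) \<inter> y ` {..<k} = {}" using disj by auto
    ultimately show ?thesis
      by (simp add: prod.union_disjoint prod.reindex injy inj_on_subset[OF injx])
  qed
  have py: "(\<Prod>w\<in>Z-{y i}. y i - w) = (\<Prod>l\<in>{..<k}-{i}. y i - y l) * (\<Prod>l<k. y i - x l)" if i: "i < k" for i
  proof -
    have "Z - {y i} = y ` ({..<k}-{i}) \<union> x ` {..<k}"
      using Z disj injy i by (auto simp: inj_on_def)
    moreover have "y ` ({..<k}-{i}) \<inter> x ` {..<k} = {}" using disj by auto
    ultimately show ?thesis
      by (simp add: prod.union_disjoint prod.reindex injx inj_on_subset[OF injy])
  qed
  have "0 \<le> (\<Sum>i<k. (poly q (x i))\<^sup>2 * f (x i) / ((\<Prod>l\<in>{..<k}-{i}. x i - x l) * (\<Prod>l<k. x i - y l)))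
    + (\<Sum>j<k. (poly q (y j))\<^sup>2 * f (y j) / ((\<Prod>l\<in>{..<k}-{j}. y j - y l) * (\<Prod>l<k. y j - x l)))"
    by (rule interlacing_divided_difference_nonneg[OF mono _ _ _ deg])
       (use pos setL lenL lt in \<open>auto simp: x_def y_def intro!: pos\<close>)
  also have "\<dots> = (\<Sum>z\<in>Z. (poly q z)\<^sup>2 * f z / (\<Prod>w\<in>Z-{z}. z - w))"
  proof -
    have "(\<Sum>z\<in>Z. (poly q z)\<^sup>2 * f z / (\<Prod>w\<in>Z-{z}. z - w))
      = (\<Sum>z\<in>x ` {..<k}. (poly q z)\<^sup>2 * f z / (\<Prod>w\<in>Z-{z}. z - w))
      + (\<Sum>z\<in>y ` {..<k}. (poly q z)\<^sup>2 * f z / (\<Prod>w\<in>Z-{z}. z - w))"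
      by (subst Z, rule sum.union_disjoint) (use disj in auto)
    then show ?thesis by (simp add: sum.reindex injx injy px py)
  qed
  finally show ?thesis .
qed

section \<open>Polynomials that are nonnegative on the half-line\<close>

text \<open>\<open>pCons 0 p\<close> is the product of \<open>p\<close> with the variable. The
  degree bound is carried along because divided differences over a given number of nodes are
  controlled only for squares of bounded degree.\<close>

inductive_set halfline_cone :: "nat \<Rightarrow> real poly set" for N :: nat where
  square: "degree (q\<^sup>2) \<le> N \<Longrightarrow> q\<^sup>2 \<in> halfline_cone N"
| shifted_square: "degree (pCons 0 (q\<^sup>2)) \<le> N \<Longrightarrow> pCons 0 (q\<^sup>2) \<in> halfline_cone N"
| add: "p \<in> halfline_cone N \<Longrightarrow> q \<in> halfline_cone N \<Longrightarrow> p + q \<in> halfline_cone N"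

lemma halfline_cone_mono: "p \<in> halfline_cone M \<Longrightarrow> M \<le> N \<Longrightarrow> p \<in> halfline_cone N"
  by (induction rule: halfline_cone.induct) (auto intro: halfline_cone.intros)

lemma halfline_cone_mult_square:
  "p \<in> halfline_cone N \<Longrightarrow> r\<^sup>2 * p \<in> halfline_cone (N + 2 * degree r)"
proof (induction rule: halfline_cone.induct)
  case (square q)
  have "degree ((r * q)\<^sup>2) \<le> N + 2 * degree r"
    using square degree_mult_le[of "r\<^sup>2" "q\<^sup>2"] degree_power_le[of r 2]
    by (simp add: power_mult_distrib)
  then have "(r * q)\<^sup>2 \<in> halfline_cone (N + 2 * degree r)" by (rule halfline_cone.square)
  then show ?case by (simp add: power_mult_distrib)
next
  case (shifted_square q)
  have eq: "r\<^sup>2 * pCons 0 (q\<^sup>2) = pCons 0 ((r * q)\<^sup>2)"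
    by (simp add: power_mult_distrib)
  have "degree (r\<^sup>2 * pCons 0 (q\<^sup>2)) \<le> N + 2 * degree r"
    using shifted_square degree_mult_le[of "r\<^sup>2" "pCons 0 (q\<^sup>2)"] degree_power_le[of r 2] by linarith
  then show ?case unfolding eq by (rule halfline_cone.shifted_square)
next
  case (add p q)
  then show ?case by (simp add: distrib_left halfline_cone.add)
qed

lemma halfline_cone_smult:
  assumes "p \<in> halfline_cone N" "0 \<le> c"
  shows "Polynomial.smult c p \<in> halfline_cone N"
proof -
  have "[:sqrt c:]\<^sup>2 * p \<in> halfline_cone (N + 2 * degree [:sqrt c:])"
    by (rule halfline_cone_mult_square[OF assms(1)])
  moreover have "[:sqrt c:]\<^sup>2 * p = Polynomial.smult c p"
    using assms(2) by (simp add: power2_eq_square)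
  ultimately show ?thesis by simp
qed

lemma halfline_cone_pCons:
  "p \<in> halfline_cone N \<Longrightarrow> pCons 0 p \<in> halfline_cone (Suc N)"
proof (induction rule: halfline_cone.induct)
  case (square q)
  have "degree (pCons 0 (q\<^sup>2)) \<le> Suc N" using square degree_pCons_le[of 0 "q\<^sup>2"] by linarith
  then show ?case by (rule halfline_cone.shifted_square)
next
  case (shifted_square q)
  have eq: "pCons 0 (pCons 0 (q\<^sup>2)) = (pCons 0 q)\<^sup>2" by (simp add: power2_eq_square)
  have "degree (pCons 0 (pCons 0 (q\<^sup>2))) \<le> Suc N"
    using shifted_square degree_pCons_le[of 0 "pCons 0 (q\<^sup>2)"] by linarith
  then show ?case unfolding eq by (rule halfline_cone.square)
next
  case (add p q)
  then show ?case by (metis add_pCons add.right_neutral halfline_cone.add)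
qed

text \<open>Dividing out a root loses the sign at that root; continuity from the right restores
  it.\<close>

lemma poly_nonneg_at_limit:
  fixes p :: "real poly"
  assumes "\<And>x. 0 \<le> x \<Longrightarrow> x \<noteq> a \<Longrightarrow> 0 \<le> poly p x" and "0 \<le> x"
  shows "0 \<le> poly p x"
proof (cases "x = a")
  case True
  have "(poly p \<longlongrightarrow> poly p a) (at_right a)"
    using poly_isCont[of a p] by (simp add: isCont_def filterlim_at_split)
  moreover have "eventually (\<lambda>u. 0 \<le> poly p u) (at_right a)"
    using assms True by (auto simp: eventually_at_filter)
  ultimately show ?thesis using True by (auto intro: tendsto_lowerbound)
next
  case False
  then show ?thesis using assms by simp
qed

text \<open>Induction on the degree: a complex root is split off, and its factor is itself of cone
  type, namely the variable plus a nonnegative constant for a root \<open>a \<le> 0\<close>, a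
  square for a positive root, a sum of two squares for a conjugate pair. In each case the bound
  stays at \<open>degree p\<close>.\<close>

theorem nonneg_halfline_in_cone:
  fixes p :: "real poly"
  assumes "\<And>x. 0 \<le> x \<Longrightarrow> 0 \<le> poly p x"
  shows "p \<in> halfline_cone (degree p)"
  using assms
proof (induction "degree p" arbitrary: p rule: less_induct)
  case less
  show ?case
  proof (cases "degree p = 0")
    case True
    then obtain c where p: "p = [:c:]" using degree_eq_zeroE by blast
    have "0 \<le> c" using less.prems[of 0] p by simp
    have "[:sqrt c:]\<^sup>2 \<in> halfline_cone (degree p)"
      by (rule halfline_cone.square) (simp add: power2_eq_square)
    then show ?thesis using \<open>0 \<le> c\<close> p by (simp add: power2_eq_square)
  next
    case False
    define pc where "pc = map_poly complex_of_real p"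
    have "degree pc = degree p" by (simp add: pc_def degree_map_poly)
    then have "\<not> constant (poly pc)" using False by (simp add: constant_degree)
    then obtain z where z: "poly pc z = 0" using fundamental_theorem_of_algebra by blast
    have p0: "p \<noteq> 0" using False by auto
    show ?thesis
    proof (cases "Im z = 0")
      case True
      define a where "a = Re z"
      have za: "z = complex_of_real a" using True by (simp add: a_def complex_eq_iff)
      have "poly p a = 0" using z by (simp add: pc_def za of_real_hom.poly_map_poly)
      then obtain p1 where p1: "p = [:- a, 1:] * p1" using poly_eq_0_iff_dvd by (auto simp: dvd_def)
      then have p10: "p1 \<noteq> 0" using p0 by auto
      have deg1: "degree p = Suc (degree p1)" using p10 unfolding p1 by (subst degree_mult_eq) auto
      have pv: "poly p x = (x - a) * poly p1 x" for x by (simp add: p1 algebra_simps)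
      show ?thesis
      proof (cases "a \<le> 0")
        case True
        have "0 \<le> poly p1 x" if "0 \<le> x" "x \<noteq> a" for x
          using less.prems[of x] that True unfolding pv by (simp add: zero_le_mult_iff)
        then have "0 \<le> poly p1 x" if "0 \<le> x" for x using poly_nonneg_at_limit that by metis
        then have c: "p1 \<in> halfline_cone (degree p1)" using less.hyps[of p1] deg1 by simp
        have "p = pCons 0 p1 + Polynomial.smult (- a) p1" unfolding p1 by simp
        also have "\<dots> \<in> halfline_cone (degree p)"
          by (intro halfline_cone.add halfline_cone_smult halfline_cone_mono[OF c])
             (use True deg1 halfline_cone_pCons[OF c] in auto)
        finally show ?thesis .
      next
        case False
        then have a: "0 < a" by simp
        \<comment> \<open>Across a positive root \<open>p\<close> keeps its sign, so the cofactor
          \<open>p1\<close> is nonnegative to the right and nonpositive to the left. Hence it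
          vanishes at \<open>a\<close> and the root is at least double.\<close>
        have right: "0 \<le> poly p1 u" if "a < u" for u
          using less.prems[of u] a that unfolding pv by (simp add: zero_le_mult_iff)
        have left: "poly p1 u \<le> 0" if "0 < u" "u < a" for u
          using less.prems[of u] that unfolding pv by (simp add: zero_le_mult_iff)
        have "0 \<le> poly p1 a"
        proof (rule tendsto_lowerbound)
          show "(poly p1 \<longlongrightarrow> poly p1 a) (at_right a)"
            using poly_isCont[of a p1] by (simp add: isCont_def filterlim_at_split)
          show "eventually (\<lambda>u. 0 \<le> poly p1 u) (at_right a)"
            unfolding eventually_at_right_field
            by (rule exI[of _ "a + 1"]) (use right in auto)
        qed auto
        moreover have "poly p1 a \<le> 0"
        proof (rule tendsto_upperbound)
          show "(poly p1 \<longlongrightarrow> poly p1 a) (at_left a)"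
            using poly_isCont[of a p1] by (simp add: isCont_def filterlim_at_split)
          show "eventually (\<lambda>u. poly p1 u \<le> 0) (at_left a)"
            unfolding eventually_at_left_field
            by (rule exI[of _ "0"]) (use left a in auto)
        qed auto
        ultimately have "poly p1 a = 0" by simp
        then obtain p2 where p2: "p1 = [:- a, 1:] * p2" using poly_eq_0_iff_dvd by (auto simp: dvd_def)
        then have p20: "p2 \<noteq> 0" using p10 by auto
        have deg2: "degree p1 = Suc (degree p2)" using p20 unfolding p2 by (subst degree_mult_eq) auto
        have pp: "p = [:- a, 1:]\<^sup>2 * p2" by (simp only: p1 p2 power2_eq_square mult.assoc)
        have pv2: "poly p x = (x - a)\<^sup>2 * poly p2 x" for x by (simp add: pp)
        have "0 \<le> poly p2 x" if "0 \<le> x" "x \<noteq> a" for x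
          using less.prems[of x] that unfolding pv2 by (simp add: zero_le_mult_iff)
        then have "0 \<le> poly p2 x" if "0 \<le> x" for x using poly_nonneg_at_limit that by metis
        then have c: "p2 \<in> halfline_cone (degree p2)" using less.hyps[of p2] deg1 deg2 by simp
        show ?thesis using halfline_cone_mult_square[OF c, of "[:- a, 1:]"] deg1 deg2 pp by simp
      qed
    next
      case False
      define a b where "a = Re z" and "b = Im z"
      \<comment> \<open>The real quadratic with the roots \<open>z\<close> and its conjugate. The
        remainder of \<open>p\<close> modulo \<open>d\<close> is real, of degree at most one and
        zero at the nonreal \<open>z\<close>, hence zero.\<close>
      define d where "d = [:- a, 1:]\<^sup>2 + [:b\<^sup>2:]"
      have d_eq: "d = [:a\<^sup>2 + b\<^sup>2, - 2 * a, 1:]" by (simp add: d_def power2_eq_square)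
      have degd: "degree d = 2" "d \<noteq> 0" by (simp_all add: d_eq)
      define q r where "q = p div d" and "r = p mod d"
      have pqr: "p = d * q + r" by (simp add: q_def r_def)
      have degr: "degree r < 2" using degd by (metis degree_mod_less' r_def degree_0 zero_less_numeral)
      have zd: "poly (map_poly complex_of_real d) z = 0"
        by (simp add: d_eq complex_eq_iff a_def b_def power2_eq_square algebra_simps)
      interpret h: map_poly_inj_idom_hom complex_of_real ..
      have "poly (map_poly complex_of_real r) z = 0"
        using z zd by (simp add: pc_def pqr h.hom_add h.hom_mult)
      moreover obtain u v where r: "r = [:u, v:]"
      proof (cases r)
        case (pCons u r')
        then have "degree r' = 0" using degr by (cases "r' = 0") auto
        then obtain v where "r' = [:v:]" using degree_eq_zeroE by blast
        then show ?thesis using pCons that by simp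
      qed
      ultimately have "complex_of_real u + z * complex_of_real v = 0"
        by (simp add: of_real_hom.map_poly_pCons_hom)
      then have "v = 0" "u = 0" using False by (auto simp: complex_eq_iff)
      then have pq: "p = d * q" using pqr r by simp
      then have q0: "q \<noteq> 0" using p0 by auto
      have degq: "degree p = 2 + degree q" using q0 degd unfolding pq by (subst degree_mult_eq) auto
      have "0 < poly d x" for x using False by (simp add: d_def b_def add_nonneg_pos)
      then have "0 \<le> poly q x" if "0 \<le> x" for x
        using less.prems[OF that] by (simp add: pq zero_le_mult_iff) (meson linorder_not_less)
      then have c: "q \<in> halfline_cone (degree q)" using less.hyps[of q] degq by simp
      have "p = [:- a, 1:]\<^sup>2 * q + Polynomial.smult (b\<^sup>2) q"
        unfolding pq d_def by (simp add: algebra_simps)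
      also have "\<dots> \<in> halfline_cone (degree p)"
        using halfline_cone_mult_square[OF c, of "[:- a, 1:]"] degq
        by (intro halfline_cone.add halfline_cone_smult halfline_cone_mono[OF c])
           (auto simp: add.commute)
      finally show ?thesis .
    qed
  qed
qed

section \<open>Approximation on finite sets\<close>

text \<open>Clearing denominators turns the hypothesis into nonnegativity of a polynomial \<open>p\<close> on the
  half-line and the conclusion into \<open>\<Psi> p \<ge> 0\<close> for a functional \<open>\<Psi>\<close> built from divided differences. On
  squares, \<open>\<Psi>\<close> is handled by adding a node \<open>e\<close> tending to \<open>0\<close>, on shifted squares by adding a
  node \<open>R\<close> tending to infinity.\<close>

lemma lowner_functional_nonneg:
  assumes mono: "rank_one_monotone f" and f_pos: "\<And>x. 0 < x \<Longrightarrow> 0 < f x"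
    and growth: "\<And>x. 1 \<le> x \<Longrightarrow> f x \<le> C * x"
    and fin: "finite Z" and pos: "\<And>z. z \<in> Z \<Longrightarrow> 0 < z" and card: "card Z = Suc (2 * j)"
    and nonneg: "\<And>x. 0 \<le> x \<Longrightarrow> 0 \<le> (\<Sum>z\<in>Z. c z * (z / (x + z)))"
  shows "0 \<le> (\<Sum>z\<in>Z. c z * f z)"
proof -
  define D where "D z = (\<Prod>w\<in>Z-{z}. z - w)" for z
  have cardm: "card (Z - {z}) = 2 * j" if "z \<in> Z" for z using fin card that by simp
  have D_nz: "D z \<noteq> 0" if "z \<in> Z" for z using fin by (auto simp: D_def)
  \<comment> \<open>Each of the \<open>2 * j\<close> factors changes sign, so the product does
    not.\<close>
  have D_alt: "(\<Prod>w\<in>Z-{z}. w - z) = D z" if "z \<in> Z" for z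
  proof -
    have "(\<Prod>w\<in>Z-{z}. w - z) = (\<Prod>w\<in>Z-{z}. (- 1) * (z - w))" by simp
    also have "\<dots> = (- 1) ^ (2 * j) * D z"
      unfolding prod.distrib D_def using cardm[OF that] by simp
    finally show ?thesis by simp
  qed
  have Zne: "Z \<noteq> {}" using card by auto
  \<comment> \<open>At \<open>- z\<close> only the summand of \<open>p\<close> with index
    \<open>z\<close> survives, so \<open>\<Psi>\<close> recovers the target sum from
    \<open>p\<close>. The \<open>z\<close> in the denominator is what a shifted square
    cancels.\<close>
  define \<Psi> where "\<Psi> p = (\<Sum>z\<in>Z. poly p (- z) * f z / (z * D z))" for p :: "real poly"
  define p where "p = (\<Sum>z\<in>Z. Polynomial.smult (c z * z) (\<Prod>w\<in>Z-{z}. [:w, 1:]))"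
  have pv: "poly p x = (\<Sum>z\<in>Z. c z * z * (\<Prod>w\<in>Z-{z}. w + x))" for x
    by (simp add: p_def poly_sum poly_prod)
  have "0 \<le> poly p x" if x: "0 \<le> x" for x
  proof -
    have "c z * z * (\<Prod>w\<in>Z-{z}. w + x) = (\<Prod>w\<in>Z. w + x) * (c z * (z / (x + z)))" if "z \<in> Z" for z
      using fin that pos[OF that] x by (simp add: prod.remove add.commute)
    then have "poly p x = (\<Prod>w\<in>Z. w + x) * (\<Sum>z\<in>Z. c z * (z / (x + z)))"
      unfolding pv by (simp add: sum_distrib_left)
    moreover have "0 \<le> (\<Prod>w\<in>Z. w + x)" using pos x by (force intro: prod_nonneg)
    ultimately show ?thesis using nonneg[OF x] by simp
  qed
  then have "p \<in> halfline_cone (degree p)" by (rule nonneg_halfline_in_cone)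
  \<comment> \<open>This leaves degree at most \<open>j\<close> for \<open>q\<close> in a square and
    below \<open>j\<close> in a shifted square. The former is what \<open>2 * (j + 1)\<close> nodes
    permit; the latter also makes the term of the node \<open>R\<close> decay.\<close>
  moreover have "degree p \<le> 2 * j"
    unfolding p_def
  proof (intro degree_sum_le fin)
    fix z assume z: "z \<in> Z"
    have "degree (\<Prod>w\<in>Z-{z}. [:w, 1:]) \<le> (\<Sum>w\<in>Z-{z}. degree [:w, 1:])"
      by (rule degree_prod_sum_le[unfolded o_def]) (use fin in auto)
    also have "\<dots> = 2 * j" using cardm[OF z] by simp
    finally show "degree (Polynomial.smult (c z * z) (\<Prod>w\<in>Z-{z}. [:w, 1:])) \<le> 2 * j"
      using degree_smult_le order_trans by blast
  qed
  ultimately have "p \<in> halfline_cone (2 * j)" by (rule halfline_cone_mono)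
  then have "0 \<le> \<Psi> p"
  proof (induction rule: halfline_cone.induct)
    case (square q)
    \<comment> \<open>The kernels have their poles at \<open>- z\<close>, the divided differences
      use the nodes \<open>z\<close>; the reflection translates between the two.\<close>
    define r where "r = pcompose q [:0, - 1:]"
    have rv: "poly r x = poly q (- x)" for x by (simp add: r_def poly_pcompose)
    have degr: "degree r < j + 1"
    proof (cases "q = 0")
      case False
      then show ?thesis using square degree_pcompose_le[of q "[:0,-1:]"] by (simp add: r_def degree_power_eq)
    qed (simp add: r_def)
    \<comment> \<open>The node \<open>e\<close> lies below all of \<open>Z\<close>, so its
      denominator is a product of an odd number of negative factors. Its term is nonpositive and is
      dropped; as \<open>e\<close> tends to \<open>0\<close>, the factor \<open>z - e\<close>
      becomes the \<open>z\<close> in \<open>\<Psi>\<close>.\<close>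
    have *: "0 \<le> (\<Sum>z\<in>Z. (poly r z)\<^sup>2 * f z / ((z - e) * D z))" if e: "0 < e" "e < Min Z" for e
    proof -
      have lt: "e < z" if "z \<in> Z" for z using e fin that by (meson Min_le order_less_le_trans)
      then have eZ: "e \<notin> Z" by blast
      have "0 \<le> (\<Sum>z\<in>insert e Z. (poly r z)\<^sup>2 * f z / (\<Prod>w\<in>insert e Z-{z}. z - w))"
        by (rule divided_difference_nonneg[OF mono _ _ _ degr]) (use fin pos e eZ card in auto)
      also have "\<dots> = (poly r e)\<^sup>2 * f e / (\<Prod>w\<in>Z. e - w)
          + (\<Sum>z\<in>Z. (poly r z)\<^sup>2 * f z / (\<Prod>w\<in>insert e Z-{z}. z - w))"
        using fin eZ by simp
      also have "(\<Sum>z\<in>Z. (poly r z)\<^sup>2 * f z / (\<Prod>w\<in>insert e Z-{z}. z - w))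
          = (\<Sum>z\<in>Z. (poly r z)\<^sup>2 * f z / ((z - e) * D z))"
      proof (intro sum.cong refl)
        fix z assume "z \<in> Z"
        then have "insert e Z - {z} = insert e (Z - {z})" "e \<notin> Z - {z}" using eZ by auto
        then show "(poly r z)\<^sup>2 * f z / (\<Prod>w\<in>insert e Z-{z}. z - w) = (poly r z)\<^sup>2 * f z / ((z - e) * D z)"
          using fin by (simp add: D_def)
      qed
      also have "(poly r e)\<^sup>2 * f e / (\<Prod>w\<in>Z. e - w) \<le> 0"
      proof -
        have "(\<Prod>w\<in>Z. e - w) = (\<Prod>w\<in>Z. (- 1) * (w - e))" by simp
        also have "\<dots> = - (\<Prod>w\<in>Z. w - e)" unfolding prod.distrib using card by simp
        finally show ?thesis using lt f_pos[OF e(1)]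
          by (simp add: prod_nonneg less_imp_le)
      qed
      finally show ?thesis by simp
    qed
    have "((\<lambda>e. \<Sum>z\<in>Z. (poly r z)\<^sup>2 * f z / ((z - e) * D z)) \<longlongrightarrow>
      (\<Sum>z\<in>Z. (poly r z)\<^sup>2 * f z / ((z - 0) * D z))) (at_right 0)"
      by (intro tendsto_intros) (use pos D_nz in fastforce)
    moreover have "eventually (\<lambda>e. 0 \<le> (\<Sum>z\<in>Z. (poly r z)\<^sup>2 * f z / ((z - e) * D z))) (at_right 0)"
      unfolding eventually_at_right_field
      by (rule exI[of _ "Min Z"]) (use * pos fin Zne in auto)
    ultimately have "0 \<le> (\<Sum>z\<in>Z. (poly r z)\<^sup>2 * f z / ((z - 0) * D z))"
      by (rule tendsto_lowerbound) simp
    then show ?case by (simp add: \<Psi>_def rv)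
  next
    case (shifted_square q)
    show ?case
    proof (cases "q = 0")
      case True
      then show ?thesis by (simp add: \<Psi>_def)
    next
      case False
      define r where "r = pcompose q [:0, - 1:]"
      have rv: "poly r x = poly q (- x)" for x by (simp add: r_def poly_pcompose)
      have degq: "degree q < j"
        using shifted_square False by (simp add: degree_pCons_eq degree_power_eq)
      then have degr: "degree r < j" using degree_pcompose_le[of q "[:0,-1:]"] by (simp add: r_def)
      \<comment> \<open>A bound, by the linear growth of \<open>f\<close>, for \<open>R\<close>
        times the term of the node \<open>R\<close>. Its numerator has degree at most
        \<open>2 * j\<close> in \<open>R\<close> and its denominator \<open>2 * j + 1\<close>, so it
        vanishes at infinity. In the other terms \<open>R / (z - R)\<close> tends to
        \<open>- 1\<close>, the sign of the variable at \<open>- z\<close>.\<close>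
      define rest where "rest R = C * ((R * poly r R)\<^sup>2 / (\<Prod>w\<in>Z. R - w))" for R
      have *: "0 \<le> (\<Sum>z\<in>Z. (poly r z)\<^sup>2 * f z * (R / (z - R)) / D z) + rest R"
        if R: "1 \<le> R" "Max Z < R" for R
      proof -
        have lt: "z < R" if "z \<in> Z" for z using R fin that by (meson Max_ge order_le_less_trans)
        then have RZ: "R \<notin> Z" by blast
        have "0 \<le> (\<Sum>z\<in>insert R Z. (poly r z)\<^sup>2 * f z / (\<Prod>w\<in>insert R Z-{z}. z - w))"
          by (rule divided_difference_nonneg[OF mono, where k = "j + 1"])
             (use fin pos R RZ card degr in auto)
        also have "\<dots> = (poly r R)\<^sup>2 * f R / (\<Prod>w\<in>Z. R - w)
            + (\<Sum>z\<in>Z. (poly r z)\<^sup>2 * f z / (\<Prod>w\<in>insert R Z-{z}. z - w))"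
          using fin RZ by simp
        also have "(\<Sum>z\<in>Z. (poly r z)\<^sup>2 * f z / (\<Prod>w\<in>insert R Z-{z}. z - w))
            = (\<Sum>z\<in>Z. (poly r z)\<^sup>2 * f z / ((z - R) * D z))"
        proof (intro sum.cong refl)
          fix z assume "z \<in> Z"
          then have "insert R Z - {z} = insert R (Z - {z})" "R \<notin> Z - {z}" using RZ by auto
          then show "(poly r z)\<^sup>2 * f z / (\<Prod>w\<in>insert R Z-{z}. z - w) = (poly r z)\<^sup>2 * f z / ((z - R) * D z)"
            using fin by (simp add: D_def)
        qed
        finally have "0 \<le> R * ((poly r R)\<^sup>2 * f R / (\<Prod>w\<in>Z. R - w)
            + (\<Sum>z\<in>Z. (poly r z)\<^sup>2 * f z / ((z - R) * D z)))"
          using R by (intro mult_nonneg_nonneg) auto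
        also have "\<dots> = R * (poly r R)\<^sup>2 * f R / (\<Prod>w\<in>Z. R - w)
            + (\<Sum>z\<in>Z. (poly r z)\<^sup>2 * f z * (R / (z - R)) / D z)"
          by (simp add: distrib_left sum_distrib_left mult_ac)
        also have "R * (poly r R)\<^sup>2 * f R / (\<Prod>w\<in>Z. R - w) \<le> R * (poly r R)\<^sup>2 * (C * R) / (\<Prod>w\<in>Z. R - w)"
        proof (rule divide_right_mono)
          show "R * (poly r R)\<^sup>2 * f R \<le> R * (poly r R)\<^sup>2 * (C * R)"
            using growth[OF R(1)] R by (intro mult_left_mono) auto
          show "0 \<le> (\<Prod>w\<in>Z. R - w)" using lt by (intro prod_nonneg) (auto simp: less_imp_le)
        qed
        also have "R * (poly r R)\<^sup>2 * (C * R) / (\<Prod>w\<in>Z. R - w) = rest R"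
          by (simp add: rest_def power2_eq_square)
        finally show ?thesis by simp
      qed
      have "((\<lambda>R. poly (([:0, 1:] * r)\<^sup>2) R / poly (\<Prod>w\<in>Z. [:- w, 1:]) R) \<longlongrightarrow> 0) at_infinity"
      proof (rule poly_divide_tendsto_0_at_infinity)
        have "degree (\<Prod>w\<in>Z. [:- w, 1:]) = Suc (2 * j)"
          using card by (subst degree_prod_eq_sum_degree) auto
        moreover have "degree (([:0, 1:] * r)\<^sup>2) \<le> 2 * j"
          using degr degree_power_le[of "[:0, 1:] * r" 2] degree_mult_le[of "[:0, 1:]" r] by simp
        ultimately show "degree (([:0, 1:] * r)\<^sup>2) < degree (\<Prod>w\<in>Z. [:- w, 1:])" by simp
      qed
      then have "((\<lambda>R. (R * poly r R)\<^sup>2 / (\<Prod>w\<in>Z. R - w)) \<longlongrightarrow> 0) at_top"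
        by (rule filterlim_mono[OF _ order_refl at_top_le_at_infinity, THEN tendsto_cong[THEN iffD1, rotated]])
           (simp add: poly_prod poly_power)
      then have rest0: "(rest \<longlongrightarrow> C * 0) at_top"
        unfolding rest_def by (intro tendsto_mult_left)
      have "((\<lambda>R. (\<Sum>z\<in>Z. (poly r z)\<^sup>2 * f z * (R / (z - R)) / D z) + rest R) \<longlongrightarrow>
        (\<Sum>z\<in>Z. (poly r z)\<^sup>2 * f z * (- 1) / D z) + C * 0) at_top"
      proof (intro tendsto_add rest0 tendsto_sum tendsto_divide tendsto_mult tendsto_const D_nz)
        show "((\<lambda>R. R / (z - R)) \<longlongrightarrow> - 1) at_top" for z :: real by real_asymp
      qed
      moreover have "eventually (\<lambda>R. 0 \<le> (\<Sum>z\<in>Z. (poly r z)\<^sup>2 * f z * (R / (z - R)) / D z) + rest R) at_top"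
        using eventually_ge_at_top[of 1] eventually_gt_at_top[of "Max Z"] by eventually_elim (rule *)
      ultimately have "0 \<le> (\<Sum>z\<in>Z. (poly r z)\<^sup>2 * f z * (- 1) / D z) + C * 0"
        by (rule tendsto_lowerbound) simp
      also have "\<dots> = \<Psi> (pCons 0 (q\<^sup>2))"
      proof -
        have "(poly r z)\<^sup>2 * f z * (- 1) / D z = poly (pCons 0 (q\<^sup>2)) (- z) * f z / (z * D z)" if "z \<in> Z" for z
          using pos[OF that] by (simp add: rv)
        then show ?thesis by (simp add: \<Psi>_def)
      qed
      finally show ?thesis .
    qed
  next
    case (add p q)
    then show ?case by (simp add: \<Psi>_def distrib_right add_divide_distrib sum.distrib)
  qed
  also have "\<Psi> p = (\<Sum>z\<in>Z. c z * f z)"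
    unfolding \<Psi>_def
  proof (intro sum.cong refl)
    fix z assume z: "z \<in> Z"
    have "poly p (- z) = (\<Sum>u\<in>Z. if u = z then c z * z * D z else 0)"
      unfolding pv
    proof (intro sum.cong refl)
      fix u assume "u \<in> Z"
      show "c u * u * (\<Prod>w\<in>Z-{u}. w + - z) = (if u = z then c z * z * D z else 0)"
        using fin z D_alt[OF z] by (auto intro!: prod_zero)
    qed
    then have "poly p (- z) = c z * z * D z" using fin z by simp
    then show "poly p (- z) * f z / (z * D z) = c z * f z"
      using D_nz[OF z] pos[OF z] by simp
  qed
  finally show ?thesis .
qed

text \<open>With \<open>s = \<lambda> / (1 + \<lambda>)\<close> these are the kernels \<open>z (1 + \<lambda>) / (z + \<lambda>)\<close> of Loewner's integral
  representation.\<close>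

definition hmean :: "real \<Rightarrow> complex \<Rightarrow> complex" where
  "hmean s z = z / (of_real s + of_real (1 - s) * z)"

text \<open>Finite convex combinations, generated by binary mixtures: a property that is stable
  under mixing, such as the final inequality, follows by induction from the functions
  \<open>hmean s\<close>.\<close>

inductive_set hmean_hull :: "(complex \<Rightarrow> complex) set" where
  hmean: "0 \<le> s \<Longrightarrow> s \<le> 1 \<Longrightarrow> hmean s \<in> hmean_hull"
| mix: "g \<in> hmean_hull \<Longrightarrow> h \<in> hmean_hull \<Longrightarrow> 0 \<le> u \<Longrightarrow> u \<le> 1 \<Longrightarrow>
    (\<lambda>z. of_real (1 - u) * g z + of_real u * h z) \<in> hmean_hull"

lemma hmean_of_real: "hmean s (of_real x) = of_real (x / (s + (1 - s) * x))"
  by (simp add: hmean_def)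

lemma hmean_denom_pos: "0 \<le> s \<Longrightarrow> s \<le> 1 \<Longrightarrow> 0 < x \<Longrightarrow> 0 < s + (1 - s) * (x::real)"
  by (cases "s = 0") (auto intro: add_pos_nonneg)

lemma hmean_hull_of_real:
  assumes "g \<in> hmean_hull" "0 < x"
  shows "Im (g (of_real x)) = 0 \<and> 0 \<le> Re (g (of_real x)) \<and> Re (g (of_real x)) \<le> 1 + x"
  using assms(1)
proof (induction rule: hmean_hull.induct)
  case (hmean s)
  have d: "0 < s + (1 - s) * x" using hmean_denom_pos hmean assms(2) by blast
  have "x \<le> (1 + x) * (s + (1 - s) * x)"
  proof -
    have "(1 + x) * (s + (1 - s) * x) - x = s + (1 - s) * x\<^sup>2" by (simp add: power2_eq_square algebra_simps)
    moreover have "0 \<le> s + (1 - s) * x\<^sup>2" using hmean by (simp add: add_nonneg_nonneg)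
    ultimately show ?thesis by linarith
  qed
  then show ?case using d assms(2) by (simp add: hmean_of_real pos_divide_le_eq)
next
  case (mix g h u)
  have "(1 - u) * Re (g (of_real x)) + u * Re (h (of_real x)) \<le> (1 - u) * (1 + x) + u * (1 + x)"
    using mix by (intro add_mono mult_left_mono) auto
  moreover have "\<dots> = 1 + x" by (simp add: algebra_simps)
  ultimately show ?case using mix by (simp add: add_nonneg_nonneg)
qed

text \<open>Otherwise a nearly closest point \<open>g\<close> of the hull yields a linear functional separating \<open>f\<close> from all
  \<open>hmean s\<close>; the node \<open>1\<close>, where all these functions equal \<open>1\<close>, absorbs its constant.\<close>

lemma hmean_hull_approx:
  assumes mono: "rank_one_monotone f" and f_pos: "\<And>x. 0 < x \<Longrightarrow> 0 < f x" and f_one: "f 1 = 1"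
    and growth: "\<And>x. 1 \<le> x \<Longrightarrow> f x \<le> C * x"
    and fin0: "finite Z\<^sub>0" and pos0: "\<And>z. z \<in> Z\<^sub>0 \<Longrightarrow> 0 < z" and e: "0 < e"
  shows "\<exists>g\<in>hmean_hull. \<forall>z\<in>Z\<^sub>0. norm (g (of_real z) - of_real (f z)) < e"
proof -
  \<comment> \<open>The nodes are enlarged so that \<open>1\<close> is among them and their number
    is odd; a spare node \<open>M\<close> above all others corrects the parity.\<close>
  obtain Z j where Z: "finite Z" "\<And>z. z \<in> Z \<Longrightarrow> 0 < z" "Z\<^sub>0 \<subseteq> Z" "1 \<in> Z" "card Z = Suc (2 * j)"
  proof (cases "odd (card (insert 1 Z\<^sub>0))")
    case True
    then obtain j where "card (insert 1 Z\<^sub>0) = Suc (2 * j)" by (elim oddE) simp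
    then show ?thesis by (intro that[of "insert 1 Z\<^sub>0" j]) (use fin0 pos0 in auto)
  next
    case False
    then obtain j where j: "card (insert 1 Z\<^sub>0) = 2 * j" by (metis evenE)
    define M where "M = Max (insert 1 Z\<^sub>0) + 1"
    have M: "z < M" if "z \<in> insert 1 Z\<^sub>0" for z
    proof -
      have "z \<le> Max (insert 1 Z\<^sub>0)" using fin0 that by (intro Max_ge) auto
      then show ?thesis unfolding M_def by linarith
    qed
    then have "M \<notin> insert 1 Z\<^sub>0" by blast
    then have "card (insert M (insert 1 Z\<^sub>0)) = Suc (2 * j)" using fin0 j by simp
    moreover have "0 < M" using M[of 1] by simp
    ultimately show ?thesis
      by (intro that[of "insert M (insert 1 Z\<^sub>0)" j]) (use fin0 pos0 in auto)
  qed
  define N where "N g = (\<Sum>z\<in>Z. (Re (g (of_real z)) - f z)\<^sup>2)" for g :: "complex \<Rightarrow> complex"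
  have N0: "0 \<le> N g" for g by (simp add: N_def sum_nonneg)
  have ne: "hmean 0 \<in> hmean_hull" by (rule hmean_hull.hmean) auto
  define d where "d = Inf (N ` hmean_hull)"
  have bdd: "bdd_below (N ` hmean_hull)" using N0 by (intro bdd_belowI2[of _ 0])
  have d_le: "d \<le> N g" if "g \<in> hmean_hull" for g
    unfolding d_def using that bdd by (intro cINF_lower) auto
  have "\<not> 0 < d"
  proof
    assume d: "0 < d"
    define K where "K = (\<Sum>z\<in>Z. (1 + z)\<^sup>2)"
    have K: "0 \<le> K" by (simp add: K_def sum_nonneg)
    \<comment> \<open>\<open>K\<close> bounds the squared length of every chord from the point of a
      hull member to that of some \<open>hmean s\<close>. With this \<open>t\<close>, the
      suboptimality \<open>t\<^sup>2\<close> of \<open>g\<close> and the quadratic term of a step of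
      size \<open>t\<close> together cost at most \<open>d / 2\<close> in the slope.\<close>
    define t where "t = min 1 (d / (1 + K))"
    have t: "0 < t" "t \<le> 1" using d K by (auto simp: t_def)
    have "t \<le> d / (1 + K)" by (simp add: t_def)
    then have tK: "t * (1 + K) \<le> d" using K by (simp add: pos_le_divide_eq)
    have "\<exists>g\<in>hmean_hull. N g < d + t\<^sup>2"
    proof (rule ccontr)
      assume "\<not> ?thesis"
      then have "d + t\<^sup>2 \<le> d" unfolding d_def using ne by (intro cINF_greatest) (auto simp: not_less d_def)
      then show False using t by simp
    qed
    then obtain g where g: "g \<in> hmean_hull" "N g < d + t\<^sup>2" by blast
    define a where "a z = Re (g (of_real z)) - f z" for z
    define B where "B = (\<Sum>z\<in>Z. a z * f z) + d / 2"
    \<comment> \<open>A step from \<open>g\<close> towards \<open>hmean s\<close> cannot bring the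
      squared distance below its infimum, which bounds the slope by \<open>- d / 2\<close> from
      below. As \<open>N g\<close> is at least \<open>d\<close>, a margin of \<open>d / 2\<close>
      remains in \<open>B\<close>.\<close>
    have sep: "B \<le> (\<Sum>z\<in>Z. a z * Re (hmean s (of_real z)))" if s: "0 \<le> s" "s \<le> 1" for s
    proof -
      define b where "b z = Re (hmean s (of_real z)) - Re (g (of_real z))" for z
      have hs: "hmean s \<in> hmean_hull" using s by (rule hmean_hull.hmean)
      have "d \<le> N (\<lambda>z. of_real (1 - t) * g z + of_real t * hmean s z)"
        by (intro d_le hmean_hull.mix g hs) (use t in auto)
      also have "\<dots> = (\<Sum>z\<in>Z. (a z + t * b z)\<^sup>2)"
        unfolding N_def by (intro sum.cong refl) (simp add: a_def b_def algebra_simps)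
      also have "\<dots> = (\<Sum>z\<in>Z. (a z)\<^sup>2 + 2 * t * (a z * b z) + t\<^sup>2 * (b z)\<^sup>2)"
        by (intro sum.cong refl) (simp add: power2_eq_square algebra_simps)
      also have "\<dots> = N g + 2 * t * (\<Sum>z\<in>Z. a z * b z) + t\<^sup>2 * (\<Sum>z\<in>Z. (b z)\<^sup>2)"
        by (simp add: sum.distrib sum_distrib_left N_def a_def)
      finally have exp: "d \<le> N g + 2 * t * (\<Sum>z\<in>Z. a z * b z) + t\<^sup>2 * (\<Sum>z\<in>Z. (b z)\<^sup>2)" .
      have "(\<Sum>z\<in>Z. (b z)\<^sup>2) \<le> K"
        unfolding K_def
      proof (rule sum_mono)
        fix z assume "z \<in> Z"
        then have "0 < z" using Z by blast
        then have "\<bar>b z\<bar> \<le> 1 + z"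
          using hmean_hull_of_real[OF hs, of z] hmean_hull_of_real[OF g(1), of z] unfolding b_def by linarith
        then show "(b z)\<^sup>2 \<le> (1 + z)\<^sup>2" using \<open>0 < z\<close> by (intro abs_le_square_iff[THEN iffD1]) simp
      qed
      then have "t\<^sup>2 * (\<Sum>z\<in>Z. (b z)\<^sup>2) \<le> t\<^sup>2 * K" by (intro mult_left_mono) auto
      then have "0 \<le> t\<^sup>2 + 2 * t * (\<Sum>z\<in>Z. a z * b z) + t\<^sup>2 * K"
        using exp g(2) by linarith
      also have "\<dots> = t * (t * (1 + K) + 2 * (\<Sum>z\<in>Z. a z * b z))"
        by (simp add: power2_eq_square algebra_simps)
      finally have "0 \<le> t * (1 + K) + 2 * (\<Sum>z\<in>Z. a z * b z)"
        using t(1) by (simp add: zero_le_mult_iff)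
      then have "- d / 2 \<le> (\<Sum>z\<in>Z. a z * b z)" using tK by simp
      moreover have "(\<Sum>z\<in>Z. a z * Re (hmean s (of_real z))) = (\<Sum>z\<in>Z. a z * b z) + N g + (\<Sum>z\<in>Z. a z * f z)"
        by (simp add: N_def a_def b_def sum.distrib[symmetric] power2_eq_square algebra_simps)
      ultimately show ?thesis using d_le[OF g(1)] by (simp add: B_def)
    qed
    define c where "c z = a z - (if z = 1 then B else 0)" for z
    have csum: "(\<Sum>z\<in>Z. c z * F z) = (\<Sum>z\<in>Z. a z * F z) - B" if "F 1 = 1" for F
    proof -
      have "(\<Sum>z\<in>Z. c z * F z) = (\<Sum>z\<in>Z. a z * F z) - (\<Sum>z\<in>Z. if z = 1 then B else 0)"
        unfolding sum_subtractf[symmetric] by (intro sum.cong refl) (auto simp: c_def that algebra_simps)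
      then show ?thesis using Z by simp
    qed
    have "0 \<le> (\<Sum>z\<in>Z. c z * f z)"
    proof (rule lowner_functional_nonneg[OF mono f_pos growth Z(1,2,5)])
      fix x :: real assume x: "0 \<le> x"
      define s where "s = x / (1 + x)"
      have s: "0 \<le> s" "s \<le> 1" using x by (auto simp: s_def)
      have h: "Re (hmean s (of_real z)) = (1 + x) * (z / (x + z))" if "0 < z" for z
      proof -
        have "1 - s = 1 / (1 + x)" using x by (simp add: s_def field_simps)
        then have "s + (1 - s) * z = (x + z) / (1 + x)" by (simp add: s_def add_divide_distrib)
        then show ?thesis using x that by (simp add: hmean_of_real mult.commute)
      qed
      have "0 \<le> (\<Sum>z\<in>Z. c z * Re (hmean s (of_real z)))"
        using sep[OF s] by (subst csum) (auto simp: hmean_def)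
      also have "\<dots> = (1 + x) * (\<Sum>z\<in>Z. c z * (z / (x + z)))"
        unfolding sum_distrib_left using Z(2) by (intro sum.cong refl) (auto simp: h)
      finally show "0 \<le> (\<Sum>z\<in>Z. c z * (z / (x + z)))" using x by (simp add: zero_le_mult_iff)
    qed
    \<comment> \<open>At \<open>f\<close> the separating functional takes the value
      \<open>- d / 2\<close>.\<close>
    then show False using csum[of f] f_one d by (simp add: B_def)
  qed
  then have "\<not> e\<^sup>2 \<le> d" using e by (smt (verit) zero_less_power2)
  then have "\<exists>g\<in>hmean_hull. N g < e\<^sup>2"
    unfolding d_def using ne by (metis cINF_greatest empty_iff not_less)
  then obtain g where g: "g \<in> hmean_hull" "N g < e\<^sup>2" by blast
  have "norm (g (of_real z) - of_real (f z)) < e" if "z \<in> Z\<^sub>0" for z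
  proof -
    have zZ: "z \<in> Z" "0 < z" using that Z by auto
    have "g (of_real z) = of_real (Re (g (of_real z)))"
      using hmean_hull_of_real[OF g(1) zZ(2)] by (simp add: complex_eq_iff)
    then have "norm (g (of_real z) - of_real (f z)) = \<bar>Re (g (of_real z)) - f z\<bar>"
      by (metis norm_of_real of_real_diff)
    moreover have "(Re (g (of_real z)) - f z)\<^sup>2 \<le> N g"
      unfolding N_def using Z(1) zZ(1) by (intro member_le_sum) auto
    then have "(Re (g (of_real z)) - f z)\<^sup>2 < e\<^sup>2" using g(2) by linarith
    then have "\<bar>Re (g (of_real z)) - f z\<bar> < e" using e by (intro power2_less_imp_less[of "\<bar>_\<bar>" e]) auto
    ultimately show ?thesis by simp
  qed
  then show ?thesis using g(1) by blast
qed

section \<open>Approximation on the slit plane\<close>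

text \<open>For \<open>s < 1\<close> the denominator vanishes only at \<open>- s / (1 - s)\<close>,
  a point of the cut.\<close>

lemma hmean_denom_nonzero:
  assumes "0 \<le> s" "s \<le> 1" "z \<notin> \<real>\<^sub>\<le>\<^sub>0"
  shows "complex_of_real s + complex_of_real (1 - s) * z \<noteq> 0"
proof
  assume eq: "complex_of_real s + complex_of_real (1 - s) * z = 0"
  have re: "s + (1 - s) * Re z = 0" and im: "(1 - s) * Im z = 0"
    using arg_cong[OF eq, of Re] arg_cong[OF eq, of Im] by simp_all
  have s1: "s \<noteq> 1" using re by auto
  then have "Im z = 0" using im by simp
  moreover have "Re z \<le> 0"
  proof (rule ccontr)
    assume "\<not> Re z \<le> 0"
    then have "0 < (1 - s) * Re z" using assms s1 by simp
    then show False using re assms by simp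
  qed
  ultimately show False using assms(3) by (simp add: complex_nonpos_Reals_iff)
qed

lemma hmean_hull_holomorphic: "g \<in> hmean_hull \<Longrightarrow> g holomorphic_on - \<real>\<^sub>\<le>\<^sub>0"
proof (induction rule: hmean_hull.induct)
  case (hmean s)
  then show ?case unfolding hmean_def
    by (intro holomorphic_intros) (use hmean_denom_nonzero in auto)
qed (intro holomorphic_intros)

text \<open>\<open>hmean s z\<close> is jointly continuous on the compact set
  \<open>{0..1} \<times> K\<close>, and mixtures respect the bound. This is the local boundedness
  behind Montel's theorem.\<close>

lemma hmean_hull_bounded:
  assumes K: "compact K" "K \<subseteq> - \<real>\<^sub>\<le>\<^sub>0"
  shows "\<exists>B. \<forall>g\<in>hmean_hull. \<forall>z\<in>K. norm (g z) \<le> B"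
proof -
  have "continuous_on ({0..1} \<times> K) (\<lambda>(s, z). hmean s z)"
    unfolding hmean_def split_def
    by (intro continuous_intros) (use K hmean_denom_nonzero in auto)
  moreover have "compact ({0..1::real} \<times> K)" using K by (intro compact_Times) auto
  ultimately have "bounded ((\<lambda>(s, z). hmean s z) ` ({0..1} \<times> K))"
    by (intro compact_imp_bounded compact_continuous_image)
  then obtain B where B: "\<And>s z. s \<in> {0..1} \<Longrightarrow> z \<in> K \<Longrightarrow> norm (hmean s z) \<le> B"
    unfolding bounded_iff by fastforce
  have "\<forall>z\<in>K. norm (g z) \<le> B" if "g \<in> hmean_hull" for g
    using that
  proof (induction rule: hmean_hull.induct)
    case (hmean s)
    then show ?case using B by simp
  next
    case (mix g h u)
    show ?case
    proof
      fix z assume z: "z \<in> K"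
      have "norm (of_real (1 - u) * g z + of_real u * h z) \<le> (1 - u) * norm (g z) + u * norm (h z)"
        using mix by (intro norm_triangle_le) (simp add: norm_mult del: of_real_diff)
      also have "\<dots> \<le> (1 - u) * B + u * B"
        using mix z by (intro add_mono mult_left_mono) auto
      finally show "norm (of_real (1 - u) * g z + of_real u * h z) \<le> B" by (simp add: algebra_simps)
    qed
  qed
  then show ?thesis by blast
qed

lemma connected_slit_plane: "connected (- \<real>\<^sub>\<le>\<^sub>0 :: complex set)"
proof -
  have "(\<real>\<^sub>\<le>\<^sub>0 :: complex set) = complex_of_real ` {..0}" by (auto simp: nonpos_Reals_def)
  then show ?thesis
    using starlike_imp_connected[OF starlike_slotted_complex_plane_left[of 0]] by simp
qed

lemma open_slit_plane: "open (- \<real>\<^sub>\<le>\<^sub>0 :: complex set)"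
  by (simp add: open_Compl)

text \<open>The approximants match \<open>f\<close> on growing initial segments of an enumeration of
  the positive rationals. A Montel limit \<open>F\<close> agrees with \<open>f\<close> there and, by
  continuity, on the half-line. It is thus a witness for the choice in \<open>analytic_ext\<close>,
  and the identity theorem identifies the chosen extension with \<open>F\<close>.\<close>

lemma analytic_ext_limit:
  assumes mono: "rank_one_monotone f" and f_pos: "\<And>x. 0 < x \<Longrightarrow> 0 < f x" and f_one: "f 1 = 1"
    and growth: "\<And>x. 1 \<le> x \<Longrightarrow> f x \<le> C * x" and cont: "continuous_on {0<..} f"
  shows "analytic_ext f holomorphic_on - \<real>\<^sub>\<le>\<^sub>0"
    and "\<exists>g. (\<forall>n. g n \<in> hmean_hull) \<and>
      (\<forall>K. compact K \<longrightarrow> K \<subseteq> - \<real>\<^sub>\<le>\<^sub>0 \<longrightarrow> uniform_limit K g (analytic_ext f) sequentially)"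
proof -
  define D where "D = (\<rat> \<inter> {0<..} :: real set)"
  have "countable D" unfolding D_def by (intro countable_Int1 countable_rat)
  moreover have "1 \<in> D" by (simp add: D_def)
  ultimately have rng: "range (from_nat_into D) = D" by (intro range_from_nat_into) auto
  define e where "e = from_nat_into D"
  have "\<exists>g\<in>hmean_hull. \<forall>z\<in>e ` {..n}. norm (g (of_real z) - of_real (f z)) < 1 / real (Suc n)" for n
    by (rule hmean_hull_approx[OF mono f_pos f_one growth]) (use rng in \<open>auto simp: e_def D_def\<close>)
  then have "\<exists>G. \<forall>n. G n \<in> hmean_hull \<and>
      (\<forall>z\<in>e ` {..n}. norm (G n (of_real z) - of_real (f z)) < 1 / real (Suc n))"
    unfolding Bex_def by (rule choice[OF allI])
  then obtain G where G: "\<And>n. G n \<in> hmean_hull"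
    "\<And>n i. i \<le> n \<Longrightarrow> norm (G n (of_real (e i)) - of_real (f (e i))) < 1 / real (Suc n)"
    by blast
  have "\<exists>F r. F holomorphic_on - \<real>\<^sub>\<le>\<^sub>0 \<and> strict_mono (r :: nat \<Rightarrow> nat) \<and>
      (\<forall>x. x \<in> - \<real>\<^sub>\<le>\<^sub>0 \<longrightarrow> (\<lambda>n. G (r n) x) \<longlonglongrightarrow> F x) \<and>
      (\<forall>K. compact K \<longrightarrow> K \<subseteq> - \<real>\<^sub>\<le>\<^sub>0 \<longrightarrow> uniform_limit K (G \<circ> r) F sequentially)"
  proof (rule Montel[OF open_slit_plane, of hmean_hull G])
    show "h holomorphic_on - \<real>\<^sub>\<le>\<^sub>0" if "h \<in> hmean_hull" for h
      using that by (rule hmean_hull_holomorphic)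
    show "\<exists>B. \<forall>h\<in>hmean_hull. \<forall>z\<in>K. cmod (h z) \<le> B" if "compact K" "K \<subseteq> - \<real>\<^sub>\<le>\<^sub>0" for K
      using that by (rule hmean_hull_bounded)
    show "range G \<subseteq> hmean_hull" using G(1) by auto
  qed blast
  then obtain F r where F: "F holomorphic_on - \<real>\<^sub>\<le>\<^sub>0" and r: "strict_mono (r :: nat \<Rightarrow> nat)"
    and ptw: "\<And>x. x \<in> - \<real>\<^sub>\<le>\<^sub>0 \<Longrightarrow> (\<lambda>n. G (r n) x) \<longlonglongrightarrow> F x"
    and unif: "\<And>K. compact K \<Longrightarrow> K \<subseteq> - \<real>\<^sub>\<le>\<^sub>0 \<Longrightarrow> uniform_limit K (G \<circ> r) F sequentially"
    by blast
  have slit: "complex_of_real x \<in> - \<real>\<^sub>\<le>\<^sub>0" if "0 < x" for x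
    using that by (simp add: complex_nonpos_Reals_iff)
  have FD: "F (of_real x) = of_real (f x)" if "x \<in> D" for x
  proof -
    have "x \<in> range e" unfolding e_def rng by (rule that)
    then obtain i where i: "x = e i" by (rule rangeE)
    have lim: "(\<lambda>n. G n (of_real x) - of_real (f x)) \<longlonglongrightarrow> 0"
    proof (rule Lim_null_comparison)
      show "\<forall>\<^sub>F n in sequentially. norm (G n (of_real x) - of_real (f x)) \<le> 1 / real (Suc n)"
        using eventually_ge_at_top[of i] by eventually_elim (use G(2) i in \<open>auto intro: less_imp_le\<close>)
      show "(\<lambda>n. 1 / real (Suc n)) \<longlonglongrightarrow> 0" using LIMSEQ_inverse_real_of_nat by (simp add: inverse_eq_divide)
    qed
    then have "(\<lambda>n. G n (of_real x)) \<longlonglongrightarrow> of_real (f x)" by (simp only: LIM_zero_iff)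
    then have "(\<lambda>n. G (r n) (of_real x)) \<longlonglongrightarrow> of_real (f x)"
      using r by (rule LIMSEQ_subseq_LIMSEQ[unfolded o_def])
    moreover have "(\<lambda>n. G (r n) (of_real x)) \<longlonglongrightarrow> F (of_real x)"
      using that by (intro ptw slit) (simp add: D_def)
    ultimately show ?thesis using LIMSEQ_unique by blast
  qed
  have Ff: "F (of_real x) = of_real (f x)" if x: "0 < x" for x
  proof -
    have "\<exists>q\<in>\<rat>. x < q \<and> q < x + 1 / real (Suc n)" for n by (intro Rats_dense_in_real) simp
    then obtain q where q: "\<And>n. q n \<in> \<rat>" "\<And>n. x < q n" "\<And>n. q n < x + 1 / real (Suc n)" by metis
    have qx: "q \<longlonglongrightarrow> x"
    proof (rule tendsto_sandwich[of "\<lambda>_. x" q sequentially "\<lambda>n. x + 1 / real (Suc n)"])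
      show "(\<lambda>n. x + 1 / real (Suc n)) \<longlonglongrightarrow> x"
        using tendsto_add[OF tendsto_const[of x] LIMSEQ_inverse_real_of_nat] by (simp add: inverse_eq_divide)
      show "\<forall>\<^sub>F n in sequentially. x \<le> q n" "\<forall>\<^sub>F n in sequentially. q n \<le> x + 1 / real (Suc n)"
        by (intro always_eventually allI less_imp_le q)+
    qed (rule tendsto_const)
    have "q n \<in> D" for n using q[of n] x by (simp add: D_def)
    then have eq: "F (of_real (q n)) = of_real (f (q n))" for n by (rule FD)
    have "isCont F (of_real x)"
      using F slit[OF x] open_slit_plane holomorphic_on_imp_continuous_on continuous_on_eq_continuous_at by blast
    then have "(\<lambda>n. F (of_real (q n))) \<longlonglongrightarrow> F (of_real x)"
      by (rule isCont_tendsto_compose) (intro tendsto_of_real qx)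
    moreover have "isCont f x" using cont x by (simp add: continuous_on_eq_continuous_at)
    then have "(\<lambda>n. complex_of_real (f (q n))) \<longlonglongrightarrow> of_real (f x)"
      by (intro tendsto_of_real isCont_tendsto_compose[OF _ qx])
    ultimately show ?thesis using eq LIMSEQ_unique by (metis (no_types, lifting) ext)
  qed
  have "analytic_ext f holomorphic_on - \<real>\<^sub>\<le>\<^sub>0 \<and>
      (\<forall>x > 0. analytic_ext f (complex_of_real x) = complex_of_real (f x))"
    unfolding analytic_ext_def by (rule someI[of _ F]) (use F Ff in auto)
  then have E: "analytic_ext f holomorphic_on - \<real>\<^sub>\<le>\<^sub>0"
    "\<And>x. 0 < x \<Longrightarrow> analytic_ext f (complex_of_real x) = complex_of_real (f x)" by auto
  show "analytic_ext f holomorphic_on - \<real>\<^sub>\<le>\<^sub>0" by (rule E)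
  \<comment> \<open>The identity theorem asks for a limit point of the set where the two functions
    agree.\<close>
  have lp: "complex_of_real 1 islimpt (complex_of_real ` {0<..})"
  proof (rule islimpt_sequential[THEN iffD2], intro exI[of _ "\<lambda>n. complex_of_real (1 + 1 / real (Suc n))"] conjI allI)
    show "complex_of_real (1 + 1 / real (Suc n)) \<in> complex_of_real ` {0<..} - {complex_of_real 1}" for n
    proof -
      have pos: "0 < 1 / real (Suc n)" by simp
      show ?thesis
      proof (intro DiffI imageI)
        show "1 + 1 / real (Suc n) \<in> {0<..}" using pos unfolding greaterThan_iff by linarith
        show "complex_of_real (1 + 1 / real (Suc n)) \<notin> {complex_of_real 1}"
          using pos unfolding singleton_iff of_real_eq_iff by linarith
      qed
    qed
    show "(\<lambda>n. complex_of_real (1 + 1 / real (Suc n))) \<longlonglongrightarrow> complex_of_real 1"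
      using tendsto_of_real[OF tendsto_add[OF tendsto_const[of 1] LIMSEQ_inverse_real_of_nat]]
      unfolding inverse_eq_divide add_0_right .
  qed
  have same: "analytic_ext f z = F z" if "z \<in> - \<real>\<^sub>\<le>\<^sub>0" for z
  proof -
    have "analytic_ext f z - F z = 0"
      by (rule analytic_continuation[OF holomorphic_on_diff[OF E(1) F] open_slit_plane connected_slit_plane _ _ lp _ that])
         (use slit E(2) Ff in auto)
    then show ?thesis by simp
  qed
  have "uniform_limit K (G \<circ> r) (analytic_ext f) sequentially" if "compact K" "K \<subseteq> - \<real>\<^sub>\<le>\<^sub>0" for K
    using unif[OF that] by (rule uniform_limit_cong'[THEN iffD1, rotated 2]) (use same that in auto)
  then show "\<exists>g. (\<forall>n. g n \<in> hmean_hull) \<and>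
      (\<forall>K. compact K \<longrightarrow> K \<subseteq> - \<real>\<^sub>\<le>\<^sub>0 \<longrightarrow> uniform_limit K g (analytic_ext f) sequentially)"
    using G(1) by (intro exI[of _ "G \<circ> r"]) auto
qed

section \<open>Unitary diagonalization\<close>

text \<open>The real part makes this meaningful for non-Hermitian matrices, where it is the
  quadratic form of the Hermitian part.\<close>

definition qform :: "complex mat \<Rightarrow> complex vec \<Rightarrow> real" where
  "qform A x = Re ((A *\<^sub>v x) \<bullet>c x)"

lemma mat_adjoint_dim [simp]:
  "dim_row (mat_adjoint A) = dim_col A" "dim_col (mat_adjoint A) = dim_row A"
  by (simp_all add: mat_adjoint_def)

lemma mat_adjoint_carrier [simp]: "A \<in> carrier_mat n m \<Longrightarrow> mat_adjoint A \<in> carrier_mat m n"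
  by (rule carrier_matI) simp_all

lemma mult_square_carrier [simp]:
  "A \<in> carrier_mat n n \<Longrightarrow> B \<in> carrier_mat n n \<Longrightarrow> A * B \<in> carrier_mat n n"
  by (rule mult_carrier_mat)

lemma mult_square_vec_carrier [simp]:
  "A \<in> carrier_mat n n \<Longrightarrow> x \<in> carrier_vec n \<Longrightarrow> A *\<^sub>v x \<in> carrier_vec n"
  by (rule mult_mat_vec_carrier)

lemma mat_adjoint_index [simp]:
  "i < dim_col A \<Longrightarrow> j < dim_row A \<Longrightarrow> mat_adjoint A $$ (i, j) = cnj (A $$ (j, i))"
  for A :: "complex mat"
  by (auto simp: mat_adjoint_def mat_of_rows_def)

lemma cscalar_prod_sum:
  "dim_vec y = n \<Longrightarrow> x \<bullet>c y = (\<Sum>i<n. x $ i * cnj (y $ i))" for x y :: "complex vec"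
  by (auto simp: scalar_prod_def atLeast0LessThan)

lemma mult_mat_vec_index:
  "A \<in> carrier_mat n m \<Longrightarrow> x \<in> carrier_vec m \<Longrightarrow> i < n \<Longrightarrow> (A *\<^sub>v x) $ i = (\<Sum>j<m. A $$ (i, j) * x $ j)"
  for A :: "complex mat"
  by (auto simp: scalar_prod_def atLeast0LessThan)

lemma mult_mat_index:
  "A \<in> carrier_mat n m \<Longrightarrow> B \<in> carrier_mat m l \<Longrightarrow> i < n \<Longrightarrow> j < l \<Longrightarrow>
    (A * B) $$ (i, j) = (\<Sum>k<m. A $$ (i, k) * B $$ (k, j))"
  for A :: "complex mat"
  by (auto simp: scalar_prod_def atLeast0LessThan)

lemma cscalar_prod_adjoint:
  fixes A :: "complex mat"
  assumes A: "A \<in> carrier_mat n m" and x: "x \<in> carrier_vec m" and y: "y \<in> carrier_vec n"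
  shows "(A *\<^sub>v x) \<bullet>c y = x \<bullet>c (mat_adjoint A *\<^sub>v y)"
proof -
  have A': "mat_adjoint A \<in> carrier_mat m n" using A by simp
  have "(A *\<^sub>v x) \<bullet>c y = (\<Sum>i<n. \<Sum>j<m. A $$ (i, j) * x $ j * cnj (y $ i))"
    using y by (simp add: cscalar_prod_sum[of y n] mult_mat_vec_index[OF A x] sum_distrib_right del: index_mult_mat_vec)
  also have "\<dots> = (\<Sum>j<m. \<Sum>i<n. A $$ (i, j) * x $ j * cnj (y $ i))" by (rule sum.swap)
  also have "\<dots> = (\<Sum>j<m. x $ j * cnj (\<Sum>i<n. mat_adjoint A $$ (j, i) * y $ i))"
    using A by (intro sum.cong refl) (simp add: sum_distrib_left mult_ac)
  also have "\<dots> = x \<bullet>c (mat_adjoint A *\<^sub>v y)"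
    using A by (simp add: cscalar_prod_sum[of _ m] mult_mat_vec_index[OF A' y] del: index_mult_mat_vec)
  finally show ?thesis .
qed

lemma mat_adjoint_mult:
  fixes A B :: "complex mat"
  assumes A: "A \<in> carrier_mat n m" and B: "B \<in> carrier_mat m l"
  shows "mat_adjoint (A * B) = mat_adjoint B * mat_adjoint A"
proof (rule eq_matI)
  fix i j assume "i < dim_row (mat_adjoint B * mat_adjoint A)" "j < dim_col (mat_adjoint B * mat_adjoint A)"
  then have i: "i < l" and j: "j < n" using A B by auto
  have AB: "A * B \<in> carrier_mat n l" using A B by (rule mult_carrier_mat)
  have A': "mat_adjoint A \<in> carrier_mat m n" and B': "mat_adjoint B \<in> carrier_mat l m" using A B by simp_all
  have "mat_adjoint (A * B) $$ (i, j) = cnj ((A * B) $$ (j, i))"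
    by (rule mat_adjoint_index) (use carrier_matD[OF AB] i j in auto)
  also have "\<dots> = (\<Sum>k<m. cnj (A $$ (j, k)) * cnj (B $$ (k, i)))"
    unfolding mult_mat_index[OF A B j i] by simp
  also have "\<dots> = (\<Sum>k<m. mat_adjoint B $$ (i, k) * mat_adjoint A $$ (k, j))"
    using A B i j by (intro sum.cong refl) (simp add: mult.commute)
  also have "\<dots> = (mat_adjoint B * mat_adjoint A) $$ (i, j)"
    unfolding mult_mat_index[OF B' A' i j] by simp
  finally show "mat_adjoint (A * B) $$ (i, j) = (mat_adjoint B * mat_adjoint A) $$ (i, j)" .
qed (use A B in auto)

lemma mat_adjoint_adjoint: "mat_adjoint (mat_adjoint A) = A" for A :: "complex mat"
  by (rule eq_matI) auto

definition real_diag :: "nat \<Rightarrow> (nat \<Rightarrow> real) \<Rightarrow> complex mat" where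
  "real_diag n d = mat_diag n (\<lambda>i. complex_of_real (d i))"

lemma real_diag_carrier: "real_diag n d \<in> carrier_mat n n"
  by (simp add: real_diag_def)

lemma mat_adjoint_real_diag: "mat_adjoint (real_diag n d) = real_diag n d"
  by (rule eq_matI) (auto simp: real_diag_def mat_diag_def)

context
  fixes U :: "complex mat" and n :: nat
  assumes U: "U \<in> carrier_mat n n" and unitary: "unitary_mat U"
begin

lemma unitary_left: "mat_adjoint U * U = 1\<^sub>m n" and unitary_right: "U * mat_adjoint U = 1\<^sub>m n"
  using U unitary by (auto simp: unitary_mat_def)

lemma unitary_conj_diag_carrier: "U * real_diag n d * mat_adjoint U \<in> carrier_mat n n"
  using U real_diag_carrier[of n d] by simp

lemma unitary_conj_diag_hermitian: "hermitian (U * real_diag n d * mat_adjoint U)"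
proof -
  have "mat_adjoint (U * real_diag n d * mat_adjoint U) = U * (real_diag n d * mat_adjoint U)"
    using U real_diag_carrier[of n d] by (simp add: mat_adjoint_mult[of _ n n _ n] mat_adjoint_adjoint mat_adjoint_real_diag)
  also have "\<dots> = U * real_diag n d * mat_adjoint U"
    using U real_diag_carrier[of n d] by (simp add: assoc_mult_mat[of _ n n _ n _ n])
  finally show ?thesis using U real_diag_carrier[of n d] by (simp add: hermitian_def)
qed

lemma qform_unitary_conj_diag:
  assumes x: "x \<in> carrier_vec n"
  shows "qform (U * real_diag n d * mat_adjoint U) x = (\<Sum>j<n. d j * (cmod ((mat_adjoint U *\<^sub>v x) $ j))\<^sup>2)"
proof -
  define y where "y = mat_adjoint U *\<^sub>v x"
  have y: "y \<in> carrier_vec n" using U x by (simp add: y_def)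
  have e1: "(U * real_diag n d * mat_adjoint U) *\<^sub>v x = U *\<^sub>v (real_diag n d *\<^sub>v y)"
    using U x real_diag_carrier[of n d] by (simp add: y_def assoc_mult_mat_vec[of _ n n _ n])
  have e2: "(U *\<^sub>v (real_diag n d *\<^sub>v y)) \<bullet>c x = (real_diag n d *\<^sub>v y) \<bullet>c y"
    unfolding y_def by (rule cscalar_prod_adjoint[of _ n n]) (use U x real_diag_carrier[of n d] in simp_all)
  have Dy: "(real_diag n d *\<^sub>v y) $ j = of_real (d j) * y $ j" if "j < n" for j
    using that y by (subst mult_mat_vec_index[OF real_diag_carrier y that]) 
      (auto simp: real_diag_def mat_diag_def if_distrib[of "\<lambda>u. u * _"] cong: if_cong)
  have "(real_diag n d *\<^sub>v y) \<bullet>c y = (\<Sum>j<n. of_real (d j) * y $ j * cnj (y $ j))"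
    using y Dy by (subst cscalar_prod_sum[of y n]) auto
  also have "\<dots> = (\<Sum>j<n. of_real (d j * (cmod (y $ j))\<^sup>2))"
    by (simp only: of_real_mult complex_norm_square mult.assoc)
  finally show ?thesis
    unfolding qform_def e1 e2 y_def[symmetric] by simp
qed

lemma unitary_conj_diag_pos_def:
  assumes d: "\<And>j. j < n \<Longrightarrow> 0 < d j"
  shows "pos_def (U * real_diag n d * mat_adjoint U)"
  unfolding pos_def_def
proof (intro conjI ballI impI unitary_conj_diag_hermitian)
  fix x :: "complex vec" assume "x \<in> carrier_vec (dim_row (U * real_diag n d * mat_adjoint U))"
    and "x \<noteq> 0\<^sub>v (dim_row (U * real_diag n d * mat_adjoint U))"
  then have x: "x \<in> carrier_vec n" and x0: "x \<noteq> 0\<^sub>v n" using U by auto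
  define y where "y = mat_adjoint U *\<^sub>v x"
  have y: "y \<in> carrier_vec n" using U x by (simp add: y_def)
  have "U *\<^sub>v y = (U * mat_adjoint U) *\<^sub>v x"
    unfolding y_def by (rule assoc_mult_mat_vec[symmetric, of _ n n _ n]) (use U x in auto)
  then have Uy: "U *\<^sub>v y = x" using x unitary_right by simp
  have "U *\<^sub>v 0\<^sub>v n = 0\<^sub>v n" using U by (intro eq_vecI) auto
  then have "y \<noteq> 0\<^sub>v n" using Uy x0 by metis
  moreover have "y = 0\<^sub>v n" if "\<And>j. j < n \<Longrightarrow> y $ j = 0"
    by (rule eq_vecI) (use that y in auto)
  ultimately obtain j where j: "j < n" "y $ j \<noteq> 0" by blast
  have "0 < (\<Sum>j<n. d j * (cmod (y $ j))\<^sup>2)"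
  proof (rule sum_pos2[of _ j])
    show "0 < d j * (cmod (y $ j))\<^sup>2" using j d by simp
    show "0 \<le> d i * (cmod (y $ i))\<^sup>2" if "i \<in> {..<n}" for i using d[of i] that by simp
  qed (use j in auto)
  then show "0 < Re (((U * real_diag n d * mat_adjoint U) *\<^sub>v x) \<bullet>c x)"
    using qform_unitary_conj_diag[OF x, of d] by (simp only: qform_def y_def)
qed

end

text \<open>Two unitary diagonalizations are intertwined by \<open>W\<close>, and \<open>W\<close> only links equal eigenvalues;
  hence it also intertwines the images under \<open>f\<close>.\<close>

lemma herm_fun_unitary_conj_diag:
  assumes U: "U \<in> carrier_mat n n" "unitary_mat U"
  shows "herm_fun f (U * real_diag n d * mat_adjoint U) = U * real_diag n (\<lambda>i. f (d i)) * mat_adjoint U"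
  unfolding herm_fun_def
proof (rule the_equality)
  let ?X = "U * real_diag n d * mat_adjoint U"
  have dimX: "dim_row ?X = n" using U by simp
  show "\<exists>V e. unitary_mat V \<and> dim_row V = dim_row ?X \<and>
      ?X = V * mat_diag (dim_row ?X) (\<lambda>i. complex_of_real (e i)) * mat_adjoint V \<and>
      U * real_diag n (\<lambda>i. f (d i)) * mat_adjoint U =
        V * mat_diag (dim_row ?X) (\<lambda>i. complex_of_real (f (e i))) * mat_adjoint V"
    unfolding dimX real_diag_def by (intro exI[of _ U] exI[of _ d] conjI refl) (use U in simp_all)
  fix M
  assume "\<exists>V e. unitary_mat V \<and> dim_row V = dim_row ?X \<and>
      ?X = V * mat_diag (dim_row ?X) (\<lambda>i. complex_of_real (e i)) * mat_adjoint V \<and>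
      M = V * mat_diag (dim_row ?X) (\<lambda>i. complex_of_real (f (e i))) * mat_adjoint V"
  then obtain V e where V: "unitary_mat V" "dim_row V = n"
    and X: "?X = V * real_diag n e * mat_adjoint V"
    and M: "M = V * real_diag n (\<lambda>i. f (e i)) * mat_adjoint V"
    unfolding dimX real_diag_def[symmetric] by blast
  have Vc: "V \<in> carrier_mat n n" using V by (intro carrier_matI) (simp_all add: unitary_mat_def)
  define W where "W = mat_adjoint V * U"
  define Ux Vx where "Ux = mat_adjoint U" and "Vx = mat_adjoint V"
  have c: "Ux \<in> carrier_mat n n" "Vx \<in> carrier_mat n n" "W \<in> carrier_mat n n"
    using U Vc by (simp_all add: Ux_def Vx_def W_def)
  note as = assoc_mult_mat[of _ n n _ n _ n]
  have inv: "Ux * U = 1\<^sub>m n" "U * Ux = 1\<^sub>m n" "Vx * V = 1\<^sub>m n" "V * Vx = 1\<^sub>m n"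
    using unitary_left[OF U] unitary_right[OF U] unitary_left[OF Vc V(1)] unitary_right[OF Vc V(1)]
    by (simp_all add: Ux_def Vx_def)
  have eqs: "W * D = E * W" if "U * D * Ux = V * E * Vx" "D \<in> carrier_mat n n" "E \<in> carrier_mat n n" for D E
  proof -
    have "W * D = Vx * (U * D * Ux) * U"
      using that(2) U c by (simp add: as W_def Vx_def[symmetric] inv)
    also have "\<dots> = (Vx * V) * E * W"
      unfolding that(1) using that(3) U Vc c by (simp add: as W_def Vx_def[symmetric])
    finally show ?thesis using that c by (simp add: inv)
  qed
  have eqs': "U * D * Ux = V * E * Vx" if "W * D = E * W" "D \<in> carrier_mat n n" "E \<in> carrier_mat n n" for D E
  proof -
    have "U * D * Ux = V * (W * D) * Ux"
    proof -
      have "V * (W * D) * Ux = (V * Vx) * U * D * Ux"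
        using that(2) U Vc c by (simp add: as W_def Vx_def[symmetric])
      then show ?thesis using U by (simp add: inv)
    qed
    also have "\<dots> = V * E * Vx * (U * Ux)"
      unfolding that(1) using that(3) U Vc c by (simp add: as W_def Vx_def[symmetric])
    also have "\<dots> = V * E * Vx" using that(3) Vc c by (simp add: inv as)
    finally show ?thesis .
  qed
  have eq: "W * real_diag n d = real_diag n e * W"
    using X by (intro eqs real_diag_carrier) (simp add: Ux_def Vx_def)
  have right: "(W * real_diag n g) $$ (i, j) = W $$ (i, j) * of_real (g j)" if "i < n" "j < n" for g i j
    using that c by (simp add: real_diag_def mat_diag_mult_right[OF c(3)])
  have left: "(real_diag n g * W) $$ (i, j) = of_real (g i) * W $$ (i, j)" if "i < n" "j < n" for g i j
    using that c by (simp add: real_diag_def mat_diag_mult_left[OF c(3)])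
  have "W * real_diag n (\<lambda>i. f (d i)) = real_diag n (\<lambda>i. f (e i)) * W"
  proof (rule eq_matI)
    fix i j assume "i < dim_row (real_diag n (\<lambda>i. f (e i)) * W)" "j < dim_col (real_diag n (\<lambda>i. f (e i)) * W)"
    then have ij: "i < n" "j < n" using c real_diag_carrier[of n "\<lambda>i. f (e i)"] by simp_all
    have "W $$ (i, j) * of_real (d j) = of_real (e i) * W $$ (i, j)"
      using arg_cong[OF eq, of "\<lambda>C. C $$ (i, j)"] unfolding left[OF ij] right[OF ij] .
    then have "W $$ (i, j) = 0 \<or> d j = e i" by (simp add: mult.commute)
    then show "(W * real_diag n (\<lambda>i. f (d i))) $$ (i, j) = (real_diag n (\<lambda>i. f (e i)) * W) $$ (i, j)"
      unfolding left[OF ij] right[OF ij] by auto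
  qed (use c real_diag_carrier[of n "\<lambda>i. f (e i)"] real_diag_carrier[of n "\<lambda>i. f (d i)"] in simp_all)
  then show "M = U * real_diag n (\<lambda>i. f (d i)) * mat_adjoint U"
    unfolding M by (intro eqs'[symmetric, unfolded Ux_def Vx_def] real_diag_carrier)
qed

section \<open>Matrix concave functions\<close>

lemma qform_sum:
  assumes "A \<in> carrier_mat n n" "x \<in> carrier_vec n"
  shows "qform A x = Re (\<Sum>i<n. \<Sum>j<n. A $$ (i, j) * x $ j * cnj (x $ i))"
  unfolding qform_def
  using assms by (simp add: cscalar_prod_sum[of x n] mult_mat_vec_index[OF assms] sum_distrib_right del: index_mult_mat_vec)

lemma qform_add:
  assumes "A \<in> carrier_mat n n" "B \<in> carrier_mat n n" "x \<in> carrier_vec n"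
  shows "qform (A + B) x = qform A x + qform B x"
proof -
  have C: "A + B \<in> carrier_mat n n" using assms by simp
  show ?thesis
    unfolding qform_sum[OF C assms(3)] qform_sum[OF assms(1,3)] qform_sum[OF assms(2,3)]
    using assms by (simp add: distrib_right sum.distrib)
qed

lemma qform_smult:
  assumes "A \<in> carrier_mat n n" "x \<in> carrier_vec n"
  shows "qform (complex_of_real c \<cdot>\<^sub>m A) x = c * qform A x"
proof -
  have C: "complex_of_real c \<cdot>\<^sub>m A \<in> carrier_mat n n" using assms by simp
  have "(\<Sum>i<n. \<Sum>j<n. (complex_of_real c \<cdot>\<^sub>m A) $$ (i, j) * x $ j * cnj (x $ i))
      = complex_of_real c * (\<Sum>i<n. \<Sum>j<n. A $$ (i, j) * x $ j * cnj (x $ i))"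
    using assms by (simp add: sum_distrib_left mult.assoc)
  then show ?thesis
    unfolding qform_sum[OF C assms(2)] qform_sum[OF assms] by simp
qed

lemma qform_minus:
  assumes "A \<in> carrier_mat n n" "B \<in> carrier_mat n n" "x \<in> carrier_vec n"
  shows "qform (A - B) x = qform A x - qform B x"
proof -
  have C: "A - B \<in> carrier_mat n n" by (rule minus_carrier_mat[OF assms(2)])
  show ?thesis
    unfolding qform_sum[OF C assms(3)] qform_sum[OF assms(1,3)] qform_sum[OF assms(2,3)]
    using assms by (simp add: left_diff_distrib sum_subtractf)
qed

lemma mat_mean_carrier [simp]:
  "A \<in> carrier_mat n n \<Longrightarrow> B \<in> carrier_mat n n \<Longrightarrow> mat_mean s A B \<in> carrier_mat n n"
  by (simp add: mat_mean_def)

lemma qform_mean: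
  assumes "A \<in> carrier_mat n n" "B \<in> carrier_mat n n" "x \<in> carrier_vec n"
  shows "qform (mat_mean s A B) x = (1 - s) * qform A x + s * qform B x"
  unfolding mat_mean_def using assms by (simp only: qform_add[of _ n] qform_smult[of _ n] smult_carrier_mat)

lemma hermitian_index:
  assumes "hermitian A" and A: "A \<in> carrier_mat n n" and ij: "i < n" "j < n"
  shows "cnj (A $$ (j, i)) = A $$ (i, j)"
proof -
  have "mat_adjoint A = A" using assms(1) by (simp add: hermitian_def)
  then have "A $$ (i, j) = mat_adjoint A $$ (i, j)" by (simp only:)
  also have "\<dots> = cnj (A $$ (j, i))" by (rule mat_adjoint_index) (use A ij in simp_all)
  finally show ?thesis by simp
qed

lemma hermitianI:
  assumes A: "A \<in> carrier_mat n n" and "\<And>i j. i < n \<Longrightarrow> j < n \<Longrightarrow> cnj (A $$ (j, i)) = A $$ (i, j)"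
  shows "hermitian A"
proof -
  have "mat_adjoint A = A"
  proof (rule eq_matI)
    fix i j assume "i < dim_row A" "j < dim_col A"
    then have ij: "i < n" "j < n" using A by simp_all
    have "mat_adjoint A $$ (i, j) = cnj (A $$ (j, i))" by (rule mat_adjoint_index) (use A ij in simp_all)
    then show "mat_adjoint A $$ (i, j) = A $$ (i, j)" using assms(2)[OF ij] by (simp only:)
  qed (use A in simp_all)
  then show ?thesis using A by (simp add: hermitian_def)
qed

lemma hermitian_minus:
  assumes A: "A \<in> carrier_mat n n" "hermitian A" and B: "B \<in> carrier_mat n n" "hermitian B"
  shows "hermitian (A - B)"
  by (rule hermitianI[of _ n])
     (use A B hermitian_index[OF A(2,1)] hermitian_index[OF B(2,1)] in \<open>simp_all add: minus_carrier_mat\<close>)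

lemma smult_mat_mult_vec:
  fixes A :: "complex mat"
  assumes A: "A \<in> carrier_mat n n" and v: "v \<in> carrier_vec n"
  shows "(a \<cdot>\<^sub>m A) *\<^sub>v v = a \<cdot>\<^sub>v (A *\<^sub>v v)"
proof (rule eq_vecI)
  have aA: "a \<cdot>\<^sub>m A \<in> carrier_mat n n" using A by simp
  show "dim_vec ((a \<cdot>\<^sub>m A) *\<^sub>v v) = dim_vec (a \<cdot>\<^sub>v (A *\<^sub>v v))" by simp
  fix i assume "i < dim_vec (a \<cdot>\<^sub>v (A *\<^sub>v v))"
  then have i: "i < n" using A by simp
  have "((a \<cdot>\<^sub>m A) *\<^sub>v v) $ i = (\<Sum>j<n. (a \<cdot>\<^sub>m A) $$ (i, j) * v $ j)"
    by (rule mult_mat_vec_index[OF aA v i])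
  also have "\<dots> = a * (\<Sum>j<n. A $$ (i, j) * v $ j)"
    unfolding sum_distrib_left by (intro sum.cong refl) (use A i in simp)
  also have "\<dots> = a * (A *\<^sub>v v) $ i" by (simp only: mult_mat_vec_index[OF A v i])
  also have "\<dots> = (a \<cdot>\<^sub>v (A *\<^sub>v v)) $ i" using A i by simp
  finally show "((a \<cdot>\<^sub>m A) *\<^sub>v v) $ i = (a \<cdot>\<^sub>v (A *\<^sub>v v)) $ i" .
qed

lemma loewner_le_iff_qform:
  assumes "A \<in> carrier_mat n n" "B \<in> carrier_mat n n"
  shows "A \<le>\<^sub>L B \<longleftrightarrow> hermitian A \<and> hermitian B \<and> (\<forall>x\<in>carrier_vec n. qform A x \<le> qform B x)"
proof -
  have "hermitian (B - A)" if "hermitian A" "hermitian B"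
    by (rule hermitian_minus[OF assms(2) that(2) assms(1) that(1)])
  moreover have "dim_row (B - A) = n" using assms by simp
  moreover have "Re (((B - A) *\<^sub>v x) \<bullet>c x) = qform B x - qform A x" if "x \<in> carrier_vec n" for x
    using qform_minus[OF assms(2,1) that] by (simp only: qform_def)
  ultimately show ?thesis
    using assms unfolding loewner_le_def pos_semidef_def by auto
qed

text \<open>\<open>herm_fun\<close> can be evaluated once a unitary diagonalization is at hand, so
  all three matrices come with one; concavity then compares weighted sums of values of
  \<open>f\<close>.\<close>

lemma matrix_concave_unitary_conj_diag:
  assumes concave: "matrix_concave f" and s: "0 \<le> s" "s \<le> 1"
    and U: "U \<in> carrier_mat n n" "unitary_mat U" and V: "V \<in> carrier_mat n n" "unitary_mat V"
    and W: "W \<in> carrier_mat n n" "unitary_mat W"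
    and d: "\<And>j. j < n \<Longrightarrow> 0 < d j" and e: "\<And>j. j < n \<Longrightarrow> 0 < e j"
    and mean: "mat_mean s (U * real_diag n d * mat_adjoint U) (V * real_diag n e * mat_adjoint V)
      = W * real_diag n g * mat_adjoint W"
    and x: "x \<in> carrier_vec n"
  shows "(1 - s) * (\<Sum>j<n. f (d j) * (cmod ((mat_adjoint U *\<^sub>v x) $ j))\<^sup>2)
      + s * (\<Sum>j<n. f (e j) * (cmod ((mat_adjoint V *\<^sub>v x) $ j))\<^sup>2)
    \<le> (\<Sum>j<n. f (g j) * (cmod ((mat_adjoint W *\<^sub>v x) $ j))\<^sup>2)"
proof -
  note c = unitary_conj_diag_carrier
  have "mat_mean s (herm_fun f (U * real_diag n d * mat_adjoint U)) (herm_fun f (V * real_diag n e * mat_adjoint V))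
      \<le>\<^sub>L herm_fun f (mat_mean s (U * real_diag n d * mat_adjoint U) (V * real_diag n e * mat_adjoint V))"
    by (rule concave[unfolded matrix_concave_def, rule_format, OF c[OF U] c[OF V] _
          unitary_conj_diag_pos_def[OF U d] unitary_conj_diag_pos_def[OF V e]]) (use s in simp_all)
  then have le: "mat_mean s (U * real_diag n (\<lambda>i. f (d i)) * mat_adjoint U) (V * real_diag n (\<lambda>i. f (e i)) * mat_adjoint V)
      \<le>\<^sub>L W * real_diag n (\<lambda>i. f (g i)) * mat_adjoint W"
    unfolding mean herm_fun_unitary_conj_diag[OF U] herm_fun_unitary_conj_diag[OF V] herm_fun_unitary_conj_diag[OF W] .
  have "qform (mat_mean s (U * real_diag n (\<lambda>i. f (d i)) * mat_adjoint U) (V * real_diag n (\<lambda>i. f (e i)) * mat_adjoint V)) x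
      \<le> qform (W * real_diag n (\<lambda>i. f (g i)) * mat_adjoint W) x"
    using le x loewner_le_iff_qform[OF mat_mean_carrier[OF c[OF U] c[OF V]] c[OF W]] by blast
  then show ?thesis
    unfolding qform_mean[OF c[OF U] c[OF V] x] qform_unitary_conj_diag[OF U x] qform_unitary_conj_diag[OF V x]
      qform_unitary_conj_diag[OF W x] .
qed

section \<open>Real orthogonal diagonalizations and real test vectors\<close>

definition real_mat :: "nat \<Rightarrow> (nat \<Rightarrow> nat \<Rightarrow> real) \<Rightarrow> complex mat" where
  "real_mat n U = Matrix.mat n n (\<lambda>(i, j). complex_of_real (U i j))"

lemma real_mat_carrier: "real_mat n U \<in> carrier_mat n n"
  by (simp add: real_mat_def)

lemma real_mat_unitary:
  assumes "\<And>j l. j < n \<Longrightarrow> l < n \<Longrightarrow> (\<Sum>i<n. U i j * U i l) = (if j = l then 1 else 0)"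
  shows "unitary_mat (real_mat n U)"
proof -
  note R = real_mat_carrier[of n U]
  have R': "mat_adjoint (real_mat n U) \<in> carrier_mat n n" using R by simp
  have 1: "mat_adjoint (real_mat n U) * real_mat n U = 1\<^sub>m n"
  proof (rule eq_matI)
    fix i j assume "i < dim_row (1\<^sub>m n :: complex mat)" "j < dim_col (1\<^sub>m n :: complex mat)"
    then have ij: "i < n" "j < n" by auto
    have "(mat_adjoint (real_mat n U) * real_mat n U) $$ (i, j) = (\<Sum>k<n. of_real (U k i * U k j))"
      unfolding mult_mat_index[OF R' R ij] by (intro sum.cong refl) (use ij in \<open>simp add: real_mat_def\<close>)
    also have "\<dots> = complex_of_real (if i = j then 1 else 0)"
      unfolding of_real_sum[symmetric] assms[OF ij] ..
    finally show "(mat_adjoint (real_mat n U) * real_mat n U) $$ (i, j) = 1\<^sub>m n $$ (i, j)"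
      using ij by simp
  qed (use R in simp_all)
  moreover have "real_mat n U * mat_adjoint (real_mat n U) = 1\<^sub>m n"
    by (rule mat_mult_left_right_inverse[OF R' R 1])
  ultimately show ?thesis using R by (simp add: unitary_mat_def)
qed

text \<open>Orthonormal columns say that the transpose is a left inverse; for a square matrix it is
  then a right inverse.\<close>

lemma orthogonal_rows:
  fixes U :: "nat \<Rightarrow> nat \<Rightarrow> real"
  assumes "\<And>j l. j < n \<Longrightarrow> l < n \<Longrightarrow> (\<Sum>i<n. U i j * U i l) = (if j = l then 1 else 0)"
    and ij: "i < n" "j < n"
  shows "(\<Sum>l<n. U i l * U j l) = (if i = j then 1 else 0)"
proof -
  note R = real_mat_carrier[of n U]
  have R': "mat_adjoint (real_mat n U) \<in> carrier_mat n n" using R by simp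
  have "(\<Sum>l<n. of_real (U i l * U j l)) = (real_mat n U * mat_adjoint (real_mat n U)) $$ (i, j)"
    unfolding mult_mat_index[OF R R' ij] by (intro sum.cong refl) (use ij in \<open>simp add: real_mat_def\<close>)
  also have "real_mat n U * mat_adjoint (real_mat n U) = 1\<^sub>m n"
    by (rule unitary_right[OF R real_mat_unitary]) (rule assms(1))
  also have "1\<^sub>m n $$ (i, j) = complex_of_real (if i = j then 1 else 0)" using ij by simp
  finally show ?thesis unfolding of_real_sum[symmetric] of_real_eq_iff .
qed

lemma real_mat_conj_diag_index:
  assumes ij: "i < n" "j < n"
  shows "(real_mat n U * real_diag n d * mat_adjoint (real_mat n U)) $$ (i, j) = of_real (\<Sum>l<n. U i l * d l * U j l)"
proof -
  note R = real_mat_carrier[of n U]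
  have R': "mat_adjoint (real_mat n U) \<in> carrier_mat n n" using R by simp
  have RD: "real_mat n U * real_diag n d \<in> carrier_mat n n" using R real_diag_carrier[of n d] by simp
  have "(real_mat n U * real_diag n d) $$ (i, l) = of_real (U i l * d l)" if "l < n" for l
    using ij that by (simp add: real_diag_def mat_diag_mult_right[OF R]) (simp add: real_mat_def)
  moreover have "mat_adjoint (real_mat n U) $$ (l, j) = of_real (U j l)" if "l < n" for l
    using ij that by (simp add: real_mat_def)
  ultimately show ?thesis
    unfolding mult_mat_index[OF RD R' ij] by simp
qed

lemma real_mat_adjoint_mult_vec:
  assumes "j < n"
  shows "(cmod ((mat_adjoint (real_mat n U) *\<^sub>v Matrix.vec n (\<lambda>i. complex_of_real (w i))) $ j))\<^sup>2
    = (\<Sum>i<n. U i j * w i)\<^sup>2"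
proof -
  have R': "mat_adjoint (real_mat n U) \<in> carrier_mat n n" using real_mat_carrier[of n U] by simp
  have "(mat_adjoint (real_mat n U) *\<^sub>v Matrix.vec n (\<lambda>i. complex_of_real (w i))) $ j
      = (\<Sum>i<n. of_real (U i j * w i))"
    by (subst mult_mat_vec_index[OF R' _ assms]) (use assms in \<open>auto simp: real_mat_def intro!: sum.cong\<close>)
  then show ?thesis unfolding of_real_sum[symmetric] by (simp add: norm_of_real del: of_real_sum)
qed

lemma matrix_concave_real_orthogonal:
  fixes U V W :: "nat \<Rightarrow> nat \<Rightarrow> real"
  assumes concave: "matrix_concave f" and s: "0 \<le> s" "s \<le> 1"
    and U: "\<And>j l. j < n \<Longrightarrow> l < n \<Longrightarrow> (\<Sum>i<n. U i j * U i l) = (if j = l then 1 else 0)"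
    and V: "\<And>j l. j < n \<Longrightarrow> l < n \<Longrightarrow> (\<Sum>i<n. V i j * V i l) = (if j = l then 1 else 0)"
    and W: "\<And>j l. j < n \<Longrightarrow> l < n \<Longrightarrow> (\<Sum>i<n. W i j * W i l) = (if j = l then 1 else 0)"
    and d: "\<And>j. j < n \<Longrightarrow> 0 < d j" and e: "\<And>j. j < n \<Longrightarrow> 0 < e j"
    and mean: "\<And>i j. i < n \<Longrightarrow> j < n \<Longrightarrow>
      (1 - s) * (\<Sum>l<n. U i l * d l * U j l) + s * (\<Sum>l<n. V i l * e l * V j l) = (\<Sum>l<n. W i l * g l * W j l)"
  shows "(1 - s) * (\<Sum>j<n. f (d j) * (\<Sum>i<n. U i j * w i)\<^sup>2) + s * (\<Sum>j<n. f (e j) * (\<Sum>i<n. V i j * w i)\<^sup>2)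
    \<le> (\<Sum>j<n. f (g j) * (\<Sum>i<n. W i j * w i)\<^sup>2)"
proof -
  let ?x = "Matrix.vec n (\<lambda>i. complex_of_real (w i))"
  note c = unitary_conj_diag_carrier[OF real_mat_carrier real_mat_unitary]
  have "mat_mean s (real_mat n U * real_diag n d * mat_adjoint (real_mat n U))
      (real_mat n V * real_diag n e * mat_adjoint (real_mat n V))
      = real_mat n W * real_diag n g * mat_adjoint (real_mat n W)" (is "mat_mean s ?A ?B = ?C")
  proof (rule eq_matI)
    have A: "?A \<in> carrier_mat n n" and B: "?B \<in> carrier_mat n n" and C: "?C \<in> carrier_mat n n"
      using c U V W by blast+
    then show "dim_row (mat_mean s ?A ?B) = dim_row ?C" "dim_col (mat_mean s ?A ?B) = dim_col ?C"
      using mat_mean_carrier[OF A B, of s] by (simp_all only: carrier_matD)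
    fix i j assume "i < dim_row ?C" "j < dim_col ?C"
    then have ij: "i < n" "j < n" using C by (simp_all only: carrier_matD)
    have "mat_mean s ?A ?B $$ (i, j) = of_real (1 - s) * ?A $$ (i, j) + of_real s * ?B $$ (i, j)"
      unfolding mat_mean_def using A B ij by (simp del: of_real_diff index_mult_mat)
    also have "\<dots> = ?C $$ (i, j)"
      unfolding real_mat_conj_diag_index[OF ij] of_real_mult[symmetric] of_real_add[symmetric] mean[OF ij] ..
    finally show "mat_mean s ?A ?B $$ (i, j) = ?C $$ (i, j)" .
  qed
  from matrix_concave_unitary_conj_diag[OF concave s real_mat_carrier real_mat_unitary[OF U]
      real_mat_carrier real_mat_unitary[OF V] real_mat_carrier real_mat_unitary[OF W] d e this, of ?x]
  show ?thesis by (simp add: real_mat_adjoint_mult_vec del: index_mult_mat_vec)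
qed

section \<open>Scalar concavity, continuity and growth\<close>

lemma matrix_concave_imp_concave_on:
  assumes "matrix_concave f"
  shows "concave_on {0<..} f"
  unfolding concave_on_iff
proof (intro conjI ballI allI impI convex_real_interval)
  fix x y u v :: real assume xy: "x \<in> {0<..}" "y \<in> {0<..}" and uv: "0 \<le> u" "0 \<le> v" "u + v = 1"
  then have u: "u = 1 - v" and v: "v \<le> 1" by simp_all
  show "u * f x + v * f y \<le> f (u *\<^sub>R x + v *\<^sub>R y)"
    using matrix_concave_real_orthogonal[OF assms uv(2) v, where n = 1 and U = "\<lambda>_ _. 1" and V = "\<lambda>_ _. 1"
        and W = "\<lambda>_ _. 1" and d = "\<lambda>_. x" and e = "\<lambda>_. y" and g = "\<lambda>_. (1 - v) * x + v * y" and w = "\<lambda>_. 1"]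
      xy unfolding u by simp
qed

lemma concave_on_continuous:
  fixes f :: "real \<Rightarrow> real"
  assumes "concave_on {0<..} f"
  shows "continuous_on {0<..} f"
proof -
  have "continuous_on {0<..} (\<lambda>x. - f x)"
    by (rule convex_on_continuous) (use assms in \<open>auto simp: concave_on_def\<close>)
  then have "continuous_on {0<..} (\<lambda>x. - (- f x))" by (rule continuous_on_minus)
  then show ?thesis by (simp only: minus_minus)
qed

text \<open>The point \<open>1\<close> lies between \<open>1 / 2\<close> and \<open>x\<close>, with
  \<open>u\<close> as the weight of \<open>x\<close>. Concavity bounds the chord by
  \<open>f 1\<close>, and the term with \<open>f (1 / 2)\<close> is dropped by positivity.\<close>

lemma concave_linear_growth:
  fixes f :: "real \<Rightarrow> real"
  assumes conc: "concave_on {0<..} f" and pos: "\<And>x. 0 < x \<Longrightarrow> 0 < f x" and x: "1 \<le> x"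
  shows "f x \<le> 2 * f 1 * x"
proof -
  define u where "u = 1 / (2 * x - 1)"
  have u: "0 \<le> u" "u \<le> 1" and ux: "u * (2 * x - 1) = 1" using x by (simp_all add: u_def)
  have "u * x + (1 - u) * (1 / 2) = 1" using ux by (simp add: field_simps)
  moreover have "u * f x + (1 - u) * f (1 / 2) \<le> f (u *\<^sub>R x + (1 - u) *\<^sub>R (1 / 2))"
    using conc[unfolded concave_on_iff, THEN conjunct2, rule_format, of x "1 / 2" u "1 - u"] u x by simp
  ultimately have "u * f x + (1 - u) * f (1 / 2) \<le> f 1" by simp
  moreover have "0 \<le> (1 - u) * f (1 / 2)" using pos[of "1 / 2"] u by simp
  ultimately have "u * f x \<le> f 1" by linarith
  then have "f x \<le> f 1 * (2 * x - 1)" using x by (simp add: u_def field_simps)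
  also have "\<dots> \<le> 2 * f 1 * x" using pos[of 1] by (simp add: algebra_simps)
  finally show ?thesis .
qed

text \<open>The reflection that exchanges \<open>v\<close> with the multiple of the first unit
  vector of the same length. Its first column is parallel to \<open>v\<close>, so it diagonalizes
  \<open>v v\<^sup>T\<close> by a real orthogonal matrix.\<close>

lemma householder_reflection:
  fixes v :: "nat \<Rightarrow> real"
  assumes "0 < n"
  obtains R where "\<And>j l. j < n \<Longrightarrow> l < n \<Longrightarrow> (\<Sum>i<n. R i j * R i l) = (if j = l then 1 else 0)"
    and "\<And>i. i < n \<Longrightarrow> sqrt (\<Sum>l<n. (v l)\<^sup>2) * R i 0 = v i"
proof -
  define c where "c = sqrt (\<Sum>l<n. (v l)\<^sup>2)"
  define u where "u i = v i - (if i = 0 then c else 0)" for i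
  define N where "N = (\<Sum>l<n. (u l)\<^sup>2)"
  \<comment> \<open>If \<open>v\<close> already is that multiple, then \<open>N = 0\<close> and
    division by zero yields the identity matrix, which is the right choice.\<close>
  define R where "R i j = (if i = j then 1 else 0) - 2 * u i * u j / N" for i j
  have c2: "c\<^sup>2 = (\<Sum>l<n. (v l)\<^sup>2)" by (simp add: c_def sum_nonneg)
  have "(\<Sum>i<n. R i j * R i l) = (if j = l then 1 else 0)" if jl: "j < n" "l < n" for j l
  proof -
    have "(\<Sum>i<n. R i j * R i l) = (\<Sum>i<n. (if i = j then (if j = l then 1 else 0) - 2 * u j * u l / N else 0)
        + (if i = l then - 2 * u j * u l / N else 0) + 4 * u j * u l / N\<^sup>2 * (u i)\<^sup>2)"
      by (intro sum.cong refl) (auto simp: R_def power2_eq_square algebra_simps)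
    also have "\<dots> = (\<Sum>i<n. if i = j then (if j = l then 1 else 0) - 2 * u j * u l / N else 0)
        + (\<Sum>i<n. if i = l then - 2 * u j * u l / N else 0) + 4 * u j * u l / N\<^sup>2 * N"
      by (simp only: sum.distrib sum_distrib_left[symmetric] N_def[symmetric])
    also have "\<dots> = (if j = l then 1 else 0) - 2 * u j * u l / N - 2 * u j * u l / N + 4 * u j * u l / N\<^sup>2 * N"
      using jl by simp
    also have "\<dots> = (if j = l then 1 else 0)" by (cases "N = 0") (auto simp: power2_eq_square)
    finally show ?thesis .
  qed
  moreover have "c * R i 0 = v i" if i: "i < n" for i
  proof (cases "N = 0")
    case True
    then have "u i = 0" using i by (simp add: N_def sum_nonneg_eq_0_iff)
    then show ?thesis using True by (auto simp: R_def u_def)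
  next
    case False
    have "N = (\<Sum>l<n. (v l)\<^sup>2 + (if l = 0 then c\<^sup>2 - 2 * c * v 0 else 0))"
      unfolding N_def by (intro sum.cong refl) (auto simp: u_def power2_eq_square algebra_simps)
    also have "\<dots> = c\<^sup>2 + (c\<^sup>2 - 2 * c * v 0)" using assms by (simp add: sum.distrib c2)
    also have "\<dots> = - 2 * c * u 0" by (simp add: u_def power2_eq_square algebra_simps)
    finally have N: "2 * c * u 0 = - N" by simp
    have "c * R i 0 = (if i = 0 then c else 0) - u i * (2 * c * u 0) / N"
      by (simp add: R_def algebra_simps)
    also have "\<dots> = v i" unfolding N using False by (simp add: u_def)
    finally show ?thesis .
  qed
  ultimately show ?thesis using that[of R] by (simp add: c_def)
qed

text \<open>A positive matrix concave function is matrix monotone: for \<open>Y = X + v v\<^sup>T\<close> and small \<open>\<delta> > 0\<close>,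
  \<open>(1 - \<delta>) (Y + \<delta>)\<close> is the mean of \<open>X\<close> and a positive definite matrix, whose
  contribution under \<open>f\<close> is dropped.\<close>

theorem matrix_concave_imp_rank_one_monotone:
  assumes concave: "matrix_concave f" and f_pos: "\<And>x. 0 < x \<Longrightarrow> 0 < f x"
  shows "rank_one_monotone f"
  unfolding rank_one_monotone_def
proof (intro allI impI)
  fix k and x y :: "nat \<Rightarrow> real" and U :: "nat \<Rightarrow> nat \<Rightarrow> real" and v w :: "nat \<Rightarrow> real"
  assume x: "\<forall>i<k. 0 < x i" and y: "\<forall>i<k. 0 < y i"
    and U: "\<forall>j<k. \<forall>l<k. (\<Sum>i<k. U i j * U i l) = (if j = l then 1 else 0)"
    and eig: "\<forall>i<k. \<forall>j<k. x i * U i j + v i * (\<Sum>l<k. v l * U l j) = y j * U i j"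
  show "(\<Sum>i<k. f (x i) * (w i)\<^sup>2) \<le> (\<Sum>j<k. f (y j) * (\<Sum>i<k. U i j * w i)\<^sup>2)"
  proof (cases "k = 0")
    case False
    then obtain R where R: "\<And>j l. j < k \<Longrightarrow> l < k \<Longrightarrow> (\<Sum>i<k. R i j * R i l) = (if j = l then 1 else 0)"
      and Rv: "\<And>i. i < k \<Longrightarrow> sqrt (\<Sum>l<k. (v l)\<^sup>2) * R i 0 = v i"
      using householder_reflection[of k v] by auto
    define c where "c = (\<Sum>l<k. (v l)\<^sup>2)"
    have c0: "0 \<le> c" by (simp add: c_def sum_nonneg)
    have U_rows: "(\<Sum>l<k. U i l * U j l) = (if i = j then 1 else 0)" if "i < k" "j < k" for i j
      by (rule orthogonal_rows) (use U that in auto)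
    \<comment> \<open>Row orthogonality turns the eigenvalue equation into
      \<open>U diag y U\<^sup>T = X + v v\<^sup>T\<close>, read entrywise.\<close>
    have UyU: "(\<Sum>l<k. U i l * y l * U j l) = (if i = j then x i else 0) + v i * v j" if ij: "i < k" "j < k" for i j
    proof -
      have "(\<Sum>l<k. U i l * y l * U j l) = (\<Sum>l<k. (x i * U i l + v i * (\<Sum>m<k. v m * U m l)) * U j l)"
        using eig ij by (intro sum.cong refl) (simp add: mult.commute)
      also have "\<dots> = x i * (\<Sum>l<k. U i l * U j l) + v i * (\<Sum>l<k. \<Sum>m<k. v m * (U m l * U j l))"
        by (simp add: distrib_right sum.distrib sum_distrib_left sum_distrib_right mult.assoc)
      also have "(\<Sum>l<k. \<Sum>m<k. v m * (U m l * U j l)) = (\<Sum>m<k. v m * (\<Sum>l<k. U m l * U j l))"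
        unfolding sum_distrib_left by (rule sum.swap)
      also have "\<dots> = v j" using ij by (simp add: U_rows if_distrib[of "\<lambda>u. _ * u"] cong: if_cong)
      finally show ?thesis using ij by (simp add: U_rows)
    qed
    have key: "(1 - \<delta>) * (\<Sum>i<k. f (x i) * (w i)\<^sup>2) \<le> (\<Sum>j<k. f ((1 - \<delta>) * (y j + \<delta>)) * (\<Sum>i<k. U i j * w i)\<^sup>2)"
      if \<delta>: "0 < \<delta>" "\<delta> < 1" for \<delta>
    proof -
      \<comment> \<open>The second matrix of the mean is
        \<open>\<rho> (\<delta> + v v\<^sup>T)\<close>, diagonalized by \<open>R\<close> with
        eigenvalues \<open>e\<close>. As \<open>\<delta> * \<rho> = 1 - \<delta>\<close>, it
        contributes \<open>(1 - \<delta>) (\<delta> + v v\<^sup>T)\<close>; the summand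
        \<open>\<delta>\<close> makes it positive definite.\<close>
      define \<rho> where "\<rho> = (1 - \<delta>) / \<delta>"
      have \<rho>: "0 < \<rho>" "\<delta> * \<rho> = 1 - \<delta>" using \<delta> by (auto simp: \<rho>_def)
      define e where "e l = \<rho> * (\<delta> + (if l = 0 then c else 0))" for l :: nat
      have e: "0 < e l" for l using \<rho> \<delta> c0 by (auto simp: e_def intro!: mult_pos_pos add_pos_nonneg)
      define I where "I i j = (if i = j then 1 else 0 :: real)" for i j :: nat
      have Iw: "(\<Sum>i<k. I i j * w i) = w j" if "j < k" for j
      proof -
        have "(\<Sum>i<k. I i j * w i) = (\<Sum>i<k. if i = j then w j else 0)"
          by (intro sum.cong refl) (auto simp: I_def)
        then show ?thesis using that by simp
      qed
      have II: "(\<Sum>i<k. I i j * I i l) = (if j = l then 1 else 0)" if "j < k" "l < k" for j l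
      proof -
        have "(\<Sum>i<k. I i j * I i l) = (\<Sum>i<k. if i = j then (if j = l then 1 else 0) else 0)"
          by (intro sum.cong refl) (auto simp: I_def)
        then show ?thesis using that by simp
      qed
      have mean: "(1 - \<delta>) * (\<Sum>l<k. I i l * x l * I j l) + \<delta> * (\<Sum>l<k. R i l * e l * R j l)
          = (\<Sum>l<k. U i l * ((1 - \<delta>) * (y l + \<delta>)) * U j l)" if ij: "i < k" "j < k" for i j
      proof -
        have "v i * v j = (sqrt c * R i 0) * (sqrt c * R j 0)"
          by (simp only: c_def Rv[OF ij(1)] Rv[OF ij(2)])
        also have "\<dots> = (sqrt c * sqrt c) * (R i 0 * R j 0)" by (simp only: mult_ac)
        also have "\<dots> = R i 0 * c * R j 0" using c0 by simp
        finally have vv: "R i 0 * c * R j 0 = v i * v j" by simp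
        have RR: "(\<Sum>l<k. R i l * R j l) = (if i = j then 1 else 0)"
          by (rule orthogonal_rows[OF R ij])
        have "(\<Sum>l<k. R i l * e l * R j l) = (\<Sum>l<k. \<rho> * \<delta> * (R i l * R j l) + (if l = 0 then \<rho> * (R i 0 * c * R j 0) else 0))"
          by (intro sum.cong refl) (simp add: e_def algebra_simps)
        also have "\<dots> = \<rho> * \<delta> * (\<Sum>l<k. R i l * R j l) + (\<Sum>l<k. if l = 0 then \<rho> * (R i 0 * c * R j 0) else 0)"
          by (simp only: sum.distrib sum_distrib_left[symmetric])
        also have "\<dots> = \<rho> * \<delta> * (if i = j then 1 else 0) + \<rho> * (v i * v j)"
          unfolding RR vv using False by simp
        finally have "\<delta> * (\<Sum>l<k. R i l * e l * R j l)
            = (\<delta> * \<rho>) * \<delta> * (if i = j then 1 else 0) + (\<delta> * \<rho>) * (v i * v j)"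
          by (simp only: distrib_left mult_ac)
        then have ReR: "\<delta> * (\<Sum>l<k. R i l * e l * R j l)
            = (1 - \<delta>) * \<delta> * (if i = j then 1 else 0) + (1 - \<delta>) * (v i * v j)"
          by (simp only: \<rho>(2))
        have "(\<Sum>l<k. I i l * x l * I j l) = (\<Sum>l<k. if l = i then (if i = j then x i else 0) else 0)"
          by (intro sum.cong refl) (auto simp: I_def)
        also have "\<dots> = (if i = j then x i else 0)" using ij by simp
        finally have IxI: "(\<Sum>l<k. I i l * x l * I j l) = (if i = j then x i else 0)" .
        have "(\<Sum>l<k. U i l * ((1 - \<delta>) * (y l + \<delta>)) * U j l)
            = (\<Sum>l<k. (1 - \<delta>) * (U i l * y l * U j l) + (1 - \<delta>) * \<delta> * (U i l * U j l))"
          by (intro sum.cong refl) (simp add: algebra_simps)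
        also have "\<dots> = (1 - \<delta>) * (\<Sum>l<k. U i l * y l * U j l) + (1 - \<delta>) * \<delta> * (\<Sum>l<k. U i l * U j l)"
          by (simp only: sum.distrib sum_distrib_left[symmetric])
        finally show ?thesis unfolding ReR IxI UyU[OF ij] U_rows[OF ij] by (simp add: algebra_simps)
      qed
      have conc: "(1 - \<delta>) * (\<Sum>j<k. f (x j) * (\<Sum>i<k. I i j * w i)\<^sup>2) + \<delta> * (\<Sum>j<k. f (e j) * (\<Sum>i<k. R i j * w i)\<^sup>2)
          \<le> (\<Sum>j<k. f ((1 - \<delta>) * (y j + \<delta>)) * (\<Sum>i<k. U i j * w i)\<^sup>2)"
      proof (rule matrix_concave_real_orthogonal[OF concave])
        show "0 \<le> \<delta>" "\<delta> \<le> 1" using \<delta> by simp_all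
        show "0 < x j" if "j < k" for j using x that by blast
        show "(\<Sum>i<k. U i j * U i l) = (if j = l then 1 else 0)" if "j < k" "l < k" for j l
          using U that by blast
      qed (assumption | rule II R e mean)+
      moreover have "0 \<le> \<delta> * (\<Sum>j<k. f (e j) * (\<Sum>i<k. R i j * w i)\<^sup>2)"
        using \<delta> e f_pos by (intro mult_nonneg_nonneg sum_nonneg) (auto simp: less_imp_le)
      moreover have IwI: "(\<Sum>j<k. f (x j) * (\<Sum>i<k. I i j * w i)\<^sup>2) = (\<Sum>j<k. f (x j) * (w j)\<^sup>2)"
        by (intro sum.cong refl) (simp add: Iw)
      ultimately show ?thesis using conc unfolding IwI by linarith
    qed
    \<comment> \<open>Scalar concavity supplies the continuity that lets \<open>\<delta>\<close>
      tend to \<open>0\<close>.\<close>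
    have cont: "isCont f (y j)" if "j < k" for j
      using concave_on_continuous[OF matrix_concave_imp_concave_on[OF concave]] y that
      by (simp add: continuous_on_eq_continuous_at)
    have "((\<lambda>\<delta>. f ((1 - \<delta>) * (y j + \<delta>))) \<longlongrightarrow> f (y j)) (at_right 0)" if "j < k" for j
    proof (rule isCont_tendsto_compose[OF cont[OF that]])
      have "((\<lambda>\<delta>. (1 - \<delta>) * (y j + \<delta>)) \<longlongrightarrow> (1 - 0) * (y j + 0)) (at_right 0)"
        by (intro tendsto_intros)
      then show "((\<lambda>\<delta>. (1 - \<delta>) * (y j + \<delta>)) \<longlongrightarrow> y j) (at_right 0)" by simp
    qed
    then have R: "((\<lambda>\<delta>. \<Sum>j<k. f ((1 - \<delta>) * (y j + \<delta>)) * (\<Sum>i<k. U i j * w i)\<^sup>2) \<longlongrightarrow>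
        (\<Sum>j<k. f (y j) * (\<Sum>i<k. U i j * w i)\<^sup>2)) (at_right 0)"
      by (intro tendsto_sum tendsto_mult tendsto_const) auto
    have L: "((\<lambda>\<delta>. (1 - \<delta>) * (\<Sum>i<k. f (x i) * (w i)\<^sup>2)) \<longlongrightarrow> (1 - 0) * (\<Sum>i<k. f (x i) * (w i)\<^sup>2)) (at_right 0)"
      by (intro tendsto_intros)
    have "eventually (\<lambda>\<delta>. (1 - \<delta>) * (\<Sum>i<k. f (x i) * (w i)\<^sup>2) \<le>
        (\<Sum>j<k. f ((1 - \<delta>) * (y j + \<delta>)) * (\<Sum>i<k. U i j * w i)\<^sup>2)) (at_right 0)"
      unfolding eventually_at_right_field by (rule exI[of _ 1]) (use key in auto)
    from tendsto_le[OF _ R L this] show ?thesis by simp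
  qed simp
qed

section \<open>Resolvents\<close>

text \<open>\<open>mat_inverse\<close> returns an option; injectivity excludes a zero determinant
  and thereby \<open>None\<close>.\<close>

lemma square_mat_inverse_exists:
  assumes A: "(A :: complex mat) \<in> carrier_mat n n"
    and inj: "\<And>v. v \<in> carrier_vec n \<Longrightarrow> A *\<^sub>v v = 0\<^sub>v n \<Longrightarrow> v = 0\<^sub>v n"
  shows "the (mat_inverse A) \<in> carrier_mat n n" "A * the (mat_inverse A) = 1\<^sub>m n" "the (mat_inverse A) * A = 1\<^sub>m n"
proof -
  have "det A \<noteq> 0" using det_0_iff_vec_prod_zero[OF A] inj by blast
  then have "A \<in> Units (ring_mat TYPE(complex) n ())" by (rule det_non_zero_imp_unit[OF A])
  then obtain B where "mat_inverse A = Some B" using mat_inverse(1)[OF A, of "()"] by (cases "mat_inverse A") auto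
  then show "the (mat_inverse A) \<in> carrier_mat n n" "A * the (mat_inverse A) = 1\<^sub>m n" "the (mat_inverse A) * A = 1\<^sub>m n"
    using mat_inverse(2)[OF A] by simp_all
qed

lemma det_holomorphic:
  assumes M: "\<And>z. M z \<in> carrier_mat n n"
    and hol: "\<And>i j. i < n \<Longrightarrow> j < n \<Longrightarrow> (\<lambda>z. M z $$ (i, j)) holomorphic_on S"
  shows "(\<lambda>z. det (M z :: complex mat)) holomorphic_on S"
  unfolding det_def'[OF M]
proof (intro holomorphic_intros hol)
  fix p i assume "p \<in> {p. p permutes {0..<n}}" and i: "i \<in> {0..<n}"
  then have p: "p permutes {0..<n}" by simp
  show "i < n" using i by simp
  have "p i \<in> {0..<n}" using permutes_in_image[OF p] i by simp
  then show "p i < n" by simp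
qed

context
  fixes X :: "complex mat" and n :: nat
  assumes X: "X \<in> carrier_mat n n"
begin

lemma resolvent_arg_carrier: "z \<cdot>\<^sub>m 1\<^sub>m n - X \<in> carrier_mat n n"
  by (rule minus_carrier_mat[OF X])

lemma resolvent_arg_mult_vec:
  assumes "v \<in> carrier_vec n"
  shows "(z \<cdot>\<^sub>m 1\<^sub>m n - X) *\<^sub>v v = z \<cdot>\<^sub>v v - X *\<^sub>v v"
proof -
  have "(z \<cdot>\<^sub>m 1\<^sub>m n - X) *\<^sub>v v = (z \<cdot>\<^sub>m 1\<^sub>m n) *\<^sub>v v - X *\<^sub>v v"
    by (rule minus_mult_distrib_mat_vec[of _ n n]) (use X assms in simp_all)
  moreover have "(z \<cdot>\<^sub>m 1\<^sub>m n) *\<^sub>v v = z \<cdot>\<^sub>v v"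
    using assms by (simp only: smult_mat_mult_vec[OF one_carrier_mat assms] one_mult_mat_vec)
  ultimately show ?thesis by simp
qed

lemma resolvent_arg_inj:
  assumes z: "z \<notin> spectrum X" and v: "v \<in> carrier_vec n" and eq: "(z \<cdot>\<^sub>m 1\<^sub>m n - X) *\<^sub>v v = 0\<^sub>v n"
  shows "v = 0\<^sub>v n"
proof (rule ccontr)
  assume v0: "v \<noteq> 0\<^sub>v n"
  have Xv: "X *\<^sub>v v \<in> carrier_vec n" using X v by simp
  have "X *\<^sub>v v = z \<cdot>\<^sub>v v"
  proof (rule eq_vecI)
    fix i assume "i < dim_vec (z \<cdot>\<^sub>v v)"
    then have i: "i < n" using v by simp
    define u where "u = X *\<^sub>v v"
    have u: "u \<in> carrier_vec n" using Xv by (simp only: u_def)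
    have "(z \<cdot>\<^sub>v v - u) $ i = 0" using eq i unfolding resolvent_arg_mult_vec[OF v] u_def by simp
    then have "u $ i = (z \<cdot>\<^sub>v v) $ i" using i v u by simp
    then show "(X *\<^sub>v v) $ i = (z \<cdot>\<^sub>v v) $ i" by (simp only: u_def)
  qed (use v X in simp)
  then have "eigenvalue X z" using v v0 X by (auto simp: eigenvalue_def eigenvector_def)
  then show False using z by (simp add: spectrum_def)
qed

lemma resolvent_inverse:
  assumes "z \<notin> spectrum X"
  shows "resolvent X z \<in> carrier_mat n n" "(z \<cdot>\<^sub>m 1\<^sub>m n - X) * resolvent X z = 1\<^sub>m n"
  using square_mat_inverse_exists[OF resolvent_arg_carrier resolvent_arg_inj[OF assms]] X
  by (simp_all add: resolvent_def)

text \<open>Cramer's rule presents the entries of the resolvent as quotients of polynomials in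
  \<open>z\<close>, from which holomorphy off the spectrum is read off.\<close>

lemma resolvent_eq_adj:
  assumes z: "z \<notin> spectrum X" and ij: "i < n" "j < n"
  shows "resolvent X z $$ (i, j) = adj_mat (z \<cdot>\<^sub>m 1\<^sub>m n - X) $$ (i, j) / det (z \<cdot>\<^sub>m 1\<^sub>m n - X)"
    and "det (z \<cdot>\<^sub>m 1\<^sub>m n - X) \<noteq> 0"
proof -
  let ?M = "z \<cdot>\<^sub>m 1\<^sub>m n - X"
  note M = resolvent_arg_carrier[of z] and R = resolvent_inverse[OF z]
  note adj = adj_mat[OF M]
  show d: "det ?M \<noteq> 0" using det_0_iff_vec_prod_zero[OF M] resolvent_arg_inj[OF z] by blast
  have "adj_mat ?M = adj_mat ?M * (?M * resolvent X z)"
    unfolding R(2) using adj(1) by simp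
  also have "\<dots> = (adj_mat ?M * ?M) * resolvent X z"
    by (rule assoc_mult_mat[symmetric, of _ n n _ n _ n]) (use adj M R in simp_all)
  also have "\<dots> = det ?M \<cdot>\<^sub>m resolvent X z"
    unfolding adj(3) using R(1) by (simp add: mult_smult_assoc_mat[of _ n n])
  finally have "adj_mat ?M $$ (i, j) = det ?M * resolvent X z $$ (i, j)"
    using R(1) ij by simp
  then show "resolvent X z $$ (i, j) = adj_mat ?M $$ (i, j) / det ?M" using d by simp
qed

lemma resolvent_arg_index_holomorphic:
  assumes "i < n" "j < n"
  shows "(\<lambda>z. (z \<cdot>\<^sub>m 1\<^sub>m n - X) $$ (i, j)) holomorphic_on S"
  using assms X by (simp add: holomorphic_intros)

lemma resolvent_holomorphic:
  assumes ij: "i < n" "j < n"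
  shows "(\<lambda>z. resolvent X z $$ (i, j)) holomorphic_on - spectrum X"
proof -
  have "(\<lambda>z. adj_mat (z \<cdot>\<^sub>m 1\<^sub>m n - X) $$ (i, j) / det (z \<cdot>\<^sub>m 1\<^sub>m n - X)) holomorphic_on - spectrum X"
  proof (rule holomorphic_on_divide)
    show "(\<lambda>z. det (z \<cdot>\<^sub>m 1\<^sub>m n - X)) holomorphic_on - spectrum X"
      by (rule det_holomorphic[OF resolvent_arg_carrier resolvent_arg_index_holomorphic])
    have "(\<lambda>z. det (mat_delete (z \<cdot>\<^sub>m 1\<^sub>m n - X) j i)) holomorphic_on - spectrum X"
    proof (rule det_holomorphic)
      show "mat_delete (z \<cdot>\<^sub>m 1\<^sub>m n - X) j i \<in> carrier_mat (n - 1) (n - 1)" for z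
        by (rule mat_delete_carrier) (rule resolvent_arg_carrier)
      fix k l assume "k < n - 1" "l < n - 1"
      then show "(\<lambda>z. mat_delete (z \<cdot>\<^sub>m 1\<^sub>m n - X) j i $$ (k, l)) holomorphic_on - spectrum X"
        using X ij by (auto simp: mat_delete_def intro!: holomorphic_intros)
    qed
    then have "(\<lambda>z. (- 1) ^ (j + i) * det (mat_delete (z \<cdot>\<^sub>m 1\<^sub>m n - X) j i)) holomorphic_on - spectrum X"
      by (intro holomorphic_intros)
    then show "(\<lambda>z. adj_mat (z \<cdot>\<^sub>m 1\<^sub>m n - X) $$ (i, j)) holomorphic_on - spectrum X"
      using ij X by (simp add: adj_mat_def cofactor_def)
  qed (use resolvent_eq_adj(2)[OF _ ij] in auto)
  then show ?thesis
    by (rule holomorphic_transform) (use resolvent_eq_adj(1)[OF _ ij] in auto)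
qed

lemma finite_spectrum: "finite (spectrum X)"
  by (rule card_finite_spectrum(1)[OF X])

lemma resolvent_continuous:
  assumes "i < n" "j < n" "S \<inter> spectrum X = {}"
  shows "continuous_on S (\<lambda>z. resolvent X z $$ (i, j))"
  by (rule continuous_on_subset[OF holomorphic_on_imp_continuous_on[OF resolvent_holomorphic[OF assms(1,2)]]])
     (use assms(3) in auto)

lemma resolvent_recursion:
  assumes z: "z \<notin> spectrum X" and ij: "i < n" "j < n"
  shows "z * resolvent X z $$ (i, j) = (if i = j then 1 else 0) + (\<Sum>k<n. X $$ (i, k) * resolvent X z $$ (k, j))"
proof -
  note R = resolvent_inverse[OF z]
  have "(\<Sum>k<n. (z \<cdot>\<^sub>m 1\<^sub>m n - X) $$ (i, k) * resolvent X z $$ (k, j)) = (if i = j then 1 else 0)"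
    using arg_cong[OF R(2), of "\<lambda>C. C $$ (i, j)"] ij unfolding mult_mat_index[OF resolvent_arg_carrier R(1) ij] by simp
  moreover have "(\<Sum>k<n. (z \<cdot>\<^sub>m 1\<^sub>m n - X) $$ (i, k) * resolvent X z $$ (k, j))
      = (\<Sum>k<n. (if k = i then z * resolvent X z $$ (i, j) else 0) - X $$ (i, k) * resolvent X z $$ (k, j))"
    by (intro sum.cong refl) (use X ij in \<open>auto simp: left_diff_distrib\<close>)
  moreover have "\<dots> = z * resolvent X z $$ (i, j) - (\<Sum>k<n. X $$ (i, k) * resolvent X z $$ (k, j))"
    using ij by (simp add: sum_subtractf)
  ultimately show ?thesis by (simp add: algebra_simps)
qed

text \<open>By \<open>z R = 1 + X R\<close>, the largest modulus \<open>m\<close> in a column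
  satisfies \<open>norm z * m \<le> 1 + K * m\<close>, so \<open>norm z * m \<le> 2\<close> once
  \<open>norm z\<close> is at least \<open>2 * K + 1\<close>. The same identity then bounds the
  deviation from \<open>1 / z\<close>. One constant serves as threshold and as bound.\<close>

lemma resolvent_decay:
  obtains C where "0 < C" and "\<And>z i j. i < n \<Longrightarrow> j < n \<Longrightarrow> C \<le> norm z \<Longrightarrow> z \<notin> spectrum X \<Longrightarrow>
    norm (resolvent X z $$ (i, j) - (if i = j then 1 else 0) / z) \<le> C / (norm z)\<^sup>2"
proof (cases "n = 0")
  case True
  then show ?thesis using that[of 1] by auto
next
  case False
  define K where "K = (\<Sum>i<n. \<Sum>k<n. norm (X $$ (i, k)))"
  have K0: "0 \<le> K" by (simp add: K_def sum_nonneg)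
  have rowK: "(\<Sum>k<n. norm (X $$ (i, k))) \<le> K" if "i < n" for i
    unfolding K_def using that by (intro member_le_sum[of i "{..<n}" "\<lambda>i. \<Sum>k<n. norm (X $$ (i, k))"]) (auto intro: sum_nonneg)
  show ?thesis
  proof (rule that[of "2 * K + 1"])
    show "0 < 2 * K + 1" using K0 by simp
    fix z i j assume ij: "i < n" "j < n" and big: "2 * K + 1 \<le> norm z" and z: "z \<notin> spectrum X"
    define m where "m = Max ((\<lambda>i. norm (resolvent X z $$ (i, j))) ` {..<n})"
    have m_ge: "norm (resolvent X z $$ (k, j)) \<le> m" if "k < n" for k
      unfolding m_def using that by (intro Max_ge) auto
    have "m \<in> (\<lambda>i. norm (resolvent X z $$ (i, j))) ` {..<n}"
      unfolding m_def using False by (intro Max_in) auto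
    then obtain p where p: "p < n" "m = norm (resolvent X z $$ (p, j))" by auto
    have m0: "0 \<le> m" using p by simp
    have row: "norm (\<Sum>k<n. X $$ (q, k) * resolvent X z $$ (k, j)) \<le> K * m" if q: "q < n" for q
    proof -
      have "norm (\<Sum>k<n. X $$ (q, k) * resolvent X z $$ (k, j)) \<le> (\<Sum>k<n. norm (X $$ (q, k)) * m)"
        by (intro sum_norm_le) (use m_ge in \<open>auto simp: norm_mult intro!: mult_left_mono\<close>)
      also have "\<dots> \<le> K * m" unfolding sum_distrib_right[symmetric] using rowK[OF q] m0 by (rule mult_right_mono)
      finally show ?thesis .
    qed
    have "norm z * m = norm (z * resolvent X z $$ (p, j))" using p by (simp add: norm_mult)
    also have "\<dots> \<le> 1 + K * m"
      unfolding resolvent_recursion[OF z p(1) ij(2)] using row[OF p(1)]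
      by (intro norm_triangle_le) auto
    finally have "norm z * m \<le> 1 + K * m" .
    moreover have "2 * (K * m) \<le> norm z * m" using big m0 K0 by (simp flip: mult.assoc add: mult_right_mono)
    ultimately have zm: "norm z * m \<le> 2" by linarith
    have z0: "0 < norm z" using big K0 by linarith
    have "z * (resolvent X z $$ (i, j) - (if i = j then 1 else 0) / z) = (\<Sum>k<n. X $$ (i, k) * resolvent X z $$ (k, j))"
      using resolvent_recursion[OF z ij] z0 by (simp add: right_diff_distrib)
    then have "norm z * norm (resolvent X z $$ (i, j) - (if i = j then 1 else 0) / z) \<le> K * m"
      using row[OF ij(1)] by (metis norm_mult)
    then have "norm z * (norm z * norm (resolvent X z $$ (i, j) - (if i = j then 1 else 0) / z)) \<le> norm z * (K * m)"
      by (rule mult_left_mono) simp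
    also have "\<dots> = K * (norm z * m)" by (simp only: mult_ac)
    also have "\<dots> \<le> K * 2" using zm K0 by (rule mult_left_mono)
    finally have "(norm z)\<^sup>2 * norm (resolvent X z $$ (i, j) - (if i = j then 1 else 0) / z) \<le> 2 * K + 1"
      by (simp add: power2_eq_square mult.assoc)
    then show "norm (resolvent X z $$ (i, j) - (if i = j then 1 else 0) / z) \<le> (2 * K + 1) / (norm z)\<^sup>2"
      using z0 by (simp add: pos_le_divide_eq mult.commute)
  qed
qed

text \<open>The right-hand side does not mention the path, so any two admissible contours give the
  same integral.\<close>

lemma contour_integral_resolvent_residues:
  assumes F: "F holomorphic_on S" and S: "open S" "connected S"
    and \<gamma>: "valid_path \<gamma>" "pathfinish \<gamma> = pathstart \<gamma>" "path_image \<gamma> \<subseteq> S - spectrum X"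
    and zero: "\<And>z. z \<notin> S \<Longrightarrow> winding_number \<gamma> z = 0"
    and one: "\<And>z. z \<in> spectrum X \<Longrightarrow> winding_number \<gamma> z = 1"
    and ij: "i < n" "j < n"
  shows "contour_integral \<gamma> (\<lambda>z. F z * resolvent X z $$ (i, j))
    = 2 * pi * \<i> * (\<Sum>p\<in>spectrum X. residue (\<lambda>z. F z * resolvent X z $$ (i, j)) p)"
proof -
  have "(\<lambda>z. F z * resolvent X z $$ (i, j)) holomorphic_on S - spectrum X"
    by (intro holomorphic_on_mult holomorphic_on_subset[OF F] holomorphic_on_subset[OF resolvent_holomorphic[OF ij]]) auto
  from Residue_theorem[OF S finite_spectrum this \<gamma>(1,2,3)] zero one
  show ?thesis by simp
qed

text \<open>The contour calculus maps the constant \<open>1\<close> to the identity matrix: the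
  circle may be replaced by a large one around the origin, where the resolvent is
  \<open>1 / z\<close> up to an error whose integral is of order \<open>1 / \<rho>\<close>.\<close>

lemma contour_integral_resolvent:
  assumes r: "0 < r" "spectrum X \<subseteq> ball c r" and ij: "i < n" "j < n"
  shows "contour_integral (circlepath c r) (\<lambda>z. resolvent X z $$ (i, j)) = (if i = j then 2 * pi * \<i> else 0)"
proof -
  obtain C where C: "0 < C" and decay: "\<And>z i j. i < n \<Longrightarrow> j < n \<Longrightarrow> C \<le> norm z \<Longrightarrow> z \<notin> spectrum X \<Longrightarrow>
    norm (resolvent X z $$ (i, j) - (if i = j then 1 else 0) / z) \<le> C / (norm z)\<^sup>2"
    by (rule resolvent_decay) blast
  obtain B where B: "0 < B" "spectrum X \<subseteq> ball 0 B"
    using finite_imp_bounded[OF finite_spectrum] bounded_subset_ballD[of "spectrum X" 0] by auto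
  define I where "I = contour_integral (circlepath c r) (\<lambda>z. resolvent X z $$ (i, j))"
  have circ: "contour_integral (circlepath a \<rho>) (\<lambda>z. 1 * resolvent X z $$ (i, j))
      = 2 * pi * \<i> * (\<Sum>p\<in>spectrum X. residue (\<lambda>z. 1 * resolvent X z $$ (i, j)) p)"
    if "0 < \<rho>" "spectrum X \<subseteq> ball a \<rho>" for a \<rho>
    by (rule contour_integral_resolvent_residues[where S = UNIV])
       (use that ij in \<open>auto simp: dist_commute dist_norm subset_iff intro!: winding_number_circlepath\<close>)
  have bound: "norm (I - (if i = j then 2 * pi * \<i> else 0)) \<le> 2 * pi * C / \<rho>"
    if \<rho>: "max B C \<le> \<rho>" for \<rho>
  proof -
    have \<rho>0: "0 < \<rho>" using \<rho> C by simp
    have sub: "spectrum X \<subseteq> ball 0 \<rho>" using B \<rho> by auto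
    have "contour_integral (circlepath 0 \<rho>) (\<lambda>z. resolvent X z $$ (i, j)) = I"
      using circ[OF \<rho>0 sub] circ[OF r] by (simp add: I_def)
    moreover have disj: "sphere 0 \<rho> \<inter> spectrum X = {}" using sub by auto
    have "(\<lambda>z. resolvent X z $$ (i, j)) contour_integrable_on circlepath 0 \<rho>"
      by (intro contour_integrable_continuous_circlepath resolvent_continuous ij) (use disj \<rho>0 in auto)
    ultimately have 1: "((\<lambda>z. resolvent X z $$ (i, j)) has_contour_integral I) (circlepath 0 \<rho>)"
      using has_contour_integral_integral by metis
    have "((\<lambda>z. 1 / (z - 0)) has_contour_integral 2 * of_real pi * \<i> * 1) (circlepath 0 \<rho>)"
      using Cauchy_integral_circlepath_simple[of "\<lambda>_. 1" 0 \<rho> 0] \<rho>0 by simp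
    then have 2: "((\<lambda>z. (if i = j then 1 else 0) * (1 / z)) has_contour_integral
        (if i = j then 1 else 0) * (2 * of_real pi * \<i>)) (circlepath 0 \<rho>)"
      by (intro has_contour_integral_lmul) simp
    have "norm (I - (if i = j then 1 else 0) * (2 * of_real pi * \<i>)) \<le> C / \<rho>\<^sup>2 * (2 * pi * \<rho>)"
    proof (rule has_contour_integral_bound_circlepath[OF has_contour_integral_diff[OF 1 2]])
      fix z :: complex assume "norm (z - 0) = \<rho>"
      then have z: "norm z = \<rho>" "z \<notin> spectrum X" using disj by auto
      then show "norm (resolvent X z $$ (i, j) - (if i = j then 1 else 0) * (1 / z)) \<le> C / \<rho>\<^sup>2"
        using decay[OF ij, of z] \<rho> by simp
    qed (use C \<rho>0 in auto)
    also have "C / \<rho>\<^sup>2 * (2 * pi * \<rho>) = 2 * pi * C / \<rho>" using \<rho>0 by (simp add: power2_eq_square)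
    finally show ?thesis by (simp split: if_splits)
  qed
  have "((\<lambda>\<rho>. 2 * pi * C / \<rho>) \<longlongrightarrow> 0) at_top" by real_asymp
  then have "norm (I - (if i = j then 2 * pi * \<i> else 0)) \<le> 0"
    by (rule tendsto_lowerbound) (use bound eventually_ge_at_top[of "max B C"] in \<open>auto elim: eventually_mono\<close>)
  then show ?thesis by (simp add: I_def)
qed

end

section \<open>The contour calculus\<close>

text \<open>Discs around \<open>c\<close> of radius \<open>c\<close> exhaust the right half-plane as
  \<open>c\<close> grows, so several accretive matrices can share one contour that stays clear of
  the cut.\<close>

lemma finite_in_circle:
  assumes "finite P" "\<And>z. z \<in> P \<Longrightarrow> 0 < Re z"
  shows "\<exists>c r. 0 < r \<and> r < c \<and> P \<subseteq> ball (complex_of_real c) r"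
proof -
  define m where "m = Min (insert 1 (Re ` P))"
  define M where "M = Max (insert 1 ((\<lambda>z. (cmod z)\<^sup>2) ` P))"
  have m: "0 < m" unfolding m_def using assms by (subst Min_gr_iff) auto
  have m_le: "m \<le> Re z" if "z \<in> P" for z unfolding m_def using assms that by (intro Min_le) auto
  have M_ge: "(cmod z)\<^sup>2 \<le> M" if "z \<in> P" for z unfolding M_def using assms that by (intro Max_ge) auto
  have M1: "1 \<le> M" unfolding M_def using assms by (intro Max_ge) auto
  \<comment> \<open>This centre achieves \<open>M < c * m\<close>, which outweighs the term
    \<open>(cmod z)\<^sup>2\<close>; taking \<open>m / 2\<close> off the radius keeps the disc away
    from the origin.\<close>
  define c where "c = (M + 1) / m + m"
  have c: "m < c" using m M1 by (simp add: c_def)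
  have "c * m = (M + 1) / m * m + m * m" unfolding c_def by (rule distrib_right)
  moreover have "(M + 1) / m * m = M + 1" using m by simp
  ultimately have "c * m = M + 1 + m * m" by linarith
  then have cm: "M < c * m" using zero_le_square[of m] by linarith
  have "z \<in> ball (complex_of_real c) (c - m / 2)" if z: "z \<in> P" for z
  proof -
    have "(cmod (complex_of_real c - z))\<^sup>2 = c\<^sup>2 - 2 * c * Re z + (cmod z)\<^sup>2"
      unfolding cmod_power2 by (simp add: power2_eq_square algebra_simps)
    also have "\<dots> < c\<^sup>2 - c * m + m\<^sup>2 / 4"
    proof -
      have "c * m \<le> c * Re z" using m_le[OF z] c m by (intro mult_left_mono) auto
      moreover have "0 \<le> m\<^sup>2 / 4" by simp
      moreover have "2 * c * Re z = 2 * (c * Re z)" by simp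
      ultimately show ?thesis using M_ge[OF z] cm by linarith
    qed
    also have "\<dots> = (c - m / 2)\<^sup>2" by (simp add: power2_eq_square algebra_simps)
    finally have "(cmod (complex_of_real c - z))\<^sup>2 < (c - m / 2)\<^sup>2" .
    moreover have "0 \<le> c - m / 2" using c m by linarith
    ultimately have "cmod (complex_of_real c - z) < c - m / 2" by (rule power2_less_imp_less)
    then show ?thesis by (simp add: dist_norm)
  qed
  then have "P \<subseteq> ball (complex_of_real c) (c - m / 2)" by blast
  moreover have "0 < c - m / 2" "c - m / 2 < c" using c m by linarith+
  ultimately show ?thesis by blast
qed

text \<open>The residue theorem on the slit plane demands winding number zero around every point of
  the cut. The cut lies in a single component of the complement of the curve, and that component is
  unbounded.\<close>

lemma surrounds_spectrum_winding_zero: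
  assumes \<Gamma>: "surrounds_spectrum \<Gamma> X" and z: "z \<in> \<real>\<^sub>\<le>\<^sub>0"
  shows "winding_number \<Gamma> z = 0"
proof (rule winding_number_zero_in_outside)
  show "path \<Gamma>" "pathfinish \<Gamma> = pathstart \<Gamma>"
    using \<Gamma> by (auto simp: surrounds_spectrum_def valid_path_imp_path)
  have disj: "(\<real>\<^sub>\<le>\<^sub>0 :: complex set) \<subseteq> - path_image \<Gamma>"
    using \<Gamma> by (auto simp: surrounds_spectrum_def)
  have half: "(\<real>\<^sub>\<le>\<^sub>0 :: complex set) = complex_of_real ` {..0}" by (auto simp: nonpos_Reals_def)
  have "connected (\<real>\<^sub>\<le>\<^sub>0 :: complex set)"
    unfolding half by (intro connected_continuous_image continuous_intros connected_Iic)
  then have sub: "(\<real>\<^sub>\<le>\<^sub>0 :: complex set) \<subseteq> connected_component_set (- path_image \<Gamma>) z"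
    by (rule connected_component_maximal[OF z _ disj])
  have "\<not> bounded (\<real>\<^sub>\<le>\<^sub>0 :: complex set)"
  proof
    assume "bounded (\<real>\<^sub>\<le>\<^sub>0 :: complex set)"
    then obtain B where B: "\<And>x. x \<in> (\<real>\<^sub>\<le>\<^sub>0 :: complex set) \<Longrightarrow> norm x \<le> B" unfolding bounded_iff by blast
    have "complex_of_real (- (\<bar>B\<bar> + 1)) \<in> \<real>\<^sub>\<le>\<^sub>0" unfolding half by (intro imageI) simp
    from B[OF this] show False unfolding norm_of_real by linarith
  qed
  then have "\<not> bounded (connected_component_set (- path_image \<Gamma>) z)" using sub bounded_subset by blast
  then show "z \<in> outside (path_image \<Gamma>)" using z disj by (auto simp: outside_def)
qed

lemma inside_sphere: "0 < r \<Longrightarrow> inside (sphere (a::complex) r) = ball a r"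
  using inside_frontier_eq_interior[of "cball a r"] by simp

lemma cball_slit_plane: "r < c \<Longrightarrow> cball (complex_of_real c) r \<subseteq> - \<real>\<^sub>\<le>\<^sub>0"
proof (intro subsetI ComplI)
  fix z assume r: "r < c" and z: "z \<in> cball (complex_of_real c) r" and neg: "z \<in> \<real>\<^sub>\<le>\<^sub>0"
  have "c - Re z \<le> r" using z complex_Re_le_cmod[of "complex_of_real c - z"] by (simp add: dist_norm)
  then show False using neg r by (simp add: complex_nonpos_Reals_iff)
qed

lemma circle_surrounds_spectrum:
  assumes "0 < r" "r < c" "spectrum X \<subseteq> ball (complex_of_real c) r"
  shows "surrounds_spectrum (circlepath (complex_of_real c) r) X"
proof -
  have "sphere (complex_of_real c) r \<subseteq> - \<real>\<^sub>\<le>\<^sub>0"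
    using cball_slit_plane[OF assms(2)] sphere_cball by blast
  then show ?thesis
    unfolding surrounds_spectrum_def using assms
    by (auto simp: inside_sphere simple_path_circlepath dist_norm norm_minus_commute[of _ "of_real c"]
        intro!: winding_number_circlepath)
qed

text \<open>The contour calculus on a fixed circle for an arbitrary \<open>F\<close>: it applies to
  the approximants as well as to the extension of \<open>f\<close>, and for functions holomorphic on
  the slit plane it is linear and continuous in \<open>F\<close>.\<close>

definition circle_calc :: "real \<Rightarrow> real \<Rightarrow> (complex \<Rightarrow> complex) \<Rightarrow> complex mat \<Rightarrow> complex mat" where
  "circle_calc c r F X = Matrix.mat (dim_row X) (dim_row X) (\<lambda>(i, j).
    1 / (2 * of_real pi * \<i>) *
      contour_integral (circlepath (of_real c) r) (\<lambda>z. F z * resolvent X z $$ (i, j)))"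

text \<open>Every curve surrounding the spectrum produces the same sum of residues, so the definite
  description in \<open>mat_fun\<close> has exactly one candidate.\<close>

lemma mat_fun_eq_circle_calc:
  assumes X: "X \<in> carrier_mat n n" and r: "0 < r" "r < c" "spectrum X \<subseteq> ball (complex_of_real c) r"
    and hol: "analytic_ext f holomorphic_on - \<real>\<^sub>\<le>\<^sub>0"
  shows "mat_fun f X = circle_calc c r (analytic_ext f) X"
  unfolding mat_fun_def
proof (rule the_equality)
  let ?\<gamma> = "circlepath (complex_of_real c) r"
  have circ: "surrounds_spectrum ?\<gamma> X" by (rule circle_surrounds_spectrum[OF r])
  show "\<exists>\<Gamma>. surrounds_spectrum \<Gamma> X \<and> circle_calc c r (analytic_ext f) X =
      Matrix.mat (dim_row X) (dim_row X) (\<lambda>(i, j). 1 / (2 * of_real pi * \<i>) *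
        contour_integral \<Gamma> (\<lambda>z. analytic_ext f z * resolvent X z $$ (i, j)))"
    using circ by (intro exI[of _ ?\<gamma>]) (simp add: circle_calc_def)
  fix M assume "\<exists>\<Gamma>. surrounds_spectrum \<Gamma> X \<and> M =
      Matrix.mat (dim_row X) (dim_row X) (\<lambda>(i, j). 1 / (2 * of_real pi * \<i>) *
        contour_integral \<Gamma> (\<lambda>z. analytic_ext f z * resolvent X z $$ (i, j)))"
  then obtain \<Gamma> where \<Gamma>: "surrounds_spectrum \<Gamma> X" and M: "M =
      Matrix.mat (dim_row X) (dim_row X) (\<lambda>(i, j). 1 / (2 * of_real pi * \<i>) *
        contour_integral \<Gamma> (\<lambda>z. analytic_ext f z * resolvent X z $$ (i, j)))" by blast
  have val: "contour_integral g (\<lambda>z. analytic_ext f z * resolvent X z $$ (i, j))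
      = 2 * pi * \<i> * (\<Sum>p\<in>spectrum X. residue (\<lambda>z. analytic_ext f z * resolvent X z $$ (i, j)) p)"
    if g: "surrounds_spectrum g X" and ij: "i < n" "j < n" for g i j
  proof (rule contour_integral_resolvent_residues[OF X hol open_slit_plane connected_slit_plane])
    show "valid_path g" "pathfinish g = pathstart g" using g by (auto simp: surrounds_spectrum_def)
    have "inside (path_image g) \<inter> path_image g = {}" by (rule inside_no_overlap)
    then show "path_image g \<subseteq> - \<real>\<^sub>\<le>\<^sub>0 - spectrum X"
      using g unfolding surrounds_spectrum_def by blast
    show "winding_number g z = 0" if "z \<notin> - \<real>\<^sub>\<le>\<^sub>0" for z
      using surrounds_spectrum_winding_zero[OF g] that by simp
    show "winding_number g z = 1" if "z \<in> spectrum X" for z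
      using g that by (auto simp: surrounds_spectrum_def)
  qed (fact ij)+
  show "M = circle_calc c r (analytic_ext f) X"
    unfolding M circle_calc_def
    by (rule cong_mat) (use val[OF \<Gamma>] val[OF circ] X in simp_all)
qed

context
  fixes X :: "complex mat" and n :: nat and c r :: real
  assumes X: "X \<in> carrier_mat n n" and r: "0 < r" "r < c" "spectrum X \<subseteq> ball (complex_of_real c) r"
begin

lemma circle_calc_carrier: "circle_calc c r F X \<in> carrier_mat n n"
  using X by (simp add: circle_calc_def)

lemma circle_calc_index:
  "i < n \<Longrightarrow> j < n \<Longrightarrow> circle_calc c r F X $$ (i, j) = 1 / (2 * of_real pi * \<i>) *
      contour_integral (circlepath (of_real c) r) (\<lambda>z. F z * resolvent X z $$ (i, j))"
  using X by (simp add: circle_calc_def)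

lemma sphere_disjoint_spectrum: "sphere (complex_of_real c) r \<inter> spectrum X = {}"
  using r by auto

lemma sphere_slit_plane: "sphere (complex_of_real c) r \<subseteq> - \<real>\<^sub>\<le>\<^sub>0"
  using cball_slit_plane[OF r(2)] sphere_cball by blast

lemma circle_integrable:
  assumes "F holomorphic_on - \<real>\<^sub>\<le>\<^sub>0" "i < n" "j < n"
  shows "(\<lambda>z. F z * resolvent X z $$ (i, j)) contour_integrable_on circlepath (of_real c) r"
  by (intro contour_integrable_continuous_circlepath continuous_on_mult resolvent_continuous[OF X]
      continuous_on_subset[OF holomorphic_on_imp_continuous_on[OF assms(1)]])
     (use assms sphere_slit_plane sphere_disjoint_spectrum r in auto)

lemma circle_calc_mix:
  assumes "g holomorphic_on - \<real>\<^sub>\<le>\<^sub>0" "h holomorphic_on - \<real>\<^sub>\<le>\<^sub>0"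
  shows "circle_calc c r (\<lambda>z. of_real (1 - u) * g z + of_real u * h z) X
    = mat_mean u (circle_calc c r g X) (circle_calc c r h X)"
proof (rule eq_matI)
  have C: "mat_mean u (circle_calc c r g X) (circle_calc c r h X) \<in> carrier_mat n n"
    by (intro mat_mean_carrier circle_calc_carrier)
  then show "dim_row (circle_calc c r (\<lambda>z. of_real (1 - u) * g z + of_real u * h z) X)
      = dim_row (mat_mean u (circle_calc c r g X) (circle_calc c r h X))"
    "dim_col (circle_calc c r (\<lambda>z. of_real (1 - u) * g z + of_real u * h z) X)
      = dim_col (mat_mean u (circle_calc c r g X) (circle_calc c r h X))"
    by (simp_all only: carrier_matD[OF circle_calc_carrier] carrier_matD[OF C])
  fix i j assume "i < dim_row (mat_mean u (circle_calc c r g X) (circle_calc c r h X))"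
    "j < dim_col (mat_mean u (circle_calc c r g X) (circle_calc c r h X))"
  then have ij: "i < n" "j < n" by (simp_all only: carrier_matD[OF C])
  let ?\<gamma> = "circlepath (complex_of_real c) r" and ?R = "\<lambda>z. resolvent X z $$ (i, j)"
  note int = circle_integrable[OF assms(1) ij] circle_integrable[OF assms(2) ij]
  have "contour_integral ?\<gamma> (\<lambda>z. (of_real (1 - u) * g z + of_real u * h z) * ?R z)
      = contour_integral ?\<gamma> (\<lambda>z. of_real (1 - u) * (g z * ?R z) + of_real u * (h z * ?R z))"
    by (simp only: distrib_right mult.assoc)
  also have "\<dots> = contour_integral ?\<gamma> (\<lambda>z. of_real (1 - u) * (g z * ?R z)) + contour_integral ?\<gamma> (\<lambda>z. of_real u * (h z * ?R z))"
    by (intro contour_integral_add contour_integrable_lmul int)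
  also have "\<dots> = of_real (1 - u) * contour_integral ?\<gamma> (\<lambda>z. g z * ?R z) + of_real u * contour_integral ?\<gamma> (\<lambda>z. h z * ?R z)"
    by (simp only: contour_integral_lmul int)
  finally have eq: "contour_integral ?\<gamma> (\<lambda>z. (of_real (1 - u) * g z + of_real u * h z) * ?R z)
      = of_real (1 - u) * contour_integral ?\<gamma> (\<lambda>z. g z * ?R z) + of_real u * contour_integral ?\<gamma> (\<lambda>z. h z * ?R z)" .
  have "mat_mean u (circle_calc c r g X) (circle_calc c r h X) $$ (i, j)
      = of_real (1 - u) * circle_calc c r g X $$ (i, j) + of_real u * circle_calc c r h X $$ (i, j)"
    using circle_calc_carrier[of g] circle_calc_carrier[of h] ij unfolding mat_mean_def by simp
  then show "circle_calc c r (\<lambda>z. of_real (1 - u) * g z + of_real u * h z) X $$ (i, j)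
      = mat_mean u (circle_calc c r g X) (circle_calc c r h X) $$ (i, j)"
    unfolding circle_calc_index[OF ij] eq by (simp only: distrib_left mult.left_commute)
qed

text \<open>The circle is compact and misses the spectrum, so the resolvent is bounded on it and
  uniform convergence survives multiplication and integration.\<close>

lemma circle_calc_limit:
  assumes g: "\<And>k. g k holomorphic_on - \<real>\<^sub>\<le>\<^sub>0" and G: "G holomorphic_on - \<real>\<^sub>\<le>\<^sub>0"
    and lim: "uniform_limit (sphere (of_real c) r) g G sequentially" and ij: "i < n" "j < n"
  shows "(\<lambda>k. circle_calc c r (g k) X $$ (i, j)) \<longlonglongrightarrow> circle_calc c r G X $$ (i, j)"
proof -
  let ?S = "sphere (complex_of_real c) r" and ?R = "\<lambda>z. resolvent X z $$ (i, j)"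
  have "uniform_limit ?S (\<lambda>k z. g k z * ?R z) (\<lambda>z. G z * ?R z) sequentially"
  proof (rule uniform_lim_mult[OF lim uniform_limit_const])
    show "bounded (G ` ?S)"
      by (intro compact_imp_bounded compact_continuous_image
          continuous_on_subset[OF holomorphic_on_imp_continuous_on[OF G] sphere_slit_plane]) simp
    show "bounded (?R ` ?S)"
      by (intro compact_imp_bounded compact_continuous_image resolvent_continuous[OF X ij] sphere_disjoint_spectrum) simp
  qed
  then have "(\<lambda>k. contour_integral (circlepath (of_real c) r) (\<lambda>z. g k z * ?R z))
      \<longlonglongrightarrow> contour_integral (circlepath (of_real c) r) (\<lambda>z. G z * ?R z)"
    by (intro contour_integral_uniform_limit_circlepath(2) always_eventually allI circle_integrable g ij)
       (use r in auto)
  then show ?thesis unfolding circle_calc_index[OF ij] by (intro tendsto_mult_left)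
qed

text \<open>With \<open>T = s + (1 - s) X\<close> and \<open>d = s + (1 - s) z\<close> one has
  \<open>hmean s z R(z) = T\<^sup>-\<^sup>1 X R(z) + (s / d) T\<^sup>-\<^sup>1\<close>; the second summand is holomorphic inside the circle.\<close>

lemma circle_calc_hmean:
  assumes s: "0 \<le> s" "s \<le> 1" and Y: "Y \<in> carrier_mat n n"
    and YT: "Y * (of_real s \<cdot>\<^sub>m 1\<^sub>m n + of_real (1 - s) \<cdot>\<^sub>m X) = 1\<^sub>m n"
  shows "circle_calc c r (hmean s) X = Y * X"
proof (rule eq_matI)
  show "dim_row (circle_calc c r (hmean s) X) = dim_row (Y * X)"
    "dim_col (circle_calc c r (hmean s) X) = dim_col (Y * X)"
    using X Y by (simp_all add: circle_calc_def)
  fix i j assume "i < dim_row (Y * X)" "j < dim_col (Y * X)"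
  then have ij: "i < n" "j < n" using X Y by simp_all
  let ?T = "of_real s \<cdot>\<^sub>m 1\<^sub>m n + of_real (1 - s) \<cdot>\<^sub>m X"
  let ?\<gamma> = "circlepath (complex_of_real c) r" and ?R = "\<lambda>k z. resolvent X z $$ (k, j)"
  let ?q = "\<lambda>z. of_real s / (of_real s + of_real (1 - s) * z)"
  have YX: "Y * X \<in> carrier_mat n n" using X Y by simp
  have q: "?q holomorphic_on - \<real>\<^sub>\<le>\<^sub>0"
    by (intro holomorphic_intros) (use hmean_denom_nonzero[OF s] in auto)
  have id: "hmean s z * ?R i z = (\<Sum>k<n. (Y * X) $$ (i, k) * ?R k z) + Y $$ (i, j) * ?q z"
    if z: "z \<in> sphere (complex_of_real c) r" for z
  proof -
    have zs: "z \<notin> spectrum X" "z \<notin> \<real>\<^sub>\<le>\<^sub>0" using z sphere_disjoint_spectrum sphere_slit_plane by auto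
    define d where "d = of_real s + of_real (1 - s) * z"
    have d0: "d \<noteq> 0" unfolding d_def by (rule hmean_denom_nonzero[OF s zs(2)])
    define R where "R = resolvent X z"
    define T where "T = ?T"
    define N where "N = z \<cdot>\<^sub>m 1\<^sub>m n - X"
    have R: "R \<in> carrier_mat n n" and NR: "N * R = 1\<^sub>m n"
      using resolvent_inverse[OF X zs(1)] by (simp_all add: R_def N_def)
    have T: "T \<in> carrier_mat n n" using X by (simp add: T_def)
    have N: "N \<in> carrier_mat n n" unfolding N_def by (rule resolvent_arg_carrier[OF X])
    \<comment> \<open>Multiplied by \<open>Y\<close> from the left and by \<open>R\<close> from the
      right this becomes the announced decomposition, because \<open>Y * T\<close> and
      \<open>N * R\<close> are the identity.\<close>
    have lin: "z \<cdot>\<^sub>m T = d \<cdot>\<^sub>m X + of_real s \<cdot>\<^sub>m N"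
      by (rule eq_matI) (use X in \<open>auto simp: T_def N_def d_def algebra_simps\<close>)
    have "z \<cdot>\<^sub>m R = z \<cdot>\<^sub>m ((Y * T) * R)" using YT R by (simp add: T_def)
    also have "\<dots> = Y * (z \<cdot>\<^sub>m T) * R"
      using Y T R by (simp add: mult_smult_distrib[of _ n n _ n] mult_smult_assoc_mat[of _ n n _ n])
    also have "\<dots> = (d \<cdot>\<^sub>m (Y * X) + of_real s \<cdot>\<^sub>m (Y * N)) * R"
      unfolding lin using Y X N by (simp add: mult_add_distrib_mat[of _ n n _ n] mult_smult_distrib[of _ n n _ n])
    also have "\<dots> = d \<cdot>\<^sub>m (Y * X * R) + of_real s \<cdot>\<^sub>m (Y * N * R)"
      using Y X N R by (simp add: add_mult_distrib_mat[of _ n n _ _ n] mult_smult_assoc_mat[of _ n n _ n])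
    also have "Y * N * R = Y"
      using Y N R NR by (simp add: assoc_mult_mat[of _ n n _ n _ n])
    finally have eq: "z \<cdot>\<^sub>m R = d \<cdot>\<^sub>m (Y * X * R) + of_real s \<cdot>\<^sub>m Y" .
    have "z * R $$ (i, j) = (z \<cdot>\<^sub>m R) $$ (i, j)" using R ij by simp
    also have "\<dots> = d * (Y * X * R) $$ (i, j) + of_real s * Y $$ (i, j)"
      unfolding eq using YX R Y ij mult_square_carrier[OF YX R] by (simp del: index_mult_mat(1))
    finally have "z * R $$ (i, j) = d * (\<Sum>k<n. (Y * X) $$ (i, k) * R $$ (k, j)) + of_real s * Y $$ (i, j)"
      unfolding mult_mat_index[OF YX R ij] .
    then have "z / d * R $$ (i, j) = (\<Sum>k<n. (Y * X) $$ (i, k) * R $$ (k, j)) + of_real s * Y $$ (i, j) / d"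
      using d0 by (simp add: field_simps)
    then show ?thesis by (simp add: hmean_def d_def R_def mult.commute)
  qed
  have "contour_integral ?\<gamma> (\<lambda>z. hmean s z * ?R i z)
      = contour_integral ?\<gamma> (\<lambda>z. (\<Sum>k<n. (Y * X) $$ (i, k) * ?R k z) + Y $$ (i, j) * ?q z)"
    by (rule contour_integral_eq) (use id r in simp)
  also have "\<dots> = (\<Sum>k<n. (Y * X) $$ (i, k) * contour_integral ?\<gamma> (?R k)) + Y $$ (i, j) * 0"
  proof (rule contour_integral_unique, intro has_contour_integral_add has_contour_integral_sum has_contour_integral_lmul)
    show "(?q has_contour_integral 0) ?\<gamma>"
    proof (rule Cauchy_theorem_convex_simple)
      show "?q holomorphic_on cball (complex_of_real c) r"
        by (rule holomorphic_on_subset[OF q cball_slit_plane[OF r(2)]])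
    qed (use r in \<open>auto simp: sphere_cball\<close>)
    fix k assume "k \<in> {..<n}"
    then show "(?R k has_contour_integral contour_integral ?\<gamma> (?R k)) ?\<gamma>"
      using circle_integrable[of "\<lambda>_. 1" k j] ij by (intro has_contour_integral_integral) simp
  qed simp
  also have "(\<Sum>k<n. (Y * X) $$ (i, k) * contour_integral ?\<gamma> (?R k))
      = (\<Sum>k<n. if k = j then 2 * pi * \<i> * (Y * X) $$ (i, j) else 0)"
    by (intro sum.cong refl) (use contour_integral_resolvent[OF X r(1,3) _ ij(2)] in \<open>simp del: index_mult_mat\<close>)
  also have "\<dots> = 2 * pi * \<i> * (Y * X) $$ (i, j)" using ij by simp
  finally show "circle_calc c r (hmean s) X $$ (i, j) = (Y * X) $$ (i, j)"
    unfolding circle_calc_index[OF ij] by simp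
qed

end

section \<open>Sesquilinear forms\<close>

lemma cscalar_prod_add_left:
  "u \<in> carrier_vec n \<Longrightarrow> v \<in> carrier_vec n \<Longrightarrow> w \<in> carrier_vec n \<Longrightarrow> (u + v) \<bullet>c w = u \<bullet>c w + v \<bullet>c w"
  for u v w :: "complex vec"
  by (simp add: cscalar_prod_sum[of _ n] distrib_right sum.distrib)

lemma cscalar_prod_add_right:
  "u \<in> carrier_vec n \<Longrightarrow> v \<in> carrier_vec n \<Longrightarrow> w \<in> carrier_vec n \<Longrightarrow> u \<bullet>c (v + w) = u \<bullet>c v + u \<bullet>c w"
  for u v w :: "complex vec"
  by (simp add: cscalar_prod_sum[of _ n] distrib_left sum.distrib)

lemma cscalar_prod_smult_left:
  "u \<in> carrier_vec n \<Longrightarrow> v \<in> carrier_vec n \<Longrightarrow> (a \<cdot>\<^sub>v u) \<bullet>c v = a * (u \<bullet>c v)"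
  for u v :: "complex vec"
  by (simp add: cscalar_prod_sum[of _ n] sum_distrib_left mult.assoc)

lemma cscalar_prod_smult_right:
  "u \<in> carrier_vec n \<Longrightarrow> v \<in> carrier_vec n \<Longrightarrow> u \<bullet>c (a \<cdot>\<^sub>v v) = cnj a * (u \<bullet>c v)"
  for u v :: "complex vec"
  by (simp add: cscalar_prod_sum[of _ n] sum_distrib_left mult_ac)

lemma cscalar_prod_swap:
  "u \<in> carrier_vec n \<Longrightarrow> v \<in> carrier_vec n \<Longrightarrow> v \<bullet>c u = cnj (u \<bullet>c v)"
  for u v :: "complex vec"
  by (simp add: cscalar_prod_sum[of _ n] mult.commute)

lemma cscalar_prod_self:
  "u \<in> carrier_vec n \<Longrightarrow> u \<bullet>c u = of_real (\<Sum>i<n. (cmod (u $ i))\<^sup>2)"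
  for u :: "complex vec"
  unfolding of_real_sum complex_norm_square by (simp add: cscalar_prod_sum[of _ n])

lemma cscalar_prod_self_nonneg: "0 \<le> Re (u \<bullet>c u)" for u :: "complex vec"
proof -
  have "u \<bullet>c u = of_real (\<Sum>i<dim_vec u. (cmod (u $ i))\<^sup>2)"
    by (rule cscalar_prod_self) (rule carrier_vecI[OF refl])
  then show ?thesis by (simp add: sum_nonneg)
qed

lemma cscalar_prod_self_pos:
  assumes u: "(u :: complex vec) \<in> carrier_vec n" "u \<noteq> 0\<^sub>v n"
  shows "0 < Re (u \<bullet>c u)"
proof -
  have "u = 0\<^sub>v n" if "\<And>i. i < n \<Longrightarrow> u $ i = 0"
    by (rule eq_vecI) (use that u in simp_all)
  then obtain i where i: "i < n" "u $ i \<noteq> 0" using u by blast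
  have "0 < (\<Sum>i<n. (cmod (u $ i))\<^sup>2)"
    by (rule sum_pos2[of _ i]) (use i in simp_all)
  then show ?thesis by (simp add: cscalar_prod_self[OF u(1)])
qed

definition sesq :: "complex mat \<Rightarrow> complex vec \<Rightarrow> complex vec \<Rightarrow> complex" where
  "sesq A u v = (A *\<^sub>v u) \<bullet>c v"

lemma qform_sesq: "qform A x = Re (sesq A x x)"
  by (simp add: qform_def sesq_def)

lemma mult_mat_vec_add:
  "A \<in> carrier_mat n n \<Longrightarrow> u \<in> carrier_vec n \<Longrightarrow> v \<in> carrier_vec n \<Longrightarrow> A *\<^sub>v (u + v) = A *\<^sub>v u + A *\<^sub>v v"
  for A :: "complex mat"
  by (rule mult_add_distrib_mat_vec)

lemma mult_mat_vec_smult: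
  "A \<in> carrier_mat n n \<Longrightarrow> u \<in> carrier_vec n \<Longrightarrow> A *\<^sub>v (a \<cdot>\<^sub>v u) = a \<cdot>\<^sub>v (A *\<^sub>v u)"
  for A :: "complex mat"
  by (rule mult_mat_vec)

context
  fixes A :: "complex mat" and n :: nat
  assumes A: "A \<in> carrier_mat n n"
begin

lemma sesq_add_left:
  "u \<in> carrier_vec n \<Longrightarrow> v \<in> carrier_vec n \<Longrightarrow> w \<in> carrier_vec n \<Longrightarrow> sesq A (u + v) w = sesq A u w + sesq A v w"
  unfolding sesq_def using A
  by (simp only: mult_mat_vec_add[of A n] cscalar_prod_add_left[of _ n] mult_square_vec_carrier)

lemma sesq_add_right:
  "u \<in> carrier_vec n \<Longrightarrow> v \<in> carrier_vec n \<Longrightarrow> w \<in> carrier_vec n \<Longrightarrow> sesq A w (u + v) = sesq A w u + sesq A w v"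
  unfolding sesq_def using A
  by (simp only: cscalar_prod_add_right[of _ n] mult_square_vec_carrier)

lemma sesq_smult_left:
  "u \<in> carrier_vec n \<Longrightarrow> v \<in> carrier_vec n \<Longrightarrow> sesq A (a \<cdot>\<^sub>v u) v = a * sesq A u v"
  unfolding sesq_def using A
  by (simp only: mult_mat_vec_smult[of A n] cscalar_prod_smult_left[of _ n] mult_square_vec_carrier)

lemma sesq_smult_right:
  "u \<in> carrier_vec n \<Longrightarrow> v \<in> carrier_vec n \<Longrightarrow> sesq A u (a \<cdot>\<^sub>v v) = cnj a * sesq A u v"
  unfolding sesq_def using A
  by (simp only: cscalar_prod_smult_right[of _ n] mult_square_vec_carrier)

lemmas sesq_simps = sesq_add_left sesq_add_right sesq_smult_left sesq_smult_right

lemma sesq_adjoint: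
  "u \<in> carrier_vec n \<Longrightarrow> v \<in> carrier_vec n \<Longrightarrow> sesq (mat_adjoint A) u v = cnj (sesq A v u)"
  unfolding sesq_def
  using cscalar_prod_adjoint[OF A, of v u] cscalar_prod_swap[of "mat_adjoint A *\<^sub>v u" n v] A
  by (simp del: index_mult_mat_vec)

end

section \<open>Hermitian parts and positive definite forms\<close>

lemma mat_Re_carrier [simp]: "A \<in> carrier_mat n n \<Longrightarrow> mat_Re A \<in> carrier_mat n n"
  by (simp add: mat_Re_def)

lemma mat_Re_index:
  "A \<in> carrier_mat n n \<Longrightarrow> i < n \<Longrightarrow> j < n \<Longrightarrow> mat_Re A $$ (i, j) = (A $$ (i, j) + cnj (A $$ (j, i))) / 2"
  by (simp add: mat_Re_def)

lemma mat_Re_hermitian: "A \<in> carrier_mat n n \<Longrightarrow> hermitian (mat_Re A)"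
  by (rule hermitianI[of _ n]) (simp_all add: mat_Re_index add.commute)

lemma sesq_mat_Re:
  assumes A: "A \<in> carrier_mat n n" and uv: "u \<in> carrier_vec n" "v \<in> carrier_vec n"
  shows "sesq (mat_Re A) u v = (sesq A u v + cnj (sesq A v u)) / 2"
proof -
  have "sesq (mat_Re A) u v = (\<Sum>i<n. (\<Sum>j<n. mat_Re A $$ (i, j) * u $ j) * cnj (v $ i))"
    using A uv unfolding sesq_def
    by (simp add: cscalar_prod_sum[of _ n] mult_mat_vec_index[of _ n n] del: index_mult_mat_vec)
  also have "\<dots> = (\<Sum>i<n. ((\<Sum>j<n. A $$ (i, j) * u $ j) * cnj (v $ i)
      + (\<Sum>j<n. mat_adjoint A $$ (i, j) * u $ j) * cnj (v $ i)) / 2)"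
    using A by (intro sum.cong refl)
      (simp add: mat_Re_index distrib_right add_divide_distrib sum.distrib flip: sum_divide_distrib)
  also have "\<dots> = (sesq A u v + sesq (mat_adjoint A) u v) / 2"
    using A uv unfolding sesq_def
    by (simp add: cscalar_prod_sum[of _ n] mult_mat_vec_index[of _ n n] sum.distrib add_divide_distrib sum_divide_distrib
        del: index_mult_mat_vec)
  finally show ?thesis using sesq_adjoint[OF A uv] by simp
qed

lemma qform_mat_Re:
  "A \<in> carrier_mat n n \<Longrightarrow> x \<in> carrier_vec n \<Longrightarrow> qform (mat_Re A) x = qform A x"
  by (simp add: qform_sesq sesq_mat_Re)

lemma sesq_hermitian:
  assumes A: "A \<in> carrier_mat n n" "hermitian A" and uv: "u \<in> carrier_vec n" "v \<in> carrier_vec n"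
  shows "sesq A v u = cnj (sesq A u v)"
  using sesq_adjoint[OF A(1) uv(2,1)] A(2) by (simp add: hermitian_def)

lemma pos_def_qform:
  assumes A: "A \<in> carrier_mat n n" "pos_def A" and x: "x \<in> carrier_vec n"
  shows "0 \<le> qform A x" "x \<noteq> 0\<^sub>v n \<Longrightarrow> 0 < qform A x"
proof -
  show *: "0 < qform A x" if "x \<noteq> 0\<^sub>v n"
    using A x that by (simp add: pos_def_def qform_def del: index_mult_mat_vec)
  have "qform A (0\<^sub>v n) = 0" using A by (simp add: qform_sum[of A n])
  then show "0 \<le> qform A x" using * by (cases "x = 0\<^sub>v n") auto
qed

text \<open>The variational principle: the quadratic form of \<open>hmean s H\<close> at
  \<open>x = s w + (1 - s) H w\<close> is the minimum of \<open>s \<langle>H a, a\<rangle> + (1 - s) \<parallel>b\<parallel>\<^sup>2\<close> over all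
  decompositions \<open>x = s a + (1 - s) b\<close>.\<close>

lemma hmean_variational:
  assumes H: "H \<in> carrier_mat n n" "pos_def H" and s: "0 \<le> s" "s \<le> 1"
    and w: "w \<in> carrier_vec n" and a: "a \<in> carrier_vec n" and b: "b \<in> carrier_vec n"
    and x: "x = of_real s \<cdot>\<^sub>v w + of_real (1 - s) \<cdot>\<^sub>v (H *\<^sub>v w)"
      "x = of_real s \<cdot>\<^sub>v a + of_real (1 - s) \<cdot>\<^sub>v b"
  shows "Re (sesq H w x) \<le> s * qform H a + (1 - s) * Re (b \<bullet>c b)"
proof -
  have herm: "hermitian H" using H by (simp add: pos_def_def)
  define v where "v = H *\<^sub>v w"
  have v: "v \<in> carrier_vec n" using H w by (simp add: v_def)
  have sv: "sesq H w u = v \<bullet>c u" for u by (simp add: sesq_def v_def)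
  have m: "(- 1 :: complex) \<cdot>\<^sub>v w \<in> carrier_vec n" "(- 1 :: complex) \<cdot>\<^sub>v v \<in> carrier_vec n" using w v by simp_all
  \<comment> \<open>The squares at \<open>a - w\<close> and at \<open>b - v\<close> are weighted by
    \<open>s\<close> and \<open>1 - s\<close>. Their cross terms add up to
    \<open>- 2 * Re (v \<bullet>c x)\<close> by the second decomposition of \<open>x\<close>, the
    terms free of \<open>a\<close> and \<open>b\<close> to \<open>Re (v \<bullet>c x)\<close> by the
    first.\<close>
  have "0 \<le> qform H (a + (- 1) \<cdot>\<^sub>v w)" by (rule pos_def_qform(1)[OF H]) (use a w in simp)
  also have "\<dots> = qform H a - 2 * Re (v \<bullet>c a) + Re (v \<bullet>c w)"
    unfolding qform_sesq using a w m
    by (simp add: sesq_simps[OF H(1)] sesq_hermitian[OF H(1) herm w a] sv)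
  finally have "0 \<le> s * (qform H a - 2 * Re (v \<bullet>c a) + Re (v \<bullet>c w))" using s by simp
  moreover have "0 \<le> Re ((b + (- 1) \<cdot>\<^sub>v v) \<bullet>c (b + (- 1) \<cdot>\<^sub>v v))" by (rule cscalar_prod_self_nonneg)
  have "\<dots> = Re (b \<bullet>c b) - 2 * Re (v \<bullet>c b) + Re (v \<bullet>c v)"
    using b v m by (simp add: cscalar_prod_add_left[of _ n] cscalar_prod_add_right[of _ n]
        cscalar_prod_smult_left[of _ n] cscalar_prod_smult_right[of _ n] cscalar_prod_swap[OF v b])
  with \<open>0 \<le> Re ((b + (- 1) \<cdot>\<^sub>v v) \<bullet>c (b + (- 1) \<cdot>\<^sub>v v))\<close>
  have "0 \<le> (1 - s) * (Re (b \<bullet>c b) - 2 * Re (v \<bullet>c b) + Re (v \<bullet>c v))" using s by simp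
  moreover have "Re (v \<bullet>c x) = s * Re (v \<bullet>c w) + (1 - s) * Re (v \<bullet>c v)"
    unfolding x(1) v_def[symmetric] using v w
    by (simp add: cscalar_prod_add_right[of _ n] cscalar_prod_smult_right[of _ n])
  moreover have "Re (v \<bullet>c x) = s * Re (v \<bullet>c a) + (1 - s) * Re (v \<bullet>c b)"
    unfolding x(2) using v a b
    by (simp add: cscalar_prod_add_right[of _ n] cscalar_prod_smult_right[of _ n])
  ultimately show ?thesis unfolding sv by (simp add: algebra_simps)
qed

text \<open>If \<open>H = \<Re>M\<close> and \<open>M = H (1 + i T)\<close>, the sector condition bounds the norm of \<open>T\<close> by \<open>\<tau>\<close> in the
  inner product of \<open>H\<close>; here \<open>z = (1 + i T) w\<close> and \<open>y = T w\<close>.\<close>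

lemma sectorial_bound:
  assumes M: "M \<in> carrier_mat n n" and pos: "pos_def (mat_Re M)"
    and sec: "\<And>u. u \<in> carrier_vec n \<Longrightarrow> \<bar>Im (sesq M u u)\<bar> \<le> \<tau> * Re (sesq M u u)" and \<tau>: "0 \<le> \<tau>"
    and w: "w \<in> carrier_vec n" and z: "z \<in> carrier_vec n" and Hz: "mat_Re M *\<^sub>v z = M *\<^sub>v w"
  shows "qform M z \<le> (1 + \<tau>\<^sup>2) * qform M w"
proof -
  define y where "y = (- \<i>) \<cdot>\<^sub>v z + \<i> \<cdot>\<^sub>v w"
  have y: "y \<in> carrier_vec n" using w z by (simp add: y_def)
  have zy: "z = w + \<i> \<cdot>\<^sub>v y"
    by (rule eq_vecI) (use w z in \<open>auto simp: y_def algebra_simps\<close>)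
  note H = mat_Re_carrier[OF M]
  define h where "h u v = sesq (mat_Re M) u v" for u v
  have h: "h u v = (sesq M u v + cnj (sesq M v u)) / 2" if "u \<in> carrier_vec n" "v \<in> carrier_vec n" for u v
    unfolding h_def using sesq_mat_Re[OF M that] .
  have hz: "h z v = sesq M w v" for v by (simp add: h_def sesq_def Hz)
  have iy: "\<i> \<cdot>\<^sub>v y \<in> carrier_vec n" using y by simp
  \<comment> \<open>In the inner product \<open>h\<close> the map from \<open>w\<close> to
    \<open>y\<close> represents the imaginary part of \<open>M\<close> and is self-adjoint. So
    \<open>h y w\<close> is real and the cross terms cancel in \<open>h z z\<close>.\<close>
  have hyv: "\<i> * h y v = (sesq M w v - cnj (sesq M v w)) / 2" if v: "v \<in> carrier_vec n" for v
  proof -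
    have "h z v = h w v + \<i> * h y v"
      unfolding h_def zy using w y v iy by (simp add: sesq_simps[OF H])
    then show ?thesis using h[OF w v] hz[of v] by (simp add: field_simps)
  qed
  have real: "h u u = of_real (qform M u)" if "u \<in> carrier_vec n" for u
    using h[OF that that] by (simp add: qform_sesq complex_eq_iff)
  have yy: "Im (sesq M w y + sesq M y w) = 2 * qform M y"
    using arg_cong[OF hyv[OF y], of Im] unfolding real[OF y] by simp
  have "h y w = of_real (Im (sesq M w w))"
    using hyv[OF w] by (simp add: complex_eq_iff)
  then have "Re (\<i> * h y w) = 0" by simp
  moreover have "h w y = cnj (h y w)" unfolding h_def
    by (rule sesq_hermitian[OF H mat_Re_hermitian[OF M] y w])
  moreover have "h z z = h w w + \<i> * h y w - \<i> * h w y + h y y"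
    unfolding zy h_def using w y iy
    by (simp add: sesq_simps[OF H] algebra_simps)
  ultimately have zz: "qform M z = qform M w + qform M y"
    using real[OF z] real[OF w] real[OF y] by (simp add: complex_eq_iff)
  \<comment> \<open>Polarization: the sector condition is used at \<open>w + l y\<close> and
    \<open>w - l y\<close>. Subtracting the imaginary parts isolates the mixed term, adding the real
    parts removes it; \<open>l = 1 / \<tau>\<close> then gives the bound.\<close>
  have pol: "2 * l * qform M y \<le> \<tau> * (qform M w + l\<^sup>2 * qform M y)" for l :: real
  proof -
    define u1 u2 where "u1 = w + of_real l \<cdot>\<^sub>v y" and "u2 = w + of_real (- l) \<cdot>\<^sub>v y"
    have ly: "complex_of_real l \<cdot>\<^sub>v y \<in> carrier_vec n" "complex_of_real (- l) \<cdot>\<^sub>v y \<in> carrier_vec n" using y by simp_all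
    have u: "u1 \<in> carrier_vec n" "u2 \<in> carrier_vec n" using w ly by (simp_all add: u1_def u2_def)
    have s1: "sesq M u1 u1 = sesq M w w + of_real l * (sesq M w y + sesq M y w) + of_real (l\<^sup>2) * sesq M y y"
      unfolding u1_def using w y ly by (simp add: sesq_simps[OF M] power2_eq_square algebra_simps)
    have s2: "sesq M u2 u2 = sesq M w w - of_real l * (sesq M w y + sesq M y w) + of_real (l\<^sup>2) * sesq M y y"
      unfolding u2_def using w y ly by (simp add: sesq_simps[OF M] power2_eq_square algebra_simps)
    have "Im (sesq M u1 u1) - Im (sesq M u2 u2) \<le> \<tau> * Re (sesq M u1 u1) + \<tau> * Re (sesq M u2 u2)"
      using sec[OF u(1)] sec[OF u(2)] by linarith
    moreover have "Im (sesq M u1 u1) - Im (sesq M u2 u2) = 4 * l * qform M y"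
    proof -
      have "Im (sesq M u1 u1) - Im (sesq M u2 u2) = 2 * l * Im (sesq M w y + sesq M y w)"
        unfolding s1 s2 by (simp add: algebra_simps)
      then show ?thesis unfolding yy by simp
    qed
    moreover have "\<tau> * Re (sesq M u1 u1) + \<tau> * Re (sesq M u2 u2) = 2 * (\<tau> * (qform M w + l\<^sup>2 * qform M y))"
    proof -
      have "Re (sesq M u1 u1) + Re (sesq M u2 u2) = 2 * (qform M w + l\<^sup>2 * qform M y)"
        unfolding s1 s2 qform_sesq by simp
      then show ?thesis unfolding distrib_left[symmetric] by simp
    qed
    ultimately show ?thesis by linarith
  qed
  have "qform M y \<le> \<tau>\<^sup>2 * qform M w"
  proof (cases "\<tau> = 0")
    case True
    then show ?thesis using pol[of 1] by simp
  next
    case False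
    then have t: "0 < \<tau>" using \<tau> by simp
    have "\<tau> * (2 * (1 / \<tau>) * qform M y) \<le> \<tau> * (\<tau> * (qform M w + (1 / \<tau>)\<^sup>2 * qform M y))"
      using pol[of "1 / \<tau>"] t by (intro mult_left_mono) auto
    then show ?thesis using t by (simp add: power2_eq_square field_simps)
  qed
  then show ?thesis unfolding zz by (simp add: distrib_right)
qed

section \<open>The inequalities for weighted harmonic means\<close>

lemma mat_mean_mult_vec:
  assumes "A \<in> carrier_mat n n" "B \<in> carrier_mat n n" "v \<in> carrier_vec n"
  shows "mat_mean t A B *\<^sub>v v = of_real (1 - t) \<cdot>\<^sub>v (A *\<^sub>v v) + of_real t \<cdot>\<^sub>v (B *\<^sub>v v)"
proof -
  have "mat_mean t A B *\<^sub>v v = (of_real (1 - t) \<cdot>\<^sub>m A) *\<^sub>v v + (of_real t \<cdot>\<^sub>m B) *\<^sub>v v"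
    unfolding mat_mean_def by (rule add_mult_distrib_mat_vec[of _ n n]) (use assms in simp_all)
  then show ?thesis using assms by (simp only: smult_mat_mult_vec)
qed

definition shift :: "real \<Rightarrow> complex mat \<Rightarrow> complex mat" where
  "shift s X = of_real s \<cdot>\<^sub>m 1\<^sub>m (dim_row X) + of_real (1 - s) \<cdot>\<^sub>m X"

lemma shift_carrier: "X \<in> carrier_mat n n \<Longrightarrow> shift s X \<in> carrier_mat n n"
  by (simp add: shift_def)

lemma shift_mult_vec:
  assumes "X \<in> carrier_mat n n" "v \<in> carrier_vec n"
  shows "shift s X *\<^sub>v v = of_real s \<cdot>\<^sub>v v + of_real (1 - s) \<cdot>\<^sub>v (X *\<^sub>v v)"
proof -
  have "shift s X = mat_mean (1 - s) (1\<^sub>m n) X" using assms by (simp add: shift_def mat_mean_def)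
  then show ?thesis using mat_mean_mult_vec[of "1\<^sub>m n" n X v "1 - s"] assms by simp
qed

definition shift_inv :: "real \<Rightarrow> complex mat \<Rightarrow> complex mat" where
  "shift_inv s X = the (mat_inverse (shift s X))"

text \<open>Here \<open>hmean s X = X (s + (1 - s) X)\<^sup>-\<^sup>1\<close>.\<close>

definition hmean_form :: "real \<Rightarrow> complex mat \<Rightarrow> complex vec \<Rightarrow> real" where
  "hmean_form s X x = Re (sesq X (shift_inv s X *\<^sub>v x) x)"

lemma accretive_qform_pos:
  assumes "accretive X" "X \<in> carrier_mat n n" "x \<in> carrier_vec n" "x \<noteq> 0\<^sub>v n"
  shows "0 < qform X x"
  using pos_def_qform(2)[OF mat_Re_carrier[OF assms(2)] _ assms(3,4)] assms qform_mat_Re[OF assms(2,3)]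
  by (simp add: accretive_def)

lemma accretive_spectrum:
  assumes acc: "accretive X" and X: "X \<in> carrier_mat n n" and z: "z \<in> spectrum X"
  shows "0 < Re z"
proof -
  obtain v where "eigenvector X v z" using z by (auto simp: spectrum_def eigenvalue_def)
  then have v: "v \<in> carrier_vec n" "v \<noteq> 0\<^sub>v n" "X *\<^sub>v v = z \<cdot>\<^sub>v v" using X by (simp_all add: eigenvector_def)
  have "qform X v = Re (z * (v \<bullet>c v))"
    unfolding qform_def v(3) using v(1) by (simp only: cscalar_prod_smult_left)
  also have "\<dots> = Re z * Re (v \<bullet>c v)" by (simp add: cscalar_prod_self[OF v(1)])
  finally have "0 < Re z * Re (v \<bullet>c v)" using accretive_qform_pos[OF acc X v(1,2)] by simp
  then show ?thesis using cscalar_prod_self_pos[OF v(1,2)] by (simp add: zero_less_mult_iff)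
qed

context
  fixes X :: "complex mat" and n :: nat and s :: real
  assumes acc: "accretive X" and X: "X \<in> carrier_mat n n" and s: "0 \<le> s" "s \<le> 1"
begin

text \<open>A nonzero kernel vector \<open>v\<close> would annihilate
  \<open>s * Re (v \<bullet>c v) + (1 - s) * qform X v\<close>, a convex combination of two positive
  numbers.\<close>

lemma shift_inverse:
  "shift_inv s X \<in> carrier_mat n n" "shift s X * shift_inv s X = 1\<^sub>m n" "shift_inv s X * shift s X = 1\<^sub>m n"
proof -
  have "v = 0\<^sub>v n" if v: "v \<in> carrier_vec n" and eq: "shift s X *\<^sub>v v = 0\<^sub>v n" for v
  proof (rule ccontr)
    assume v0: "v \<noteq> 0\<^sub>v n"
    have Xv: "X *\<^sub>v v \<in> carrier_vec n" using X v by simp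
    have "(shift s X *\<^sub>v v) \<bullet>c v = of_real s * (v \<bullet>c v) + of_real (1 - s) * ((X *\<^sub>v v) \<bullet>c v)"
      unfolding shift_mult_vec[OF X v] using v Xv
      by (simp add: cscalar_prod_add_left[of _ n] cscalar_prod_smult_left[of _ n] del: of_real_diff index_mult_mat_vec)
    moreover have "(0\<^sub>v n :: complex vec) \<bullet>c v = 0" using v by (simp add: cscalar_prod_sum[of _ n])
    ultimately have "s * Re (v \<bullet>c v) + (1 - s) * qform X v = 0"
      unfolding eq qform_def by (simp add: complex_eq_iff)
    moreover have "0 < Re (v \<bullet>c v)" "0 < qform X v"
      using cscalar_prod_self_pos[OF v v0] accretive_qform_pos[OF acc X v v0] by blast+
    moreover have "0 < s * Re (v \<bullet>c v) + (1 - s) * qform X v"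
    proof (cases "s = 0")
      case False
      then have "0 < s * Re (v \<bullet>c v)" "0 \<le> (1 - s) * qform X v"
        using s calculation(2,3) by simp_all
      then show ?thesis by linarith
    qed (use calculation(3) in simp)
    ultimately show False by simp
  qed
  from square_mat_inverse_exists[OF shift_carrier[OF X] this]
  show "shift_inv s X \<in> carrier_mat n n" "shift s X * shift_inv s X = 1\<^sub>m n" "shift_inv s X * shift s X = 1\<^sub>m n"
    by (simp_all add: shift_inv_def)
qed

text \<open>With \<open>w = shift_inv s X *\<^sub>v x\<close> this is the splitting
  \<open>x = s w + (1 - s) X w\<close>, which attains the minimum when \<open>X\<close> is positive
  definite.\<close>

lemma shift_inv_mult_vec:
  assumes "x \<in> carrier_vec n"
  shows "shift_inv s X *\<^sub>v x \<in> carrier_vec n"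
    "x = of_real s \<cdot>\<^sub>v (shift_inv s X *\<^sub>v x) + of_real (1 - s) \<cdot>\<^sub>v (X *\<^sub>v (shift_inv s X *\<^sub>v x))"
proof -
  note Y = shift_inverse
  show w: "shift_inv s X *\<^sub>v x \<in> carrier_vec n" using Y(1) assms by simp
  have "x = (shift s X * shift_inv s X) *\<^sub>v x" unfolding Y(2) using assms by simp
  also have "\<dots> = shift s X *\<^sub>v (shift_inv s X *\<^sub>v x)"
    by (rule assoc_mult_mat_vec[OF shift_carrier[OF X] Y(1) assms])
  finally show "x = of_real s \<cdot>\<^sub>v (shift_inv s X *\<^sub>v x) + of_real (1 - s) \<cdot>\<^sub>v (X *\<^sub>v (shift_inv s X *\<^sub>v x))"
    unfolding shift_mult_vec[OF X w] .
qed

lemma shift_inv_commute: "shift_inv s X * X = X * shift_inv s X"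
proof -
  define Y T where "Y = shift_inv s X" and "T = shift s X"
  have Y: "Y \<in> carrier_mat n n" "T * Y = 1\<^sub>m n" "Y * T = 1\<^sub>m n"
    using shift_inverse by (simp_all add: Y_def T_def)
  have T: "T \<in> carrier_mat n n" unfolding T_def by (rule shift_carrier[OF X])
  note as = assoc_mult_mat[of _ n n _ n _ n]
  have TX: "X * T = T * X"
  proof -
    have "X * T = of_real s \<cdot>\<^sub>m X + of_real (1 - s) \<cdot>\<^sub>m (X * X)"
      unfolding T_def shift_def using X
      by (simp add: mult_add_distrib_mat[of _ n n _ n] mult_smult_distrib[of _ n n _ n])
    moreover have "T * X = of_real s \<cdot>\<^sub>m X + of_real (1 - s) \<cdot>\<^sub>m (X * X)"
      unfolding T_def shift_def using X
      by (simp add: add_mult_distrib_mat[of _ n n _ _ n] mult_smult_assoc_mat[of _ n n _ n])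
    ultimately show ?thesis by simp
  qed
  have "Y * X = Y * (X * (T * Y))" using X Y by simp
  also have "\<dots> = Y * ((X * T) * Y)" using X Y(1) T by (simp only: as mult_square_carrier)
  also have "\<dots> = (Y * T) * (X * Y)" unfolding TX using X Y(1) T by (simp only: as mult_square_carrier)
  also have "\<dots> = X * Y" using X Y by simp
  finally show ?thesis by (simp only: Y_def)
qed

lemma shift_inv_hermitian:
  assumes "hermitian X"
  shows "hermitian (shift_inv s X * X)"
proof -
  define Y T where "Y = shift_inv s X" and "T = shift s X"
  have Y: "Y \<in> carrier_mat n n" "T * Y = 1\<^sub>m n"
    using shift_inverse by (simp_all add: Y_def T_def)
  have T: "T \<in> carrier_mat n n" unfolding T_def by (rule shift_carrier[OF X])
  have adjX: "mat_adjoint X = X" using assms by (simp add: hermitian_def)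
  have "hermitian T"
  proof (rule hermitianI[OF T])
    fix i j assume "i < n" "j < n"
    then show "cnj (T $$ (j, i)) = T $$ (i, j)"
      using X hermitian_index[OF assms X, of i j] by (auto simp: T_def shift_def)
  qed
  then have adjT: "mat_adjoint T = T" by (simp add: hermitian_def)
  have Y': "mat_adjoint Y \<in> carrier_mat n n" using Y by simp
  have one: "mat_adjoint (1\<^sub>m n) = (1\<^sub>m n :: complex mat)" by (rule eq_matI) auto
  have "mat_adjoint (T * Y) = mat_adjoint Y * mat_adjoint T" by (rule mat_adjoint_mult[OF T Y(1)])
  then have YT: "mat_adjoint Y * T = 1\<^sub>m n" unfolding Y(2) one adjT by simp
  have "mat_adjoint Y = mat_adjoint Y * (T * Y)" unfolding Y(2) by (rule right_mult_one_mat[OF Y', symmetric])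
  also have "\<dots> = (mat_adjoint Y * T) * Y" by (rule assoc_mult_mat[symmetric, OF Y' T Y(1)])
  also have "\<dots> = Y" unfolding YT using Y by simp
  finally have adjY: "mat_adjoint Y = Y" .
  have "mat_adjoint (Y * X) = mat_adjoint X * mat_adjoint Y" by (rule mat_adjoint_mult[OF Y(1) X])
  also have "\<dots> = Y * X" unfolding adjX adjY using shift_inv_commute by (simp add: Y_def)
  finally show ?thesis using X Y by (simp add: hermitian_def Y_def)
qed

lemma circle_calc_hmean_shift:
  assumes "0 < r" "r < c" "spectrum X \<subseteq> ball (complex_of_real c) r"
  shows "circle_calc c r (hmean s) X = shift_inv s X * X"
proof (rule circle_calc_hmean[OF X assms s shift_inverse(1)])
  show "shift_inv s X * (of_real s \<cdot>\<^sub>m 1\<^sub>m n + of_real (1 - s) \<cdot>\<^sub>m X) = 1\<^sub>m n"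
    using shift_inverse(3) X by (simp add: shift_def)
qed

lemma qform_circle_calc_hmean:
  assumes r: "0 < r" "r < c" "spectrum X \<subseteq> ball (complex_of_real c) r" and x: "x \<in> carrier_vec n"
  shows "qform (circle_calc c r (hmean s) X) x = hmean_form s X x"
proof -
  have "(X * shift_inv s X) *\<^sub>v x = X *\<^sub>v (shift_inv s X *\<^sub>v x)"
    by (rule assoc_mult_mat_vec[OF X shift_inverse(1) x])
  then show ?thesis
    unfolding circle_calc_hmean_shift[OF r] shift_inv_commute qform_def hmean_form_def sesq_def by (simp only:)
qed

text \<open>The functional from \<open>hmean_variational\<close> at \<open>a = w\<close> and
  \<open>b = X w\<close>. The identity holds for every accretive \<open>X\<close>, which makes
  non-Hermitian matrices comparable with their Hermitian parts.\<close>

lemma hmean_form_expand: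
  assumes x: "x \<in> carrier_vec n"
  defines "w \<equiv> shift_inv s X *\<^sub>v x"
  shows "hmean_form s X x = s * qform X w + (1 - s) * Re ((X *\<^sub>v w) \<bullet>c (X *\<^sub>v w))"
proof -
  have w: "w \<in> carrier_vec n" and xw: "x = of_real s \<cdot>\<^sub>v w + of_real (1 - s) \<cdot>\<^sub>v (X *\<^sub>v w)"
    unfolding w_def using shift_inv_mult_vec[OF x] by blast+
  define v where "v = X *\<^sub>v w"
  have v: "v \<in> carrier_vec n" using X w by (simp add: v_def)
  have "v \<bullet>c x = of_real s * (v \<bullet>c w) + of_real (1 - s) * (v \<bullet>c v)"
    unfolding xw v_def[symmetric] using v w
    by (simp add: cscalar_prod_add_right[of _ n] cscalar_prod_smult_right[of _ n])
  then show ?thesis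
    unfolding hmean_form_def qform_def sesq_def w_def[symmetric] v_def[symmetric] by simp
qed

lemma hmean_form_variational:
  assumes herm: "hermitian X" and x: "x \<in> carrier_vec n" and a: "a \<in> carrier_vec n" and b: "b \<in> carrier_vec n"
    and dec: "x = of_real s \<cdot>\<^sub>v a + of_real (1 - s) \<cdot>\<^sub>v b"
  shows "hmean_form s X x \<le> s * qform X a + (1 - s) * Re (b \<bullet>c b)"
proof -
  have "mat_Re X = X"
    by (rule eq_matI) (use X hermitian_index[OF herm X] in \<open>auto simp: mat_Re_index[OF X] mat_Re_def\<close>)
  then have "pos_def X" using acc by (simp add: accretive_def)
  then show ?thesis
    unfolding hmean_form_def
    by (rule hmean_variational[OF X _ s shift_inv_mult_vec(1)[OF x] a b shift_inv_mult_vec(2)[OF x] dec])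
qed

end

section \<open>Accretive matrices under Hermitian parts and means\<close>

lemma mat_Re_mat_Re: "A \<in> carrier_mat n n \<Longrightarrow> mat_Re (mat_Re A) = mat_Re A"
proof (rule eq_matI)
  assume A: "A \<in> carrier_mat n n"
  note R = mat_Re_carrier[OF A] and RR = mat_Re_carrier[OF mat_Re_carrier[OF A]]
  show "dim_row (mat_Re (mat_Re A)) = dim_row (mat_Re A)" "dim_col (mat_Re (mat_Re A)) = dim_col (mat_Re A)"
    by (simp_all only: carrier_matD[OF R] carrier_matD[OF RR])
  fix i j assume "i < dim_row (mat_Re A)" "j < dim_col (mat_Re A)"
  then have ij: "i < n" "j < n" by (simp_all only: carrier_matD[OF R])
  show "mat_Re (mat_Re A) $$ (i, j) = mat_Re A $$ (i, j)"
    unfolding mat_Re_index[OF R ij] using hermitian_index[OF mat_Re_hermitian[OF A] R ij] by simp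
qed

lemma accretive_mat_Re:
  assumes "accretive A" "A \<in> carrier_mat n n"
  shows "accretive (mat_Re A)"
  using assms mat_Re_mat_Re[OF assms(2)] by (simp add: accretive_def carrier_matD[OF mat_Re_carrier[OF assms(2)]])

lemma mat_mean_index:
  "A \<in> carrier_mat n n \<Longrightarrow> B \<in> carrier_mat n n \<Longrightarrow> i < n \<Longrightarrow> j < n \<Longrightarrow>
    mat_mean t A B $$ (i, j) = of_real (1 - t) * A $$ (i, j) + of_real t * B $$ (i, j)"
  by (simp add: mat_mean_def)

lemma mat_Re_mean:
  assumes "A \<in> carrier_mat n n" "B \<in> carrier_mat n n"
  shows "mat_Re (mat_mean t A B) = mat_mean t (mat_Re A) (mat_Re B)"
proof (rule eq_matI)
  note C = mat_mean_carrier[OF assms, of t] and R = mat_Re_carrier[OF assms(1)] mat_Re_carrier[OF assms(2)]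
  note D = mat_mean_carrier[OF R, of t]
  show "dim_row (mat_Re (mat_mean t A B)) = dim_row (mat_mean t (mat_Re A) (mat_Re B))"
    "dim_col (mat_Re (mat_mean t A B)) = dim_col (mat_mean t (mat_Re A) (mat_Re B))"
    by (simp_all only: carrier_matD[OF mat_Re_carrier[OF C]] carrier_matD[OF D])
  fix i j assume "i < dim_row (mat_mean t (mat_Re A) (mat_Re B))" "j < dim_col (mat_mean t (mat_Re A) (mat_Re B))"
  then have ij: "i < n" "j < n" by (simp_all only: carrier_matD[OF D])
  show "mat_Re (mat_mean t A B) $$ (i, j) = mat_mean t (mat_Re A) (mat_Re B) $$ (i, j)"
    unfolding mat_Re_index[OF C ij] mat_mean_index[OF R ij] mat_mean_index[OF assms ij] mat_mean_index[OF assms ij(2,1)]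
      mat_Re_index[OF assms(1) ij] mat_Re_index[OF assms(2) ij]
    by (simp add: add_divide_distrib distrib_left del: of_real_diff)
qed

lemma accretive_mean:
  assumes A: "A \<in> carrier_mat n n" "accretive A" and B: "B \<in> carrier_mat n n" "accretive B" and t: "0 \<le> t" "t \<le> 1"
  shows "accretive (mat_mean t A B)"
proof -
  note C = mat_mean_carrier[OF A(1) B(1), of t]
  have "0 < qform (mat_Re (mat_mean t A B)) x" if x: "x \<in> carrier_vec n" "x \<noteq> 0\<^sub>v n" for x
  proof -
    have a: "0 < qform A x" and b: "0 < qform B x"
      using accretive_qform_pos A B x by blast+
    have "0 < (1 - t) * qform A x + t * qform B x"
    proof (cases "t = 0")
      case False
      then have "0 < t * qform B x" "0 \<le> (1 - t) * qform A x" using t a b by simp_all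
      then show ?thesis by linarith
    qed (use a in simp)
    then show ?thesis unfolding qform_mat_Re[OF C x(1)] qform_mean[OF A(1) B(1) x(1)] .
  qed
  then have "pos_def (mat_Re (mat_mean t A B))"
    unfolding pos_def_def qform_def[symmetric] using mat_Re_hermitian[OF C] mat_Re_carrier[OF C] by simp
  then show ?thesis using C by (simp add: accretive_def)
qed

text \<open>The numerical range only sees unit vectors; both sides are homogeneous of degree two, so
  normalizing \<open>u\<close> suffices.\<close>

lemma numerical_range_sector:
  assumes M: "M \<in> carrier_mat n n" and W: "numerical_range M \<subseteq> sector \<alpha>" and u: "u \<in> carrier_vec n"
  shows "\<bar>Im (sesq M u u)\<bar> \<le> tan \<alpha> * Re (sesq M u u)"
proof (cases "u = 0\<^sub>v n")
  case True
  have "sesq M (0\<^sub>v n) (0\<^sub>v n) = 0" unfolding sesq_def using M by (simp add: cscalar_prod_sum[of _ n])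
  then show ?thesis using True by simp
next
  case False
  define N where "N = Re (u \<bullet>c u)"
  have N: "0 < N" unfolding N_def by (rule cscalar_prod_self_pos[OF u False])
  have uu: "u \<bullet>c u = of_real N" by (simp add: N_def cscalar_prod_self[OF u])
  define v where "v = complex_of_real (1 / sqrt N) \<cdot>\<^sub>v u"
  have v: "v \<in> carrier_vec n" using u by (simp add: v_def)
  have sq: "complex_of_real (1 / sqrt N) * complex_of_real (1 / sqrt N) = of_real (1 / N)"
    unfolding of_real_mult[symmetric] using N by simp
  have "v \<bullet>c v = (complex_of_real (1 / sqrt N) * complex_of_real (1 / sqrt N)) * (u \<bullet>c u)"
    unfolding v_def using u
    by (simp only: cscalar_prod_smult_left[of _ n] cscalar_prod_smult_right[of _ n] smult_carrier_vec
        complex_cnj_complex_of_real mult.assoc)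
  then have vv: "v \<bullet>c v = 1" unfolding sq uu of_real_mult[symmetric] using N by simp
  have "sesq M v v = (complex_of_real (1 / sqrt N) * complex_of_real (1 / sqrt N)) * sesq M u u"
    unfolding v_def using u
    by (simp only: sesq_simps[OF M] smult_carrier_vec complex_cnj_complex_of_real mult.assoc)
  then have s: "sesq M v v = of_real (1 / N) * sesq M u u" unfolding sq .
  have "sesq M v v \<in> numerical_range M"
    unfolding numerical_range_def sesq_def by (intro CollectI exI[of _ v]) (use v M vv in simp)
  then have "sesq M v v \<in> sector \<alpha>" using W by blast
  then have "\<bar>1 / N * Im (sesq M u u)\<bar> \<le> tan \<alpha> * (1 / N * Re (sesq M u u))"
    unfolding s sector_def by simp
  then have "1 / N * \<bar>Im (sesq M u u)\<bar> \<le> 1 / N * (tan \<alpha> * Re (sesq M u u))"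
    using N by (simp add: abs_mult)
  then show ?thesis using N by (simp add: divide_le_cancel)
qed

text \<open>The decomposition of \<open>x\<close> belonging to \<open>M\<close> competes in the
  minimum for \<open>mat_Re M\<close>, and the functional has the same value there because
  \<open>qform\<close> depends only on the Hermitian part.\<close>

lemma hmean_form_lower:
  assumes M: "M \<in> carrier_mat n n" "accretive M" and s: "0 \<le> s" "s \<le> 1" and x: "x \<in> carrier_vec n"
  shows "hmean_form s (mat_Re M) x \<le> hmean_form s M x"
proof -
  define w where "w = shift_inv s M *\<^sub>v x"
  have w: "w \<in> carrier_vec n" and xw: "x = of_real s \<cdot>\<^sub>v w + of_real (1 - s) \<cdot>\<^sub>v (M *\<^sub>v w)"
    unfolding w_def using shift_inv_mult_vec[OF M(2,1) s x] by blast+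
  have Mw: "M *\<^sub>v w \<in> carrier_vec n" using M w by simp
  have "hmean_form s (mat_Re M) x \<le> s * qform (mat_Re M) w + (1 - s) * Re ((M *\<^sub>v w) \<bullet>c (M *\<^sub>v w))"
    by (rule hmean_form_variational[OF accretive_mat_Re[OF M(2,1)] mat_Re_carrier[OF M(1)] s mat_Re_hermitian[OF M(1)] x w Mw xw])
  also have "\<dots> = hmean_form s M x"
    unfolding qform_mat_Re[OF M(1) w] hmean_form_expand[OF M(2,1) s x] unfolding w_def ..
  finally show ?thesis .
qed

text \<open>The functional is affine in the matrix, so its minimum is concave: the minimizing
  decomposition for the mean competes for \<open>A\<close> and for \<open>B\<close>.\<close>

lemma hmean_form_concave:
  assumes A: "A \<in> carrier_mat n n" "accretive A" "hermitian A"
    and B: "B \<in> carrier_mat n n" "accretive B" "hermitian B"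
    and s: "0 \<le> s" "s \<le> 1" and t: "0 \<le> t" "t \<le> 1" and x: "x \<in> carrier_vec n"
  shows "(1 - t) * hmean_form s A x + t * hmean_form s B x \<le> hmean_form s (mat_mean t A B) x"
proof -
  note C = mat_mean_carrier[OF A(1) B(1), of t] and acc = accretive_mean[OF A(1,2) B(1,2) t]
  define w where "w = shift_inv s (mat_mean t A B) *\<^sub>v x"
  have w: "w \<in> carrier_vec n" and xw: "x = of_real s \<cdot>\<^sub>v w + of_real (1 - s) \<cdot>\<^sub>v (mat_mean t A B *\<^sub>v w)"
    unfolding w_def using shift_inv_mult_vec[OF acc C s x] by blast+
  have Cw: "mat_mean t A B *\<^sub>v w \<in> carrier_vec n" using C w by simp
  define N where "N = Re ((mat_mean t A B *\<^sub>v w) \<bullet>c (mat_mean t A B *\<^sub>v w))"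
  have "hmean_form s A x \<le> s * qform A w + (1 - s) * N"
    unfolding N_def by (rule hmean_form_variational[OF A(2,1) s A(3) x w Cw xw])
  then have a: "(1 - t) * hmean_form s A x \<le> (1 - t) * (s * qform A w + (1 - s) * N)"
    using t by (intro mult_left_mono) auto
  have "hmean_form s B x \<le> s * qform B w + (1 - s) * N"
    unfolding N_def by (rule hmean_form_variational[OF B(2,1) s B(3) x w Cw xw])
  then have b: "t * hmean_form s B x \<le> t * (s * qform B w + (1 - s) * N)"
    using t by (intro mult_left_mono) auto
  have "hmean_form s (mat_mean t A B) x = s * qform (mat_mean t A B) w + (1 - s) * N"
    unfolding hmean_form_expand[OF acc C s x] N_def w_def ..
  also have "\<dots> = (1 - t) * (s * qform A w + (1 - s) * N) + t * (s * qform B w + (1 - s) * N)"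
    unfolding qform_mean[OF A(1) B(1) w] by (simp add: algebra_simps)
  finally show ?thesis using a b by linarith
qed

text \<open>The form is the product of \<open>v = M w\<close> with \<open>x\<close>. Splitting
  \<open>x\<close> by the decomposition of the Hermitian part leaves two mixed terms, and Young's
  inequality with weight \<open>\<kappa>\<close> bounds twice their weighted sum by the form of
  \<open>M\<close> plus \<open>\<kappa>\<close> times that of \<open>H\<close>. One copy of the form
  of \<open>M\<close> then cancels.\<close>

lemma hmean_form_upper:
  assumes M: "M \<in> carrier_mat n n" "accretive M" and s: "0 \<le> s" "s \<le> 1" and x: "x \<in> carrier_vec n"
    and sec: "\<And>u. u \<in> carrier_vec n \<Longrightarrow> \<bar>Im (sesq M u u)\<bar> \<le> \<tau> * Re (sesq M u u)" and \<tau>: "0 \<le> \<tau>"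
  shows "hmean_form s M x \<le> (1 + \<tau>\<^sup>2) * hmean_form s (mat_Re M) x"
proof -
  define H where "H = mat_Re M"
  have H: "H \<in> carrier_mat n n" "accretive H" "hermitian H"
    unfolding H_def using mat_Re_carrier[OF M(1)] accretive_mat_Re[OF M(2,1)] mat_Re_hermitian[OF M(1)] by blast+
  have pd: "pos_def (mat_Re M)" using M by (simp add: accretive_def)
  define \<kappa> where "\<kappa> = 1 + \<tau>\<^sup>2"
  have \<kappa>: "0 < \<kappa>" by (simp add: \<kappa>_def add_pos_nonneg)
  define w where "w = shift_inv s M *\<^sub>v x"
  have w: "w \<in> carrier_vec n" unfolding w_def by (rule shift_inv_mult_vec(1)[OF M(2,1) s x])
  define w0 where "w0 = shift_inv s H *\<^sub>v x"
  have w0: "w0 \<in> carrier_vec n" and xw0: "x = of_real s \<cdot>\<^sub>v w0 + of_real (1 - s) \<cdot>\<^sub>v (H *\<^sub>v w0)"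
    unfolding w0_def using shift_inv_mult_vec[OF H(2,1) s x] by blast+
  define v v0 where "v = M *\<^sub>v w" and "v0 = H *\<^sub>v w0"
  have v: "v \<in> carrier_vec n" "v0 \<in> carrier_vec n" using M H w w0 by (simp_all add: v_def v0_def)
  \<comment> \<open>At weight \<open>0\<close> the shift is \<open>H\<close> itself, so
    \<open>z\<close> is \<open>H\<^sup>-\<^sup>1 v\<close>, the vector that
    \<open>sectorial_bound\<close> compares with \<open>w\<close>.\<close>
  define z where "z = shift_inv 0 H *\<^sub>v v"
  have z: "z \<in> carrier_vec n" and Hz: "H *\<^sub>v z = v"
  proof -
    have "z \<in> carrier_vec n" "v = of_real 0 \<cdot>\<^sub>v z + of_real (1 - 0) \<cdot>\<^sub>v (H *\<^sub>v z)"
      unfolding z_def using shift_inv_mult_vec[OF H(2,1), of 0 v] v by simp_all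
    moreover have "of_real 0 \<cdot>\<^sub>v z = 0\<^sub>v n" using calculation(1) by (intro eq_vecI) simp_all
    moreover have "H *\<^sub>v z \<in> carrier_vec n" using calculation(1) H(1) by simp
    ultimately show "z \<in> carrier_vec n" "H *\<^sub>v z = v" by simp_all
  qed
  have bound: "qform M z \<le> \<kappa> * qform M w"
    unfolding \<kappa>_def by (rule sectorial_bound[OF M(1) pd sec \<tau> w z]) (use Hz in \<open>simp_all add: H_def v_def\<close>)
  have k: "complex_of_real (- \<kappa>) \<cdot>\<^sub>v w0 \<in> carrier_vec n" "complex_of_real (- \<kappa>) \<cdot>\<^sub>v v0 \<in> carrier_vec n"
    using w0 v by simp_all
  have "0 \<le> qform H (z + of_real (- \<kappa>) \<cdot>\<^sub>v w0)"
    unfolding H_def using pos_def_qform(1)[OF mat_Re_carrier[OF M(1)] pd] z k by simp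
  also have "\<dots> = qform H z - 2 * \<kappa> * Re (v \<bullet>c w0) + \<kappa>\<^sup>2 * qform H w0"
  proof -
    have "sesq H z w0 = v \<bullet>c w0" by (simp add: sesq_def Hz)
    moreover have "sesq H w0 z = cnj (sesq H z w0)" by (rule sesq_hermitian[OF H(1,3) z w0])
    ultimately show ?thesis
      unfolding qform_sesq using z w0 k by (simp add: sesq_simps[OF H(1)] power2_eq_square algebra_simps)
  qed
  finally have "2 * \<kappa> * Re (v \<bullet>c w0) \<le> \<kappa> * qform M w + \<kappa>\<^sup>2 * qform H w0"
    using bound qform_mat_Re[OF M(1) z] by (simp add: H_def)
  then have "\<kappa> * (2 * Re (v \<bullet>c w0)) \<le> \<kappa> * (qform M w + \<kappa> * qform H w0)"
    by (simp add: power2_eq_square algebra_simps)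
  then have 1: "2 * Re (v \<bullet>c w0) \<le> qform M w + \<kappa> * qform H w0" using \<kappa> by simp
  have "0 \<le> Re ((v + of_real (- \<kappa>) \<cdot>\<^sub>v v0) \<bullet>c (v + of_real (- \<kappa>) \<cdot>\<^sub>v v0))" by (rule cscalar_prod_self_nonneg)
  also have "\<dots> = Re (v \<bullet>c v) - 2 * \<kappa> * Re (v \<bullet>c v0) + \<kappa>\<^sup>2 * Re (v0 \<bullet>c v0)"
    using v k by (simp add: cscalar_prod_add_left[of _ n] cscalar_prod_add_right[of _ n] cscalar_prod_smult_left[of _ n]
        cscalar_prod_smult_right[of _ n] cscalar_prod_swap[OF v] power2_eq_square algebra_simps)
  \<comment> \<open>The sector condition enters only through the other mixed term; here
    \<open>1 \<le> \<kappa>\<close> is enough.\<close>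
  also have "\<dots> \<le> \<kappa> * Re (v \<bullet>c v) - 2 * \<kappa> * Re (v \<bullet>c v0) + \<kappa>\<^sup>2 * Re (v0 \<bullet>c v0)"
    using cscalar_prod_self_nonneg[of v] by (simp add: \<kappa>_def distrib_right)
  finally have "\<kappa> * (2 * Re (v \<bullet>c v0)) \<le> \<kappa> * (Re (v \<bullet>c v) + \<kappa> * Re (v0 \<bullet>c v0))"
    by (simp add: power2_eq_square algebra_simps)
  then have 2: "2 * Re (v \<bullet>c v0) \<le> Re (v \<bullet>c v) + \<kappa> * Re (v0 \<bullet>c v0)" using \<kappa> by simp
  have "hmean_form s M x = Re (v \<bullet>c x)" by (simp add: hmean_form_def sesq_def v_def w_def)
  also have "\<dots> = s * Re (v \<bullet>c w0) + (1 - s) * Re (v \<bullet>c v0)"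
    unfolding xw0 v0_def[symmetric] using v w0
    by (simp add: cscalar_prod_add_right[of _ n] cscalar_prod_smult_right[of _ n])
  finally have "2 * hmean_form s M x = s * (2 * Re (v \<bullet>c w0)) + (1 - s) * (2 * Re (v \<bullet>c v0))" by simp
  also have "\<dots> \<le> s * (qform M w + \<kappa> * qform H w0) + (1 - s) * (Re (v \<bullet>c v) + \<kappa> * Re (v0 \<bullet>c v0))"
    using 1 2 s by (intro add_mono mult_left_mono) auto
  also have "\<dots> = (s * qform M w + (1 - s) * Re (v \<bullet>c v)) + \<kappa> * (s * qform H w0 + (1 - s) * Re (v0 \<bullet>c v0))"
    by (simp add: algebra_simps)
  also have "\<dots> = hmean_form s M x + \<kappa> * hmean_form s H x"
    unfolding hmean_form_expand[OF M(2,1) s x] hmean_form_expand[OF H(2,1) s x] w_def v_def w0_def v0_def ..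
  finally show ?thesis by (simp add: \<kappa>_def H_def)
qed

section \<open>The inequality for matrix concave functions\<close>

lemma qform_tendsto:
  assumes K: "\<And>k::nat. K k \<in> carrier_mat n n" and L: "L \<in> carrier_mat n n" and x: "x \<in> carrier_vec n"
    and lim: "\<And>i j. i < n \<Longrightarrow> j < n \<Longrightarrow> (\<lambda>k. K k $$ (i, j)) \<longlonglongrightarrow> L $$ (i, j)"
  shows "(\<lambda>k. qform (K k) x) \<longlonglongrightarrow> qform L x"
  unfolding qform_sum[OF K x] qform_sum[OF L x]
  by (intro tendsto_Re tendsto_sum tendsto_mult tendsto_const lim) auto

lemma hermitian_limit:
  assumes K: "\<And>k::nat. K k \<in> carrier_mat n n" "\<And>k. hermitian (K k)" and L: "L \<in> carrier_mat n n"
    and lim: "\<And>i j. i < n \<Longrightarrow> j < n \<Longrightarrow> (\<lambda>k. K k $$ (i, j)) \<longlonglongrightarrow> L $$ (i, j)"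
  shows "hermitian L"
proof (rule hermitianI[OF L])
  fix i j assume ij: "i < n" "j < n"
  have "(\<lambda>k. cnj (K k $$ (j, i))) \<longlonglongrightarrow> cnj (L $$ (j, i))"
    by (intro tendsto_cnj lim ij)
  then have "(\<lambda>k. K k $$ (i, j)) \<longlonglongrightarrow> cnj (L $$ (j, i))"
    by (simp only: hermitian_index[OF K(2,1) ij])
  then show "cnj (L $$ (j, i)) = L $$ (i, j)" using lim[OF ij] LIMSEQ_unique by blast
qed

lemma hermitian_mean:
  assumes A: "A \<in> carrier_mat n n" "hermitian A" and B: "B \<in> carrier_mat n n" "hermitian B"
  shows "hermitian (mat_mean t A B)"
proof (rule hermitianI[OF mat_mean_carrier[OF A(1) B(1)]])
  fix i j assume ij: "i < n" "j < n"
  show "cnj (mat_mean t A B $$ (j, i)) = mat_mean t A B $$ (i, j)"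
    unfolding mat_mean_index[OF A(1) B(1) ij] mat_mean_index[OF A(1) B(1) ij(2,1)]
    by (simp add: hermitian_index[OF A(2,1) ij] hermitian_index[OF B(2,1) ij] del: of_real_diff)
qed

lemma hermitian_add:
  assumes A: "A \<in> carrier_mat n n" "hermitian A" and B: "B \<in> carrier_mat n n" "hermitian B"
  shows "hermitian (A + B)"
  by (rule hermitianI[of _ n]) (use A B hermitian_index[OF A(2,1)] hermitian_index[OF B(2,1)] in simp_all)

lemma hermitian_smult:
  assumes A: "A \<in> carrier_mat n n" "hermitian A"
  shows "hermitian (complex_of_real a \<cdot>\<^sub>m A)"
  by (rule hermitianI[of _ n]) (use A hermitian_index[OF A(2,1)] in simp_all)

text \<open>\<open>shift_inv s H\<close> is Hermitian and commutes with \<open>H\<close>, so the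
  generators have Hermitian values, and real mixtures preserve this.\<close>

lemma hermitian_circle_calc:
  assumes g: "g \<in> hmean_hull" and H: "H \<in> carrier_mat n n" "accretive H" "hermitian H"
    and r: "0 < r" "r < c" "spectrum H \<subseteq> ball (complex_of_real c) r"
  shows "hermitian (circle_calc c r g H)"
  using g
proof (induction rule: hmean_hull.induct)
  case (hmean s)
  show ?case
    unfolding circle_calc_hmean_shift[OF H(2,1) hmean r] by (rule shift_inv_hermitian[OF H(2,1) hmean H(3)])
next
  case (mix g h u)
  show ?case
    unfolding circle_calc_mix[OF H(1) r hmean_hull_holomorphic[OF mix(1)] hmean_hull_holomorphic[OF mix(2)]]
    by (rule hermitian_mean[OF circle_calc_carrier[OF H(1) r] mix(5) circle_calc_carrier[OF H(1) r] mix(6)])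
qed

lemma hmean_form_inequality:
  assumes A: "A \<in> carrier_mat n n" "accretive A" and B: "B \<in> carrier_mat n n" "accretive B"
    and WA: "numerical_range A \<subseteq> sector \<alpha>" and WB: "numerical_range B \<subseteq> sector \<alpha>" and alpha: "0 \<le> tan \<alpha>"
    and s: "0 \<le> s" "s \<le> 1" and t: "0 \<le> t" "t \<le> 1" and x: "x \<in> carrier_vec n"
  defines "\<kappa> \<equiv> 1 + (tan \<alpha>)\<^sup>2"
  shows "(1 - t) * hmean_form s A x + t * hmean_form s B x + 2 * min t (1 - t) * \<kappa> *
      (hmean_form s (mat_mean (1 / 2) (mat_Re A) (mat_Re B)) x
        - ((1 - 1 / 2) * hmean_form s (mat_Re A) x + 1 / 2 * hmean_form s (mat_Re B) x))
    \<le> \<kappa> * hmean_form s (mat_mean t A B) x"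
proof -
  define HA HB where "HA = mat_Re A" and "HB = mat_Re B"
  have HA: "HA \<in> carrier_mat n n" "accretive HA" "hermitian HA"
    unfolding HA_def using mat_Re_carrier[OF A(1)] accretive_mat_Re[OF A(2,1)] mat_Re_hermitian[OF A(1)] by blast+
  have HB: "HB \<in> carrier_mat n n" "accretive HB" "hermitian HB"
    unfolding HB_def using mat_Re_carrier[OF B(1)] accretive_mat_Re[OF B(2,1)] mat_Re_hermitian[OF B(1)] by blast+
  define Hh where "Hh = mat_mean (1 / 2) HA HB"
  have Hh: "Hh \<in> carrier_mat n n" "accretive Hh" "hermitian Hh"
    unfolding Hh_def using HA HB by (auto intro: accretive_mean hermitian_mean)
  have \<kappa>: "0 \<le> \<kappa>" by (simp add: \<kappa>_def)
  let ?h = "\<lambda>X. hmean_form s X x"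
  have a: "(1 - t) * ?h A \<le> (1 - t) * (\<kappa> * ?h HA)"
    unfolding \<kappa>_def HA_def using t
    by (intro mult_left_mono hmean_form_upper[OF A s x] numerical_range_sector[OF A(1) WA] alpha) auto
  have b: "t * ?h B \<le> t * (\<kappa> * ?h HB)"
    unfolding \<kappa>_def HB_def using t
    by (intro mult_left_mono hmean_form_upper[OF B s x] numerical_range_sector[OF B(1) WB] alpha) auto
  have low: "?h (mat_mean t HA HB) \<le> ?h (mat_mean t A B)"
    using hmean_form_lower[OF mat_mean_carrier[OF A(1) B(1)] accretive_mean[OF A B t] s x]
    unfolding mat_Re_mean[OF A(1) B(1)] HA_def HB_def .
  \<comment> \<open>The mean with weight \<open>t\<close> is rewritten as a mean of the midpoint
    \<open>Hh\<close> with the nearer endpoint: weight \<open>2 * t\<close> from \<open>HA\<close>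
    if \<open>t \<le> 1 / 2\<close>, weight \<open>2 * t - 1\<close> towards \<open>HB\<close>
    otherwise.\<close>
  have conc: "(1 - t) * ?h HA + t * ?h HB + 2 * min t (1 - t) * (?h Hh - ((1 - 1 / 2) * ?h HA + 1 / 2 * ?h HB))
      \<le> ?h (mat_mean t HA HB)"
  proof (cases "t \<le> 1 / 2")
    case True
    have eq: "mat_mean (2 * t) HA Hh = mat_mean t HA HB"
      by (rule eq_matI) (use HA HB in \<open>auto simp: Hh_def mat_mean_def algebra_simps\<close>)
    have "(1 - 2 * t) * ?h HA + 2 * t * ?h Hh \<le> ?h (mat_mean (2 * t) HA Hh)"
      by (rule hmean_form_concave[OF HA Hh s _ _ x]) (use t True in auto)
    moreover have "min t (1 - t) = t" using True by simp
    ultimately show ?thesis unfolding eq by (simp add: algebra_simps)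
  next
    case False
    have eq: "mat_mean (2 * t - 1) Hh HB = mat_mean t HA HB"
      by (rule eq_matI) (use HA HB in \<open>auto simp: Hh_def mat_mean_def algebra_simps\<close>)
    have "(1 - (2 * t - 1)) * ?h Hh + (2 * t - 1) * ?h HB \<le> ?h (mat_mean (2 * t - 1) Hh HB)"
      by (rule hmean_form_concave[OF Hh HB s _ _ x]) (use t False in auto)
    moreover have "min t (1 - t) = 1 - t" using False by simp
    ultimately show ?thesis unfolding eq by (simp add: algebra_simps)
  qed
  have "(1 - t) * ?h A + t * ?h B + 2 * min t (1 - t) * \<kappa> * (?h Hh - ((1 - 1 / 2) * ?h HA + 1 / 2 * ?h HB))
      \<le> \<kappa> * ((1 - t) * ?h HA + t * ?h HB + 2 * min t (1 - t) * (?h Hh - ((1 - 1 / 2) * ?h HA + 1 / 2 * ?h HB)))"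
    using a b by (simp add: algebra_simps)
  also have "\<dots> \<le> \<kappa> * ?h (mat_mean t A B)"
    using conc low \<kappa> by (intro mult_left_mono) linarith+
  finally show ?thesis unfolding Hh_def HA_def HB_def .
qed

theorem theorem2p4:
  fixes f :: "real \<Rightarrow> real" and A B :: "complex mat" and n :: nat and \<alpha> t r :: real
  assumes f_pos: "\<And>x. 0 < x \<Longrightarrow> 0 < f x"
    and f_concave: "matrix_concave f"
    and f_one: "f 1 = 1"
    and A: "A \<in> carrier_mat n n" and B: "B \<in> carrier_mat n n"
    and accA: "accretive A" and accB: "accretive B"
    and alpha: "0 \<le> \<alpha>" "\<alpha> < pi / 2"
    and WA: "numerical_range A \<subseteq> sector \<alpha>" and WB: "numerical_range B \<subseteq> sector \<alpha>"
    and t: "0 \<le> t" "t \<le> 1"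
    and r: "r = min t (1 - t)"
  shows "mat_Re (mat_mean t (mat_fun f A) (mat_fun f B)) +
      complex_of_real (2 * r * (1 / cos \<alpha>)\<^sup>2) \<cdot>\<^sub>m
        (mat_fun f (mat_Re (mat_mean (1 / 2) A B)) -
          mat_mean (1 / 2) (mat_fun f (mat_Re A)) (mat_fun f (mat_Re B)))
    \<le>\<^sub>L complex_of_real ((1 / cos \<alpha>)\<^sup>2) \<cdot>\<^sub>m mat_Re (mat_fun f (mat_mean t A B))"
proof -
  define HA HB Hh Ct where "HA = mat_Re A" and "HB = mat_Re B"
    and "Hh = mat_mean (1 / 2) HA HB" and "Ct = mat_mean t A B"
  have HA: "HA \<in> carrier_mat n n" "accretive HA" "hermitian HA"
    unfolding HA_def using mat_Re_carrier[OF A] accretive_mat_Re[OF accA A] mat_Re_hermitian[OF A] by blast+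
  have HB: "HB \<in> carrier_mat n n" "accretive HB" "hermitian HB"
    unfolding HB_def using mat_Re_carrier[OF B] accretive_mat_Re[OF accB B] mat_Re_hermitian[OF B] by blast+
  have Hh: "Hh \<in> carrier_mat n n" "accretive Hh" "hermitian Hh"
    unfolding Hh_def using HA HB by (auto intro: accretive_mean hermitian_mean)
  have Ct: "Ct \<in> carrier_mat n n" "accretive Ct"
    unfolding Ct_def using A B accretive_mean[OF A accA B accB t] by simp_all
  have Hh_eq: "mat_Re (mat_mean (1 / 2) A B) = Hh" unfolding Hh_def HA_def HB_def by (rule mat_Re_mean[OF A B])
  \<comment> \<open>All six matrices share one circle, so a single approximating sequence serves
    every term of the inequality.\<close>
  define \<M> where "\<M> = {A, B, HA, HB, Hh, Ct}"
  have \<M>: "X \<in> carrier_mat n n" "accretive X" if "X \<in> \<M>" for X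
    using that A B accA accB HA HB Hh Ct unfolding \<M>_def by auto
  have "\<exists>c r. 0 < r \<and> r < c \<and> (\<Union>X\<in>\<M>. spectrum X) \<subseteq> ball (complex_of_real c) r"
  proof (rule finite_in_circle)
    have "finite \<M>" by (simp add: \<M>_def)
    then show "finite (\<Union>X\<in>\<M>. spectrum X)" using finite_spectrum[OF \<M>(1)] by (intro finite_UN_I)
    show "0 < Re z" if "z \<in> (\<Union>X\<in>\<M>. spectrum X)" for z
      using that accretive_spectrum[OF \<M>(2) \<M>(1)] by blast
  qed
  then obtain c \<rho> where \<rho>: "0 < \<rho>" "\<rho> < c" and sp: "\<And>X. X \<in> \<M> \<Longrightarrow> spectrum X \<subseteq> ball (complex_of_real c) \<rho>"
    by blast
  note mono = matrix_concave_imp_rank_one_monotone[OF f_concave f_pos]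
  note conc = matrix_concave_imp_concave_on[OF f_concave]
  note ext = analytic_ext_limit[OF mono f_pos f_one concave_linear_growth[OF conc f_pos] concave_on_continuous[OF conc]]
  obtain g where g: "\<And>k. g k \<in> hmean_hull"
    and unif: "\<And>K. compact K \<Longrightarrow> K \<subseteq> - \<real>\<^sub>\<le>\<^sub>0 \<Longrightarrow> uniform_limit K g (analytic_ext f) sequentially"
    using ext(2) by blast
  define Q where "Q h X = circle_calc c \<rho> h X" for h X
  have Q: "Q h X \<in> carrier_mat n n" if "X \<in> \<M>" for h X
    unfolding Q_def by (rule circle_calc_carrier[OF \<M>(1)[OF that] \<rho> sp[OF that]])
  have F: "mat_fun f X = Q (analytic_ext f) X" if "X \<in> \<M>" for X
    unfolding Q_def by (rule mat_fun_eq_circle_calc[OF \<M>(1)[OF that] \<rho> sp[OF that] ext(1)])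
  have lim: "(\<lambda>k. Q (g k) X $$ (i, j)) \<longlonglongrightarrow> Q (analytic_ext f) X $$ (i, j)"
    if X: "X \<in> \<M>" and ij: "i < n" "j < n" for X i j
  proof -
    have "uniform_limit (sphere (complex_of_real c) \<rho>) g (analytic_ext f) sequentially"
      by (rule unif[OF compact_sphere sphere_slit_plane[OF \<M>(1)[OF X] \<rho> sp[OF X]]])
    from circle_calc_limit[OF \<M>(1)[OF X] \<rho> sp[OF X] hmean_hull_holomorphic[OF g] ext(1) this ij]
    show ?thesis unfolding Q_def .
  qed
  have mem: "A \<in> \<M>" "B \<in> \<M>" "HA \<in> \<M>" "HB \<in> \<M>" "Hh \<in> \<M>" "Ct \<in> \<M>" by (simp_all add: \<M>_def)
  have "0 < cos \<alpha>" using alpha by (intro cos_gt_zero_pi) auto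
  then have \<kappa>: "(1 / cos \<alpha>)\<^sup>2 = 1 + (tan \<alpha>)\<^sup>2" using tan_sec[of \<alpha>] by (simp add: power_divide inverse_eq_divide)
  have tan0: "0 \<le> tan \<alpha>"
  proof (cases "\<alpha> = 0")
    case False
    then show ?thesis using alpha tan_gt_zero[of \<alpha>] by simp
  qed simp
  define \<kappa> where "\<kappa> = 1 + (tan \<alpha>)\<^sup>2"
  \<comment> \<open>For fixed \<open>x\<close> both sides are linear in \<open>h\<close>, so
    mixtures inherit the inequality from the functions \<open>hmean s\<close>.\<close>
  have main: "(1 - t) * qform (Q h A) x + t * qform (Q h B) x + 2 * r * \<kappa> *
      (qform (Q h Hh) x - ((1 - 1 / 2) * qform (Q h HA) x + 1 / 2 * qform (Q h HB) x)) \<le> \<kappa> * qform (Q h Ct) x"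
    if h: "h \<in> hmean_hull" and x: "x \<in> carrier_vec n" for h x
    using h
  proof (induction rule: hmean_hull.induct)
    case (hmean s)
    have val: "qform (Q (hmean s) X) x = hmean_form s X x" if "X \<in> \<M>" for X
      unfolding Q_def by (rule qform_circle_calc_hmean[OF \<M>(2,1)[OF that] hmean \<rho> sp[OF that] x])
    show ?case
      unfolding val[OF mem(1)] val[OF mem(2)] val[OF mem(3)] val[OF mem(4)] val[OF mem(5)] val[OF mem(6)]
      unfolding \<kappa>_def r HA_def HB_def Hh_def Ct_def
      by (rule hmean_form_inequality[OF A accA B accB WA WB tan0 hmean t x])
  next
    case (mix h1 h2 u)
    have val: "qform (Q (\<lambda>z. of_real (1 - u) * h1 z + of_real u * h2 z) X) x
        = (1 - u) * qform (Q h1 X) x + u * qform (Q h2 X) x" if X: "X \<in> \<M>" for X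
      unfolding Q_def circle_calc_mix[OF \<M>(1)[OF X] \<rho> sp[OF X] hmean_hull_holomorphic[OF mix(1)] hmean_hull_holomorphic[OF mix(2)]]
      by (rule qform_mean[OF Q[OF X, unfolded Q_def] Q[OF X, unfolded Q_def] x])
    from mult_left_mono[OF mix(5), of "1 - u"] mult_left_mono[OF mix(6), of u] mix(3,4)
    show ?case
      unfolding val[OF mem(1)] val[OF mem(2)] val[OF mem(3)] val[OF mem(4)] val[OF mem(5)] val[OF mem(6)]
      by (simp add: algebra_simps)
  qed
  define G where "G = analytic_ext f"
  have qlim: "(\<lambda>k. qform (Q (g k) X) x) \<longlonglongrightarrow> qform (Q G X) x" if X: "X \<in> \<M>" and x: "x \<in> carrier_vec n" for X x
    unfolding G_def by (rule qform_tendsto[OF Q[OF X] Q[OF X] x lim[OF X]])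
  have final: "(1 - t) * qform (Q G A) x + t * qform (Q G B) x + 2 * r * \<kappa> *
      (qform (Q G Hh) x - ((1 - 1 / 2) * qform (Q G HA) x + 1 / 2 * qform (Q G HB) x)) \<le> \<kappa> * qform (Q G Ct) x"
    if x: "x \<in> carrier_vec n" for x
  proof (rule tendsto_le[OF sequentially_bot _ _ always_eventually[OF allI[OF main[OF g x]]]])
    show "(\<lambda>k. \<kappa> * qform (Q (g k) Ct) x) \<longlonglongrightarrow> \<kappa> * qform (Q G Ct) x"
      by (intro tendsto_intros qlim mem x)
    show "(\<lambda>k. (1 - t) * qform (Q (g k) A) x + t * qform (Q (g k) B) x + 2 * r * \<kappa> *
        (qform (Q (g k) Hh) x - ((1 - 1 / 2) * qform (Q (g k) HA) x + 1 / 2 * qform (Q (g k) HB) x)))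
      \<longlonglongrightarrow> (1 - t) * qform (Q G A) x + t * qform (Q G B) x + 2 * r * \<kappa> *
        (qform (Q G Hh) x - ((1 - 1 / 2) * qform (Q G HA) x + 1 / 2 * qform (Q G HB) x))"
      by (intro tendsto_add tendsto_mult tendsto_diff tendsto_const qlim mem x)
  qed
  \<comment> \<open>The Loewner order requires both sides to be Hermitian; for the terms outside
    \<open>mat_Re\<close> this passes from the approximants to the limit.\<close>
  have herm: "hermitian (Q G X)" if X: "X \<in> \<M>" and hX: "hermitian X" for X
  proof (rule hermitian_limit[OF Q[OF X] _ Q[OF X]])
    show "hermitian (Q (g k) X)" for k
      unfolding Q_def by (rule hermitian_circle_calc[OF g \<M>(1,2)[OF X] hX \<rho> sp[OF X]])
    show "(\<lambda>k. Q (g k) X $$ (i, j)) \<longlonglongrightarrow> Q G X $$ (i, j)" if "i < n" "j < n" for i j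
      unfolding G_def by (rule lim[OF X that])
  qed
  note QA = Q[OF mem(1), of G] and QB = Q[OF mem(2), of G] and QHA = Q[OF mem(3), of G]
    and QHB = Q[OF mem(4), of G] and QHh = Q[OF mem(5), of G] and QCt = Q[OF mem(6), of G]
  note M1 = mat_mean_carrier[OF QA QB, of t] and M2 = mat_mean_carrier[OF QHA QHB, of "1 / 2"]
  have D: "Q G Hh - mat_mean (1 / 2) (Q G HA) (Q G HB) \<in> carrier_mat n n" by (rule minus_carrier_mat[OF M2])
  have D': "complex_of_real (2 * r * \<kappa>) \<cdot>\<^sub>m (Q G Hh - mat_mean (1 / 2) (Q G HA) (Q G HB)) \<in> carrier_mat n n"
    by (rule smult_carrier_mat[OF D])
  have L: "mat_Re (mat_mean t (Q G A) (Q G B)) +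
      complex_of_real (2 * r * \<kappa>) \<cdot>\<^sub>m (Q G Hh - mat_mean (1 / 2) (Q G HA) (Q G HB)) \<in> carrier_mat n n"
    by (rule add_carrier_mat[OF D'])
  have R: "complex_of_real \<kappa> \<cdot>\<^sub>m mat_Re (Q G Ct) \<in> carrier_mat n n"
    by (rule smult_carrier_mat[OF mat_Re_carrier[OF QCt]])
  have "mat_Re (mat_mean t (Q G A) (Q G B)) +
      complex_of_real (2 * r * \<kappa>) \<cdot>\<^sub>m (Q G Hh - mat_mean (1 / 2) (Q G HA) (Q G HB))
    \<le>\<^sub>L complex_of_real \<kappa> \<cdot>\<^sub>m mat_Re (Q G Ct)"
    unfolding loewner_le_iff_qform[OF L R]
  proof (intro conjI ballI)
    show "hermitian (mat_Re (mat_mean t (Q G A) (Q G B)) +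
        complex_of_real (2 * r * \<kappa>) \<cdot>\<^sub>m (Q G Hh - mat_mean (1 / 2) (Q G HA) (Q G HB)))"
      by (intro hermitian_add[OF mat_Re_carrier[OF M1] mat_Re_hermitian[OF M1] D'] hermitian_smult[OF D]
          hermitian_minus[OF QHh _ M2] hermitian_mean[OF QHA _ QHB] herm mem HA HB Hh)
    show "hermitian (complex_of_real \<kappa> \<cdot>\<^sub>m mat_Re (Q G Ct))"
      by (rule hermitian_smult[OF mat_Re_carrier[OF QCt] mat_Re_hermitian[OF QCt]])
    fix x :: "complex vec" assume x: "x \<in> carrier_vec n"
    show "qform (mat_Re (mat_mean t (Q G A) (Q G B)) +
        complex_of_real (2 * r * \<kappa>) \<cdot>\<^sub>m (Q G Hh - mat_mean (1 / 2) (Q G HA) (Q G HB))) x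
      \<le> qform (complex_of_real \<kappa> \<cdot>\<^sub>m mat_Re (Q G Ct)) x"
      using final[OF x]
      unfolding qform_add[OF mat_Re_carrier[OF M1] D' x] qform_mat_Re[OF M1 x] qform_mean[OF QA QB x]
        qform_smult[OF D x] qform_minus[OF QHh M2 x] qform_mean[OF QHA QHB x]
        qform_smult[OF mat_Re_carrier[OF QCt] x] qform_mat_Re[OF QCt x] .
  qed
  then show ?thesis
    unfolding Hh_eq HA_def[symmetric] HB_def[symmetric] Ct_def[symmetric] \<kappa> \<kappa>_def[symmetric]
      F[OF mem(1)] F[OF mem(2)] F[OF mem(3)] F[OF mem(4)] F[OF mem(5)] F[OF mem(6)] G_def[symmetric] .
qed

end
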